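(* Let $1\le\ell\le n$ be integers, let $X,X_0\sim\mathscr N_{\ell\times n}(0,\mathrm{Id}_\ell\otimes\mathrm{Id}_n)$ be independent, and let $R$ be a deterministic symmetric real $n\times n$ matrix such that $\mathrm{Id}_n-R^2$ is positive semidefinite. Let $Y$ be a random $\ell\times n$ matrix such that $(X,Y)$ has the same distribution as $(X,\,XR+X_0(\mathrm{Id}_n-R^2)^{1/2})$. Then, for all integers $k,l\ge0$ and all partitions $\kappa\vdash k$, $\sigma\vdash l$, $$\mathbb E\big[H_\kappa^{(\ell,n)}(X)H_\sigma^{(\ell,n)}(Y)\big]=\mathbb I\{\kappa=\sigma\}\cdot4^{-k}\Big(\frac n2\Big)_\kappa^{-1}k!\;C_\kappa(R^2)\,\frac{C_\kappa(\mathrm{Id}_\ell)}{C_\kappa(\mathrm{Id}_n)}.$$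
   Context: $X\sim\mathscr N_{\ell\times n}(0,\mathrm{Id}_\ell\otimes\mathrm{Id}_n)$ means that $X$ is an $\ell\times n$ matrix with i.i.d. standard normal entries. $\mathbb I\{\cdot\}$ is the indicator. $B^{1/2}$ denotes the positive semidefinite square root. **Partitions, zonal polynomials.** $\kappa\vdash k$ means that $\kappa=(k_1\ge k_2\ge\cdots)$ is a partition of $k$ into at most $\ell$ positive parts ($\kappa=(0)$ if $k=0$). For a real symmetric $m\times m$ matrix variable $S$ (both $m=\ell$ and $m=n$ occur), the space of homogeneous polynomials of degree $k$ in the entries of $S$, with $\mathrm{GL}_m(\mathbb R)$ acting by $(L\cdot P)(S)=P(L^{-1}S(L^{-1})^T)$, is the direct sum of irreducible invariant subspaces $V_\kappa$ indexed by the partitions $\kappa$ of $k$ into at most $m$ parts, $V_\kappa$ being the one containing $\prod_j\Delta_j(S)^{k_j-k_{j+1}}$ ($\Delta_j$ = $j$-th leading principal minor). The zonal polynomial $C_\kappa(S)$ is the component of $(\mathrm{tr}\,S)^k$ in $V_\kappa$; thus $(\mathrm{tr}\,S)^k=\sum_\kappa C_\kappa(S)$. It is a homogeneous symmetric polynomial of degree $k$ in the eigenvalues of $S$. Generalized binomial coefficients $\binom{\kappa}{\sigma}$ are defined by $\frac{C_\kappa(S+\mathrm{Id}_\ell)}{C_\kappa(\mathrm{Id}_\ell)}=\sum_{s=0}^k\sum_{\sigma\vdash s}\binom{\kappa}{\sigma}\frac{C_\sigma(S)}{C_\sigma(\mathrm{Id}_\ell)}$ ($S$ of size $\ell$). Generalized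 Pochhammer symbol: $(a)_\kappa=\prod_{j=1}^\ell (a-\frac{j-1}{2})_{k_j}$ with $(a)_r=a(a+1)\cdots(a+r-1)$. **Laguerre and Hermite polynomials.** For $\gamma>-1$ and $S$ of size $\ell$, $L_\kappa^{(\gamma)}(S)=(\gamma+\frac{\ell+1}2)_\kappa C_\kappa(\mathrm{Id}_\ell)\sum_{s=0}^k\sum_{\sigma\vdash s}\binom\kappa\sigma\frac{(-1)^s}{(\gamma+\frac{\ell+1}{2})_\sigma}\frac{C_\sigma(S)}{C_\sigma(\mathrm{Id}_\ell)}$. The matrix-variate Hermite polynomials are $H_\kappa^{(\ell,n)}(X)=(-2)^{-k}(\frac n2)_\kappa^{-1}L_\kappa^{(\frac{n-\ell-1}{2})}(2^{-1}XX^T)$, $\kappa\vdash k$, $X\in\mathbb R^{\ell\times n}$. *)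

theory Defs
  imports "HOL-Probability.Probability" "HOL-Library.Function_Algebras"
begin

text \<open>
  Real matrices with rows indexed by \<open>'l\<close> and columns indexed by \<open>'n\<close>, i.e. \<open>real^'n^'l\<close>.
\<close>

type_synonym ('l, 'n) rmat = "((real, 'n) vec, 'l) vec"

section \<open>Partitions\<close>

text \<open>
  A partition \<open>(k\<^sub>1 \<ge> k\<^sub>2 \<ge> \<dots>)\<close> is encoded as the antitone sequence \<open>\<kappa> :: nat \<Rightarrow> nat\<close>
  with \<open>\<kappa> i = k\<^bsub>i+1\<^esub>\<close> (indices start at \<open>0\<close>), padded with zeros. The encoding is canonical, so
  equality of partitions is equality of functions.
\<close>

definition psize :: "(nat \<Rightarrow> nat) \<Rightarrow> nat" where
  "psize \<kappa> = (\<Sum>i | \<kappa> i \<noteq> 0. \<kappa> i)"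

definition partitions :: "nat \<Rightarrow> nat \<Rightarrow> (nat \<Rightarrow> nat) set" where
  "partitions m k = {\<kappa>. antimono \<kappa> \<and> (\<forall>i\<ge>m. \<kappa> i = 0) \<and> psize \<kappa> = k}"

definition gen_pochhammer :: "nat \<Rightarrow> real \<Rightarrow> (nat \<Rightarrow> nat) \<Rightarrow> real" where
  "gen_pochhammer m a \<kappa> = (\<Prod>j = 1..m. pochhammer (a - real (j - 1) / 2) (\<kappa> (j - 1)))"

section \<open>Polynomials in a symmetric matrix\<close>

global_interpretation fun_space: vector_space "\<lambda>(c::real) (f :: 'a \<Rightarrow> real) x. c * f x"
  by unfold_locales (auto simp: fun_eq_iff algebra_simps)

text \<open>
  A polynomial in the entries of a symmetric matrix is represented by its polynomial function on
  the symmetric matrices (this is faithful, the ground field being infinite), extended by \<open>0\<close> to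
  the other matrices, so that equality of polynomials is equality of functions.
\<close>

definition on_sym :: "(('m::finite, 'm) rmat \<Rightarrow> real) \<Rightarrow> ('m, 'm) rmat \<Rightarrow> real" where
  "on_sym f S = (if transpose S = S then f S else 0)"

definition hom_polys :: "nat \<Rightarrow> (('m::finite, 'm) rmat \<Rightarrow> real) set" where
  "hom_polys k = fun_space.span
     {on_sym (\<lambda>S. \<Prod>i\<in>UNIV. \<Prod>j\<in>UNIV. S $ i $ j ^ e i j) | e. (\<Sum>i\<in>UNIV. \<Sum>j\<in>UNIV. e i j) = k}"

definition gl_act :: "('m::finite, 'm) rmat \<Rightarrow> (('m, 'm) rmat \<Rightarrow> real) \<Rightarrow> ('m, 'm) rmat \<Rightarrow> real" where
  "gl_act L P = (\<lambda>S. P (matrix_inv L ** S ** transpose (matrix_inv L)))"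

definition gl_invariant :: "(('m::finite, 'm) rmat \<Rightarrow> real) set \<Rightarrow> bool" where
  "gl_invariant V \<longleftrightarrow>
     fun_space.subspace V \<and> (\<forall>L. invertible L \<longrightarrow> (\<forall>P\<in>V. gl_act L P \<in> V))"

definition gl_irreducible :: "(('m::finite, 'm) rmat \<Rightarrow> real) set \<Rightarrow> bool" where
  "gl_irreducible V \<longleftrightarrow>
     gl_invariant V \<and> V \<noteq> {0} \<and> (\<forall>W\<subseteq>V. gl_invariant W \<longrightarrow> W = {0} \<or> W = V)"

section \<open>Zonal polynomials\<close>

text \<open>
  The rows and columns of an \<open>m \<times> m\<close> matrix are indexed by a finite linearly ordered type of
  cardinality \<open>m\<close>; the \<open>j\<close>-th leading principal minor is that of the \<open>j\<close> smallest indices, written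
  out by the Leibniz formula.
\<close>

definition leading_minor :: "nat \<Rightarrow> ('m::{finite,linorder}, 'm) rmat \<Rightarrow> real" where
  "leading_minor j S =
     (let J = {i. card {h. h < i} < j}
      in \<Sum>p | p permutes J. of_int (sign p) * (\<Prod>i\<in>J. S $ i $ p i))"

definition power_poly :: "(nat \<Rightarrow> nat) \<Rightarrow> ('m::{finite,linorder}, 'm) rmat \<Rightarrow> real" where
  "power_poly \<kappa> = on_sym (\<lambda>S. \<Prod>j = 1..CARD('m). leading_minor j S ^ (\<kappa> (j - 1) - \<kappa> j))"

definition zonal_space :: "(nat \<Rightarrow> nat) \<Rightarrow> (('m::{finite,linorder}, 'm) rmat \<Rightarrow> real) set" where
  "zonal_space \<kappa> =
     (THE V. V \<subseteq> hom_polys (psize \<kappa>) \<and> gl_irreducible V \<and> power_poly \<kappa> \<in> V)"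

text \<open>\<open>zonal \<kappa>\<close> is \<open>C\<^sub>\<kappa>\<close>, the \<open>\<kappa>\<close>-component of the \<open>|\<kappa>|\<close>-th power of the trace.\<close>

definition zonal :: "(nat \<Rightarrow> nat) \<Rightarrow> ('m::{finite,linorder}, 'm) rmat \<Rightarrow> real" where
  "zonal \<kappa> =
     (THE c. (\<forall>\<tau>\<in>partitions CARD('m) (psize \<kappa>). c \<tau> \<in> zonal_space \<tau>) \<and>
             (\<forall>\<tau>. \<tau> \<notin> partitions CARD('m) (psize \<kappa>) \<longrightarrow> c \<tau> = 0) \<and>
             on_sym (\<lambda>S. trace S ^ psize \<kappa>) = (\<Sum>\<tau>\<in>partitions CARD('m) (psize \<kappa>). c \<tau>)) \<kappa>"

text \<open>The first argument only carries the size \<open>\<ell>\<close> of the matrices in the defining identity.\<close>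

definition gen_binomial ::
  "'l::{finite,linorder} itself \<Rightarrow> (nat \<Rightarrow> nat) \<Rightarrow> (nat \<Rightarrow> nat) \<Rightarrow> real" where
  "gen_binomial ty \<kappa> =
     (THE b. (\<forall>\<sigma>. \<sigma> \<notin> (\<Union>s\<le>psize \<kappa>. partitions CARD('l) s) \<longrightarrow> b \<sigma> = 0) \<and>
             (\<forall>S :: ('l, 'l) rmat. transpose S = S \<longrightarrow>
                zonal \<kappa> (S + mat 1) / zonal \<kappa> (mat 1 :: ('l, 'l) rmat) =
                (\<Sum>s\<le>psize \<kappa>. \<Sum>\<sigma>\<in>partitions CARD('l) s.
                   b \<sigma> * (zonal \<sigma> S / zonal \<sigma> (mat 1 :: ('l, 'l) rmat)))))"

section \<open>Laguerre and Hermite polynomials\<close>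

definition laguerre :: "real \<Rightarrow> (nat \<Rightarrow> nat) \<Rightarrow> ('l::{finite,linorder}, 'l) rmat \<Rightarrow> real" where
  "laguerre \<gamma> \<kappa> S =
     gen_pochhammer CARD('l) (\<gamma> + (real CARD('l) + 1) / 2) \<kappa> * zonal \<kappa> (mat 1 :: ('l, 'l) rmat) *
     (\<Sum>s\<le>psize \<kappa>. \<Sum>\<sigma>\<in>partitions CARD('l) s.
        gen_binomial TYPE('l) \<kappa> \<sigma> *
        ((-1) ^ s / gen_pochhammer CARD('l) (\<gamma> + (real CARD('l) + 1) / 2) \<sigma>) *
        (zonal \<sigma> S / zonal \<sigma> (mat 1 :: ('l, 'l) rmat)))"

definition hermite :: "(nat \<Rightarrow> nat) \<Rightarrow> ('l::{finite,linorder}, 'n::finite) rmat \<Rightarrow> real" where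
  "hermite \<kappa> X =
     inverse ((-2) ^ psize \<kappa>) * inverse (gen_pochhammer CARD('l) (real CARD('n) / 2) \<kappa>) *
     laguerre ((real CARD('n) - real CARD('l) - 1) / 2) \<kappa> ((1/2) *\<^sub>R (X ** transpose X))"

section \<open>Positive semidefinite matrices and Gaussian matrices\<close>

definition pos_semidef :: "('n::finite, 'n) rmat \<Rightarrow> bool" where
  "pos_semidef A \<longleftrightarrow> transpose A = A \<and> (\<forall>x. 0 \<le> x \<bullet> (A *v x))"

definition psd_sqrt :: "('n::finite, 'n) rmat \<Rightarrow> ('n, 'n) rmat" where
  "psd_sqrt A = (THE B. pos_semidef B \<and> B ** B = A)"

definition std_normal_matrix :: "'w measure \<Rightarrow> ('w \<Rightarrow> ('l::finite, 'n::finite) rmat) \<Rightarrow> bool" where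
  "std_normal_matrix M X \<longleftrightarrow>
     prob_space.indep_vars M (\<lambda>_. borel) (\<lambda>(i, j) \<omega>. X \<omega> $ i $ j) UNIV \<and>
     (\<forall>i j. distributed M lborel (\<lambda>\<omega>. X \<omega> $ i $ j) std_normal_density)"

end

theory Submission
  imports Defs
begin

text \<open>
  Let \<open>\<langle>p, q\<rangle>\<close> be the Fischer form on homogeneous polynomials of degree \<open>2k\<close> on \<open>\<ell> \<times> n\<close> matrices,
  normalized by \<open>\<langle>(a \<bullet> x)\<^bsup>2k\<^esup>, q\<rangle> = q a\<close>. A polynomial in \<open>homs (2k)\<close> on which the lower triangular group
  acts through the character of \<open>\<Prod>\<^sub>j \<Delta>\<^sub>j(xx\<^sup>T)\<^bsup>k\<^sub>j - k\<^sub>j\<^sub>+\<^sub>1\<^esup>\<close> is a multiple of that product. Therefore the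
  \<open>GL\<^sub>\<ell>\<close>-span of the product is irreducible, i.e. equal to \<open>V\<^sub>\<kappa>\<close>, and different \<open>V\<^sub>\<kappa>\<close> are orthogonal for
  the form \<open>\<langle>P(xx\<^sup>T), Q(xx\<^sup>T)\<rangle>\<close>.

  If \<open>C\<^sub>\<kappa>(xx\<^sup>T) = \<Sum>\<^sub>a \<alpha>\<^sub>a (a \<bullet> x)\<^bsup>2k\<^esup>\<close>, then \<open>H\<^sub>\<kappa>(x)\<close> is \<open>4\<^bsup>-k\<^esup> (n/2)\<^sub>\<kappa>\<^bsup>-1\<^esup>\<close> times the sum of the \<open>\<alpha>\<^sub>a\<close>-multiples
  of the one-variable Hermite polynomials of degree \<open>2k\<close> in \<open>a \<bullet> x\<close>. Two such Hermite polynomials in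
  \<open>a \<bullet> X\<close> and \<open>b \<bullet> Y\<close> have covariance \<open>(2k)! (a \<bullet> bR)\<^bsup>2k\<^esup>\<close> if their degrees agree, and 0 otherwise, so that the
  expectation in question is a multiple of \<open>\<langle>C\<^sub>\<kappa>(xx\<^sup>T), C\<^sub>\<sigma>(xR\<^sup>2x\<^sup>T)\<rangle>\<close>. As a function of \<open>R\<^sup>2\<close> this is an
  orthogonally invariant element of \<open>V\<^sub>\<sigma>\<close> for \<open>n \<times> n\<close> matrices, hence a multiple of \<open>C\<^sub>\<sigma>(R\<^sup>2)\<close>. The factor is found at
  \<open>R = Id\<close>, where the orthogonality of the \<open>V\<^sub>\<kappa>\<close> reduces it to \<open>\<langle>(tr xx\<^sup>T)\<^sup>k, C\<^sub>\<kappa>(xx\<^sup>T)\<rangle>\<close>, which is a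
  multiple of \<open>E C\<^sub>\<kappa>(XX\<^sup>T) = 2\<^sup>k (n/2)\<^sub>\<kappa> C\<^sub>\<kappa>(Id)\<close>.
\<close>

section \<open>Polynomial functions\<close>

text \<open>\<open>zonal_space\<close>, \<open>zonal\<close>, \<open>gen_binomial\<close> and
  \<open>psd_sqrt\<close> are defined by \<open>THE\<close>, so each of them needs existence and
  uniqueness. For \<open>zonal\<close>, existence means that the power of the trace lies in the sum
  of the V_\<kappa>. This is a dimension count: a bi-invariant polynomial is determined by its
  values on diagonal matrices, where it is symmetric and even, which leaves at most as many
  dimensions as there are partitions, and every V_\<kappa> contributes one. Two substitutes for
  analysis on groups recur. An invariant element is obtained not by averaging but as the element
  representing evaluation at the identity, a point fixed by all orthogonal congruences. And an
  identity known for invertible or positive definite matrices is extended along a segment that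
  starts at the identity, since small parameters determine a polynomial. The constant (n/2)_\<kappa>
  comes from integrating out one row at a time: row r + 1 enters the next minor through its
  projection to a space of dimension n - r, and repeated integration by parts yields the factors n -
  r + 2 e.\<close>

lemma sum_fun_apply: "(\<Sum>i\<in>I. f i) x = (\<Sum>i\<in>I. f i x)" for f :: "'i \<Rightarrow> 'a \<Rightarrow> real"
  by (induction I rule: infinite_finite_induct) auto

lemma subspaceI_fun:
  assumes "(\<lambda>x. 0) \<in> U" "\<And>f g. f \<in> U \<Longrightarrow> g \<in> U \<Longrightarrow> (\<lambda>x. f x + g x) \<in> U"
    "\<And>c f. f \<in> U \<Longrightarrow> (\<lambda>x. c * f x) \<in> U"
  shows "fun_space.subspace (U :: ('a \<Rightarrow> real) set)"
  using assms unfolding fun_space.subspace_def by (auto simp: zero_fun_def plus_fun_def)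

lemma subspace_fun_zero: "fun_space.subspace U \<Longrightarrow> (\<lambda>x::'a. 0::real) \<in> U"
  using fun_space.subspace_0[of U] by (simp add: zero_fun_def)

lemma subspace_fun_add:
  "fun_space.subspace U \<Longrightarrow> f \<in> U \<Longrightarrow> g \<in> U \<Longrightarrow> (\<lambda>x::'a. f x + g x :: real) \<in> U"
  using fun_space.subspace_add[of U f g] by (simp add: plus_fun_def)

lemma subspace_fun_scale:
  "fun_space.subspace U \<Longrightarrow> f \<in> U \<Longrightarrow> (\<lambda>x::'a. c * f x :: real) \<in> U"
  using fun_space.subspace_scale[of U f c] by simp

lemma subspace_fun_diff:
  "fun_space.subspace U \<Longrightarrow> f \<in> U \<Longrightarrow> g \<in> U \<Longrightarrow> (\<lambda>x::'a. f x - g x :: real) \<in> U"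
  using fun_space.subspace_diff[of U f g] by (simp add: fun_diff_def)

lemma subspace_fun_sum:
  assumes "fun_space.subspace U" "\<And>i. i \<in> I \<Longrightarrow> f i \<in> U"
  shows "(\<lambda>x::'a. \<Sum>i\<in>I. f i x :: real) \<in> U"
  using fun_space.subspace_sum[of U I f] assms by (simp add: sum_fun_apply fun_eq_iff sum_fun_apply[abs_def])

lemma span_fun_induct [consumes 1, case_names zero base add scale]:
  assumes "f \<in> fun_space.span S" "P (\<lambda>x. 0)" "\<And>f. f \<in> S \<Longrightarrow> P f"
    "\<And>f g. f \<in> fun_space.span S \<Longrightarrow> P f \<Longrightarrow> g \<in> fun_space.span S \<Longrightarrow> P g \<Longrightarrow> P (\<lambda>x::'a. f x + g x :: real)"
    "\<And>c f. f \<in> fun_space.span S \<Longrightarrow> P f \<Longrightarrow> P (\<lambda>x. c * f x)"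
  shows "P f"
proof -
  have "f \<in> fun_space.span S \<and> P f"
    using assms(1)
  proof (induction rule: fun_space.span_induct_alt)
    case base
    show ?case using assms(2) fun_space.span_zero[of S] by (simp add: zero_fun_def)
  next
    case (step c f g)
    have "f \<in> fun_space.span S" by (simp add: fun_space.span_base step)
    then have "(\<lambda>x. c * f x) \<in> fun_space.span S" "P (\<lambda>x. c * f x)"
      using assms(3,5) step by (auto intro!: fun_space.span_scale)
    then show ?case
      using assms(4)[of "\<lambda>x. c * f x" g] step fun_space.span_add[of "\<lambda>x. c * f x" S g]
      by (simp add: plus_fun_def)
  qed
  then show ?thesis by simp
qed

text \<open>Replacing \<open>t\<close> by \<open>t/2\<close> and subtracting \<open>2\<^bsup>-j\<^esup>\<close> times the original combination eliminates
  the \<open>j\<close>-th coefficient and rescales the others.\<close>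

lemma coefficients_in_subspace:
  fixes v :: "nat \<Rightarrow> 'a \<Rightarrow> real"
  assumes U: "fun_space.subspace U" and "finite I" and "0 < e"
    and "\<And>t. 0 < t \<Longrightarrow> t < e \<Longrightarrow> (\<lambda>x. \<Sum>i\<in>I. t ^ i * v i x) \<in> U"
  shows "i \<in> I \<Longrightarrow> v i \<in> U"
  using assms(2,4)
proof (induction I arbitrary: v i rule: finite_induct)
  case (insert j I)
  define w where "w i x = ((1/2) ^ i - (1/2) ^ j) * v i x" for i x
  have w: "w i \<in> U" if "i \<in> I" for i
  proof (rule insert.IH[OF that])
    fix t :: real assume t: "0 < t" "t < e"
    have 1: "(\<lambda>x. \<Sum>i\<in>insert j I. (t/2) ^ i * v i x) \<in> U"
      using t by (intro insert.prems(2)) auto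
    have 2: "(\<lambda>x. (1/2)^j * (\<Sum>i\<in>insert j I. t ^ i * v i x)) \<in> U"
      using t by (intro subspace_fun_scale[OF U] insert.prems(2)) auto
    have "(\<lambda>x. \<Sum>i\<in>I. t ^ i * w i x) =
      (\<lambda>x. (\<Sum>i\<in>insert j I. (t/2) ^ i * v i x) - (1/2)^j * (\<Sum>i\<in>insert j I. t ^ i * v i x))"
      using insert.hyps
      by (auto simp: fun_eq_iff w_def sum_distrib_left power_divide sum_subtractf[symmetric] algebra_simps intro!: sum.cong)
    then show "(\<lambda>x. \<Sum>i\<in>I. t ^ i * w i x) \<in> U"
      using subspace_fun_diff[OF U 1 2] by simp
  qed
  have v: "v i \<in> U" if "i \<in> I" for i
  proof -
    have "(1/2::real) ^ i \<noteq> (1/2) ^ j"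
      using that insert.hyps by (auto simp: power_inject_exp' power_one_over)
    then have "v i = (\<lambda>x. inverse ((1/2) ^ i - (1/2) ^ j) * w i x)"
      by (auto simp: w_def fun_eq_iff)
    then show ?thesis using subspace_fun_scale[OF U w[OF that]] by simp
  qed
  show ?case
  proof (cases "i \<in> I")
    case False
    then have "i = j" using insert.prems by simp
    define t where "t = e / 2"
    have t: "0 < t" "t < e" using \<open>0 < e\<close> by (auto simp: t_def)
    have 1: "(\<lambda>x. (\<Sum>i\<in>insert j I. t ^ i * v i x) - (\<Sum>i\<in>I. t ^ i * v i x)) \<in> U"
      using t by (intro subspace_fun_diff[OF U] subspace_fun_sum[OF U] subspace_fun_scale[OF U] insert.prems(2) v) auto
    have "v j = (\<lambda>x. inverse (t^j) * ((\<Sum>i\<in>insert j I. t ^ i * v i x) - (\<Sum>i\<in>I. t ^ i * v i x)))"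
      using insert.hyps t by (auto simp: fun_eq_iff)
    then show ?thesis using subspace_fun_scale[OF U 1] \<open>i = j\<close> by simp
  qed (use v in auto)
qed simp

lemma coefficients_zero:
  fixes v :: "nat \<Rightarrow> real"
  assumes "finite I" "0 < e" "\<And>t. 0 < t \<Longrightarrow> t < e \<Longrightarrow> (\<Sum>i\<in>I. t ^ i * v i) = 0" "i \<in> I"
  shows "v i = 0"
proof -
  \<comment> \<open>Real numbers are regarded as functions on \<open>unit\<close>, and vanishing as
    membership in the zero subspace.\<close>
  have "fun_space.subspace {\<lambda>x::unit. 0::real}"
    by (rule subspaceI_fun) auto
  then have "(\<lambda>x::unit. v i) \<in> {\<lambda>x. 0}"
    by (rule coefficients_in_subspace[where v = "\<lambda>i x. v i", OF _ assms(1,2) _ assms(4)])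
       (simp add: assms(3))
  then show ?thesis by (auto simp: fun_eq_iff)
qed

text \<open>By polarization, these are all homogeneous polynomial functions of degree \<open>k\<close>.\<close>

definition homs :: "nat \<Rightarrow> ('a::euclidean_space \<Rightarrow> real) set" where
  "homs k = fun_space.span (range (\<lambda>a x. (a \<bullet> x) ^ k))"

lemma subspace_homs: "fun_space.subspace (homs k)"
  by (simp add: homs_def)

lemmas homs_zero = subspace_fun_zero[OF subspace_homs]
  and homs_add = subspace_fun_add[OF subspace_homs]
  and homs_diff = subspace_fun_diff[OF subspace_homs]
  and homs_scale = subspace_fun_scale[OF subspace_homs]
  and homs_sum = subspace_fun_sum[OF subspace_homs]

lemma homs_power: "(\<lambda>x. (a \<bullet> x) ^ k) \<in> homs k"
  by (auto simp: homs_def intro!: fun_space.span_base)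

lemma homs_induct [consumes 1, case_names zero power add scale]:
  assumes "f \<in> homs k" "P (\<lambda>x. 0)" "\<And>a. P (\<lambda>x. (a \<bullet> x) ^ k)"
    "\<And>f g. f \<in> homs k \<Longrightarrow> P f \<Longrightarrow> g \<in> homs k \<Longrightarrow> P g \<Longrightarrow> P (\<lambda>x. f x + g x)"
    "\<And>c f. f \<in> homs k \<Longrightarrow> P f \<Longrightarrow> P (\<lambda>x. c * f x)"
  shows "P f"
  using assms(1) unfolding homs_def
  by (rule span_fun_induct) (use assms(2-) in \<open>auto simp: homs_def\<close>)

lemma homs_repr:
  fixes f :: "'a::euclidean_space \<Rightarrow> real"
  assumes "f \<in> homs k"
  obtains A :: "'a set" and \<alpha> where "finite A" "f = (\<lambda>x. \<Sum>a\<in>A. \<alpha> a * (a \<bullet> x) ^ k)"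
proof -
  have "\<exists>A \<alpha>. finite A \<and> f = (\<lambda>x. \<Sum>a\<in>A. \<alpha> a * (a \<bullet> x) ^ k)"
    using assms
  proof (induction rule: homs_induct)
    case zero
    show ?case by (intro exI[of _ "{}"]) auto
  next
    case (power a)
    show ?case by (intro exI[of _ "{a}"] exI[of _ "\<lambda>_. 1"]) auto
  next
    case (add f g)
    then obtain A \<alpha> B \<beta> where "finite A" "f = (\<lambda>x. \<Sum>a\<in>A. \<alpha> a * (a \<bullet> x) ^ k)"
      "finite B" "g = (\<lambda>x. \<Sum>a\<in>B. \<beta> a * (a \<bullet> x) ^ k)" by blast
    moreover have "(\<Sum>a\<in>A. \<alpha> a * (a \<bullet> x) ^ k) = (\<Sum>a\<in>A \<union> B. (if a \<in> A then \<alpha> a else 0) * (a \<bullet> x) ^ k)"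
      "(\<Sum>a\<in>B. \<beta> a * (a \<bullet> x) ^ k) = (\<Sum>a\<in>A \<union> B. (if a \<in> B then \<beta> a else 0) * (a \<bullet> x) ^ k)" for x
      using calculation by (auto intro!: sum.mono_neutral_cong_left)
    ultimately show ?case
      by (intro exI[of _ "A \<union> B"] exI[of _ "\<lambda>a. (if a \<in> A then \<alpha> a else 0) + (if a \<in> B then \<beta> a else 0)"])
         (auto simp: distrib_right sum.distrib)
  next
    case (scale c f)
    then obtain A \<alpha> where "finite A" "f = (\<lambda>x. \<Sum>a\<in>A. \<alpha> a * (a \<bullet> x) ^ k)" by blast
    then show ?case
      by (intro exI[of _ A] exI[of _ "\<lambda>a. c * \<alpha> a"]) (auto simp: sum_distrib_left mult_ac)
  qed
  then show ?thesis using that by blast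
qed

lemma homs_const: "(\<lambda>x. c) \<in> homs 0"
  using homs_scale[OF homs_power[of undefined 0], of c] by simp

lemma homs_linear: "(\<lambda>x. a \<bullet> x) \<in> homs 1"
  using homs_power[of a 1] by simp

text \<open>Polarization: up to a binomial coefficient the product is the coefficient of
  \<open>t ^ l\<close> in \<open>((a + t *\<^sub>R b) \<bullet> x) ^ (k + l)\<close>, and the
  coefficients of a polynomial family in a subspace belong to the subspace.\<close>

lemma homs_power_mult: "(\<lambda>x. (a \<bullet> x) ^ k * (b \<bullet> x) ^ l) \<in> homs (k + l)"
proof -
  have *: "(\<lambda>x. \<Sum>i\<le>k+l. t ^ i * (of_nat ((k+l) choose i) * ((a \<bullet> x) ^ (k+l-i) * (b \<bullet> x) ^ i))) \<in> homs (k + l)" for t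
  proof -
    have "(\<Sum>i\<le>k+l. t ^ i * (of_nat ((k+l) choose i) * ((a \<bullet> x) ^ (k+l-i) * (b \<bullet> x) ^ i))) = ((a + t *\<^sub>R b) \<bullet> x) ^ (k+l)" for x
      using binomial_ring[of "t * (b \<bullet> x)" "a \<bullet> x" "k+l"]
      by (simp add: inner_add_left power_mult_distrib mult_ac add.commute)
    then show ?thesis using homs_power[of "a + t *\<^sub>R b" "k+l"] by simp
  qed
  have "(\<lambda>x. of_nat ((k+l) choose l) * ((a \<bullet> x) ^ (k+l-l) * (b \<bullet> x) ^ l)) \<in> homs (k + l)"
    by (rule coefficients_in_subspace[OF subspace_homs, where I = "{..k+l}" and e = 1]) (use * in auto)
  then have "(\<lambda>x. inverse (of_nat ((k+l) choose l)) * (of_nat ((k+l) choose l) * ((a \<bullet> x) ^ (k+l-l) * (b \<bullet> x) ^ l))) \<in> homs (k + l)"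
    by (rule homs_scale)
  moreover have "real ((k+l) choose l) \<noteq> 0" by simp
  ultimately show ?thesis by (simp add: mult.assoc[symmetric] del: of_nat_eq_0_iff)
qed

lemma homs_mult:
  assumes "f \<in> homs k" "g \<in> homs l"
  shows "(\<lambda>x. f x * g x) \<in> homs (k + l)"
  using assms(1)
proof (induction rule: homs_induct)
  case (power a)
  show ?case using assms(2)
    by (induction rule: homs_induct)
       (auto simp: homs_zero homs_power_mult distrib_left homs_add mult.left_commute intro: homs_scale)
qed (auto simp: homs_zero distrib_right homs_add mult.assoc intro: homs_scale)

lemma homs_prod:
  assumes "finite I" "\<And>i. i \<in> I \<Longrightarrow> f i \<in> homs (d i)"
  shows "(\<lambda>x. \<Prod>i\<in>I. f i x) \<in> homs (\<Sum>i\<in>I. d i)"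
  using assms by (induction I rule: finite_induct) (auto intro: homs_const homs_mult)

lemma homs_pow: "f \<in> homs k \<Longrightarrow> (\<lambda>x. f x ^ n) \<in> homs (n * k)"
  by (induction n) (auto intro: homs_const homs_mult)

lemma homs_compose:
  assumes "f \<in> homs k" "linear g"
  shows "(\<lambda>x. f (g x)) \<in> homs k"
  using assms(1)
proof (induction rule: homs_induct)
  case (power a)
  have "(a \<bullet> g x) = adjoint g a \<bullet> x" for x by (simp add: adjoint_works assms(2) inner_commute)
  then show ?case by (simp add: homs_power)
qed (auto intro: homs_zero homs_add homs_scale)

lemma homs_homogeneous: "f \<in> homs k \<Longrightarrow> f (c *\<^sub>R x) = c ^ k * f x"
  by (induction rule: homs_induct) (auto simp: power_mult_distrib algebra_simps)

lemma homs_line: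
  assumes "f \<in> homs k"
  obtains v where "\<And>i. i \<le> k \<Longrightarrow> v i \<in> homs (k - i)" "\<And>t x. f (x + t *\<^sub>R y) = (\<Sum>i\<le>k. t ^ i * v i x)"
proof -
  have "\<exists>v. (\<forall>i\<le>k. v i \<in> homs (k - i)) \<and> (\<forall>t x. f (x + t *\<^sub>R y) = (\<Sum>i\<le>k. t ^ i * v i x))"
    using assms
  proof (induction rule: homs_induct)
    case zero
    show ?case by (intro exI[of _ "\<lambda>_ _. 0"]) (auto simp: homs_zero)
  next
    case (power a)
    have "(a \<bullet> (x + t *\<^sub>R y)) ^ k = (\<Sum>i\<le>k. t ^ i * ((of_nat (k choose i) * (a \<bullet> y)^i) * (a \<bullet> x) ^ (k - i)))" for x t
      using binomial_ring[of "t * (a \<bullet> y)" "a \<bullet> x" "k"]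
      by (simp add: inner_add_right power_mult_distrib mult_ac add.commute)
    then show ?case
      by (intro exI[of _ "\<lambda>i x. (of_nat (k choose i) * (a \<bullet> y)^i) * (a \<bullet> x) ^ (k - i)"])
         (auto intro: homs_scale homs_power)
  next
    case (add f g)
    from add.IH(1) obtain v where "\<forall>i\<le>k. v i \<in> homs (k - i)" "\<forall>t x. f (x + t *\<^sub>R y) = (\<Sum>i\<le>k. t ^ i * v i x)" by blast
    moreover from add.IH(2) obtain w where
      "\<forall>i\<le>k. w i \<in> homs (k - i)" "\<forall>t x. g (x + t *\<^sub>R y) = (\<Sum>i\<le>k. t ^ i * w i x)" by blast
    ultimately show ?case
      by (intro exI[of _ "\<lambda>i x. v i x + w i x"]) (auto simp: distrib_left sum.distrib homs_add)
  next
    case (scale c f)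
    then obtain v where "\<forall>i\<le>k. v i \<in> homs (k - i)" "\<forall>t x. f (x + t *\<^sub>R y) = (\<Sum>i\<le>k. t ^ i * v i x)" by blast
    then show ?case
      by (intro exI[of _ "\<lambda>i x. c * v i x"]) (auto simp: sum_distrib_left mult_ac intro: homs_scale)
  qed
  then show ?thesis using that by blast
qed

text \<open>Takes the place of density arguments: with \<open>x\<close> the identity matrix,
  vanishing need only be known for matrices close to the identity, where positivity and
  invertibility hold.\<close>

lemma homs_zero_of_line:
  assumes f: "f \<in> homs k" and "0 < e" "\<And>t. 0 < t \<Longrightarrow> t < e \<Longrightarrow> f (x + t *\<^sub>R y) = 0"
  shows "f (x + s *\<^sub>R y) = 0"
proof -
  obtain v where v: "\<And>t x. f (x + t *\<^sub>R y) = (\<Sum>i\<le>k. t ^ i * v i x)"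
    using homs_line[OF f, of y] by metis
  have "v i x = 0" if "i \<le> k" for i
    by (rule coefficients_zero[where v = "\<lambda>i. v i x" and I = "{..k}" and e = e]) (use assms that in \<open>auto simp: v[symmetric]\<close>)
  then show ?thesis by (simp add: v)
qed

text \<open>Induction on the degree through (a . x)^(k+1) = sum over the basis of (a . b) (b . x) (a
  . x)^k. The representation of linear functionals in \<open>gram_form_riesz\<close> rests on this
  finiteness.\<close>

lemma homs_finite_span:
  "\<exists>F. finite F \<and> F \<subseteq> homs k \<and> (homs k :: ('a::euclidean_space \<Rightarrow> real) set) \<subseteq> fun_space.span F"
proof (induction k)
  case 0
  have "f \<in> fun_space.span {\<lambda>x::'a. 1}" if "f \<in> homs 0" for f :: "'a \<Rightarrow> real"
  proof -
    obtain A \<alpha> where "f = (\<lambda>x. \<Sum>a\<in>(A::'a set). \<alpha> a * (a \<bullet> x) ^ 0)" using homs_repr[OF \<open>f \<in> homs 0\<close>] by metis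
    then have "f = (\<lambda>x. (\<Sum>a\<in>A. \<alpha> a) * 1)" by simp
    then show ?thesis using fun_space.span_scale[OF fun_space.span_base, of "\<lambda>x. 1" "{\<lambda>x. 1}" "\<Sum>a\<in>A. \<alpha> a"] by simp
  qed
  then show ?case using homs_const by (intro exI[of _ "{\<lambda>x. 1}"]) auto
next
  case (Suc k)
  then obtain F where F: "finite F" "F \<subseteq> homs k" "(homs k :: ('a \<Rightarrow> real) set) \<subseteq> fun_space.span F" by auto
  define G where "G = (\<lambda>(b, f) x. (b \<bullet> x) * f x) ` (Basis \<times> F)"
  have G: "(\<lambda>x. (b \<bullet> x) * f x) \<in> fun_space.span G" if "b \<in> Basis" "f \<in> fun_space.span F" for b f
    using that(2)
  proof (induction rule: span_fun_induct)
    case zero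
    show ?case by (simp add: subspace_fun_zero)
  next
    case (base f)
    then show ?case using that(1) by (intro fun_space.span_base) (auto simp: G_def)
  next
    case (add f g)
    then show ?case by (simp add: distrib_left subspace_fun_add)
  next
    case (scale c f)
    then show ?case using subspace_fun_scale[of "fun_space.span G" _ c] by (simp add: mult.left_commute)
  qed
  have "f \<in> fun_space.span G" if "f \<in> homs (Suc k)" for f
    using that
  proof (induction rule: homs_induct)
    case (power a)
    have "(\<lambda>x. \<Sum>b\<in>Basis. (a \<bullet> b) * ((b \<bullet> x) * (a \<bullet> x) ^ k)) \<in> fun_space.span G"
      by (intro subspace_fun_sum subspace_fun_scale G) (use F homs_power in auto)
    moreover have "(\<Sum>b\<in>Basis. (a \<bullet> b) * ((b \<bullet> x) * (a \<bullet> x) ^ k)) = (a \<bullet> x) ^ Suc k" for x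
      by (simp add: euclidean_inner[of a x] sum_distrib_right inner_commute mult_ac)
    ultimately show ?case by simp
  qed (auto simp: subspace_fun_zero intro: subspace_fun_add subspace_fun_scale)
  moreover have "G \<subseteq> homs (Suc k)" using F homs_mult[OF homs_linear, of _ k] by (auto simp: G_def)
  ultimately show ?case using F by (intro exI[of _ G]) (auto simp: G_def)
qed

section \<open>The Fischer form\<close>

lemma sum_mult_swap:
  fixes \<alpha> :: "'a \<Rightarrow> real"
  shows "(\<Sum>a\<in>A. \<alpha> a * (\<Sum>b\<in>B. \<beta> b * K a b)) = (\<Sum>b\<in>B. \<beta> b * (\<Sum>a\<in>A. \<alpha> a * K a b))"
  unfolding sum_distrib_left by (subst sum.swap) (simp add: mult.left_commute)

text \<open>For \<open>p\<close> and \<open>q\<close> in \<open>homs k\<close> the value does not depend on the chosen representation of \<open>p\<close>.\<close>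

definition fischer :: "nat \<Rightarrow> ('a::euclidean_space \<Rightarrow> real) \<Rightarrow> ('a \<Rightarrow> real) \<Rightarrow> real" where
  "fischer k p q = (let (A, \<alpha>) = (SOME (A, \<alpha>). finite A \<and> p = (\<lambda>x. \<Sum>a\<in>A. \<alpha> a * (a \<bullet> x) ^ k))
     in \<Sum>a\<in>A. \<alpha> a * q a)"

text \<open>If q is also written as a combination of powers, the value becomes a double sum of
  \<alpha> \<beta> (a . b)^k, which regroups to a sum of values of p. Any two representations of p
  therefore give the same number.\<close>

lemma fischer_eq:
  fixes p q :: "'a::euclidean_space \<Rightarrow> real"
  assumes "finite A" "p = (\<lambda>x. \<Sum>a\<in>A. \<alpha> a * (a \<bullet> x) ^ k)" "q \<in> homs k"
  shows "fischer k p q = (\<Sum>a\<in>A. \<alpha> a * q a)"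
proof -
  obtain B \<beta> where q: "finite B" "q = (\<lambda>x. \<Sum>b\<in>(B::'a set). \<beta> b * (b \<bullet> x) ^ k)"
    using homs_repr[OF assms(3)] by metis
  have *: "(\<Sum>a\<in>A. \<alpha> a * q a) = (\<Sum>b\<in>B. \<beta> b * p b)"
    if "p = (\<lambda>x. \<Sum>a\<in>A. \<alpha> a * (a \<bullet> x) ^ k)" for A \<alpha>
    unfolding q(2) that by (subst sum_mult_swap) (simp add: inner_commute)
  define z where "z = (SOME (A, \<alpha>). finite A \<and> p = (\<lambda>x. \<Sum>a\<in>A. \<alpha> a * (a \<bullet> x) ^ k))"
  have "case z of (A, \<alpha>) \<Rightarrow> finite A \<and> p = (\<lambda>x. \<Sum>a\<in>A. \<alpha> a * (a \<bullet> x) ^ k)"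
    unfolding z_def by (rule someI[of _ "(A, \<alpha>)"]) (use assms(1,2) in blast)
  moreover obtain A' \<alpha>' where z: "z = (A', \<alpha>')" by fastforce
  ultimately have "p = (\<lambda>x. \<Sum>a\<in>A'. \<alpha>' a * (a \<bullet> x) ^ k)" by blast
  from *[OF this] *[OF assms(2)] show ?thesis
    unfolding fischer_def z_def[symmetric] z Let_def prod.case by (simp only:)
qed

lemma fischer_power: "q \<in> homs k \<Longrightarrow> fischer k (\<lambda>x. (a \<bullet> x) ^ k) q = q a"
  using fischer_eq[of "{a}" "\<lambda>x. (a \<bullet> x) ^ k" "\<lambda>_. 1" k q] by simp

lemma fischer_sym:
  fixes p q :: "'a::euclidean_space \<Rightarrow> real"
  assumes "p \<in> homs k" "q \<in> homs k"
  shows "fischer k p q = fischer k q p"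
proof -
  obtain A \<alpha> where p: "finite A" "p = (\<lambda>x. \<Sum>a\<in>(A::'a set). \<alpha> a * (a \<bullet> x) ^ k)"
    using homs_repr[OF assms(1)] by metis
  obtain B \<beta> where q: "finite B" "q = (\<lambda>x. \<Sum>b\<in>(B::'a set). \<beta> b * (b \<bullet> x) ^ k)"
    using homs_repr[OF assms(2)] by metis
  have "(\<Sum>a\<in>A. \<alpha> a * q a) = (\<Sum>b\<in>B. \<beta> b * p b)"
    unfolding p(2) q(2) by (subst sum_mult_swap) (simp add: inner_commute)
  then show ?thesis unfolding fischer_eq[OF p assms(2)] fischer_eq[OF q assms(1)] .
qed

lemma fischer_add_right:
  "p \<in> homs k \<Longrightarrow> q \<in> homs k \<Longrightarrow> r \<in> homs k \<Longrightarrow> fischer k p (\<lambda>x. q x + r x) = fischer k p q + fischer k p r"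
  by (erule homs_repr) (simp add: fischer_eq homs_add distrib_left sum.distrib)

lemma fischer_scale_right:
  "p \<in> homs k \<Longrightarrow> q \<in> homs k \<Longrightarrow> fischer k p (\<lambda>x. c * q x) = c * fischer k p q"
  by (erule homs_repr) (simp add: fischer_eq homs_scale sum_distrib_left mult_ac)

lemma fischer_sum_right:
  "p \<in> homs k \<Longrightarrow> (\<And>i. i \<in> I \<Longrightarrow> q i \<in> homs k) \<Longrightarrow> fischer k p (\<lambda>x. \<Sum>i\<in>I. q i x) = (\<Sum>i\<in>I. fischer k p (q i))"
  by (erule homs_repr) (simp add: fischer_eq homs_sum sum_distrib_left, subst sum.swap, simp)

lemma fischer_add_left:
  "p \<in> homs k \<Longrightarrow> q \<in> homs k \<Longrightarrow> r \<in> homs k \<Longrightarrow> fischer k (\<lambda>x. q x + r x) p = fischer k q p + fischer k r p"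
  by (simp add: fischer_sym[of _ _ p] homs_add fischer_add_right)

lemma fischer_scale_left:
  "p \<in> homs k \<Longrightarrow> q \<in> homs k \<Longrightarrow> fischer k (\<lambda>x. c * q x) p = c * fischer k q p"
  by (simp add: fischer_sym[of _ _ p] homs_scale fischer_scale_right)

lemma fischer_sum_left:
  "p \<in> homs k \<Longrightarrow> (\<And>i. i \<in> I \<Longrightarrow> q i \<in> homs k) \<Longrightarrow> fischer k (\<lambda>x. \<Sum>i\<in>I. q i x) p = (\<Sum>i\<in>I. fischer k (q i) p)"
  by (simp add: fischer_sym[of _ _ p] homs_sum fischer_sum_right)

text \<open>By linearity p may be a power (a . x)^k; composing with g turns it into the power
  belonging to h a, and both sides are q (h a).\<close>

lemma fischer_adjoint:
  assumes "p \<in> homs k" "q \<in> homs k" "linear g" "linear h" "\<And>x y. g x \<bullet> y = x \<bullet> h y"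
  shows "fischer k (\<lambda>x. p (g x)) q = fischer k p (\<lambda>x. q (h x))"
proof -
  have z: "fischer k (\<lambda>x. 0) r = 0" if "r \<in> homs k" for r :: "'c::euclidean_space \<Rightarrow> real"
    using fischer_scale_left[OF that homs_zero, of 0] by simp
  from assms(1) show ?thesis
  proof (induction rule: homs_induct)
    case zero
    show ?case using z[OF assms(2)] z[OF homs_compose[OF assms(2,4)]] by simp
  next
    case (power a)
    have "a \<bullet> g x = h a \<bullet> x" for x using assms(5)[of x a] by (simp add: inner_commute)
    then show ?case
      using fischer_power[OF assms(2), of "h a"] fischer_power[OF homs_compose[OF assms(2,4)], of a] by simp
  qed (simp_all add: fischer_add_left fischer_scale_left assms homs_compose)
qed

lemma power_sum_words:
  "(\<Sum>b\<in>B. f b) ^ k = (\<Sum>w\<in>PiE {..<k} (\<lambda>_. B). \<Prod>i<k. f (w i))" if "finite B" for f :: "'b \<Rightarrow> real"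
  using prod_sum_PiE[of "{..<k}" "\<lambda>_. B" "\<lambda>_. f"] that by simp

text \<open>The Fischer form is the inner product of the coefficient tensors.\<close>

lemma fischer_squares:
  fixes p :: "'a::euclidean_space \<Rightarrow> real"
  assumes "p \<in> homs k"
  obtains W :: "(nat \<Rightarrow> 'a) set" and c m where "finite W" "\<And>x. p x = (\<Sum>w\<in>W. c w * m x w)"
    "fischer k p p = (\<Sum>w\<in>W. (c w)\<^sup>2)"
proof -
  obtain A \<alpha> where p: "finite A" "p = (\<lambda>x. \<Sum>a\<in>(A::'a set). \<alpha> a * (a \<bullet> x) ^ k)"
    using homs_repr[OF assms(1)] by metis
  \<comment> \<open>A word w of length k in the basis indexes a coordinate of the k-fold tensor
    power; \<open>m a w\<close> is that coordinate of a \<otimes> ... \<otimes> a, and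
    \<open>c w\<close> that of p.\<close>
  define W where "W = PiE {..<k} (\<lambda>_. Basis :: 'a set)"
  define m where "m a w = (\<Prod>i<k. a \<bullet> w i)" for a :: 'a and w
  define c where "c w = (\<Sum>a\<in>A. \<alpha> a * m a w)" for w
  have W: "finite W" by (auto simp: W_def intro!: finite_PiE)
  have pow: "(a \<bullet> b) ^ k = (\<Sum>w\<in>W. m b w * m a w)" for a b
    by (simp add: euclidean_inner[of a b] power_sum_words W_def m_def prod.distrib mult.commute)
  have px: "p x = (\<Sum>w\<in>W. c w * m x w)" for x
    unfolding p(2) pow by (subst sum_mult_swap) (simp add: c_def mult.commute)
  have "fischer k p p = (\<Sum>a\<in>A. \<alpha> a * p a)" by (rule fischer_eq[OF p assms])
  also have "\<dots> = (\<Sum>w\<in>W. (c w)\<^sup>2)"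
    unfolding px by (subst sum_mult_swap) (simp add: c_def power2_eq_square)
  finally show ?thesis using that W px by blast
qed

lemma fischer_eq_0_imp:
  assumes "p \<in> homs k" "fischer k p p = 0"
  shows "p x = 0"
  by (rule fischer_squares[OF assms(1)]) (use assms(2) in \<open>simp add: sum_nonneg_eq_0_iff\<close>)

lemma fischer_nonneg: "p \<in> homs k \<Longrightarrow> 0 \<le> fischer k p p"
  by (erule fischer_squares) (simp add: sum_nonneg)

section \<open>Gaussian integration of polynomials\<close>

definition polys :: "('a::euclidean_space \<Rightarrow> real) set" where
  "polys = fun_space.span (\<Union>k. homs k)"

lemma homs_subset_polys: "f \<in> homs k \<Longrightarrow> f \<in> polys"
  by (auto simp: polys_def intro!: fun_space.span_base)

lemma subspace_polys: "fun_space.subspace polys"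
  by (simp add: polys_def)

lemmas polys_zero = subspace_fun_zero[OF subspace_polys]
  and polys_add = subspace_fun_add[OF subspace_polys]
  and polys_diff = subspace_fun_diff[OF subspace_polys]
  and polys_scale = subspace_fun_scale[OF subspace_polys]
  and polys_sum = subspace_fun_sum[OF subspace_polys]

lemma polys_power: "(\<lambda>x. (a \<bullet> x) ^ k) \<in> polys"
  by (rule homs_subset_polys[OF homs_power])

lemma polys_induct [consumes 1, case_names zero power add scale]:
  assumes "f \<in> polys" "P (\<lambda>x. 0)" "\<And>a k. P (\<lambda>x. (a \<bullet> x) ^ k)"
    "\<And>f g. f \<in> polys \<Longrightarrow> P f \<Longrightarrow> g \<in> polys \<Longrightarrow> P g \<Longrightarrow> P (\<lambda>x. f x + g x)"
    "\<And>c f. f \<in> polys \<Longrightarrow> P f \<Longrightarrow> P (\<lambda>x. c * f x)"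
  shows "P f"
  using assms(1) unfolding polys_def
proof (induction rule: span_fun_induct)
  case (base f)
  then obtain k where "f \<in> homs k" by auto
  then show ?case
    by (induction rule: homs_induct) (use assms(2-) homs_subset_polys[of _ k] in blast)+
qed (use assms(2-) in \<open>auto simp: polys_def\<close>)

lemma polys_const: "(\<lambda>x. c) \<in> polys"
  by (rule homs_subset_polys[OF homs_const])

lemma polys_linear: "(\<lambda>x. a \<bullet> x) \<in> polys"
  by (rule homs_subset_polys[OF homs_linear])

lemma polys_mult:
  assumes "f \<in> polys" "g \<in> polys"
  shows "(\<lambda>x. f x * g x) \<in> polys"
  using assms(1)
proof (induction rule: polys_induct)
  case (power a k)
  show ?case using assms(2)
    by (induction rule: polys_induct)
       (auto simp: polys_zero homs_subset_polys[OF homs_power_mult] distrib_left polys_add mult.left_commute intro: polys_scale)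
qed (auto simp: polys_zero distrib_right polys_add mult.assoc intro: polys_scale)

lemma polys_pow: "f \<in> polys \<Longrightarrow> (\<lambda>x. f x ^ n) \<in> polys"
  by (induction n) (auto intro: polys_const polys_mult)

lemma polys_prod:
  assumes "\<And>i. i \<in> I \<Longrightarrow> f i \<in> polys"
  shows "(\<lambda>x. \<Prod>i\<in>I. f i x) \<in> polys"
  using assms by (induction I rule: infinite_finite_induct) (auto intro: polys_const polys_mult)

lemma polys_compose:
  assumes "f \<in> polys" "linear g"
  shows "(\<lambda>x. f (g x)) \<in> polys"
  using assms(1)
  by (induction rule: polys_induct)
     (auto intro: polys_zero polys_add polys_scale homs_subset_polys[OF homs_compose[OF homs_power assms(2)]])

lemma polys_line:
  assumes "f \<in> polys"
  shows "\<exists>n v. \<forall>t. f (x + t *\<^sub>R y) = (\<Sum>i\<le>n. t ^ i * v i)"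
  using assms
proof (induction rule: polys_induct)
  case (power a k)
  show ?case using homs_line[OF homs_power[of a k], of y] by metis
next
  case (add f g)
  obtain n v where 1: "\<And>t. f (x + t *\<^sub>R y) = (\<Sum>i\<le>n. t ^ i * v i)" using add.IH(1) by blast
  obtain m w where 2: "\<And>t. g (x + t *\<^sub>R y) = (\<Sum>i\<le>m. t ^ i * w i)" using add.IH(2) by blast
  have "(\<Sum>i\<le>n. t ^ i * v i) = (\<Sum>i\<le>max n m. t ^ i * (if i \<le> n then v i else 0))"
    "(\<Sum>i\<le>m. t ^ i * w i) = (\<Sum>i\<le>max n m. t ^ i * (if i \<le> m then w i else 0))" for t
    by (auto intro!: sum.mono_neutral_cong_left split: if_splits)
  then show ?case
    by (intro exI[of _ "max n m"] exI[of _ "\<lambda>i. (if i \<le> n then v i else 0) + (if i \<le> m then w i else 0)"])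
       (simp add: 1 2 sum.distrib distrib_left)
next
  case (scale c f)
  then obtain n v where "\<And>t. f (x + t *\<^sub>R y) = (\<Sum>i\<le>n. t ^ i * v i)" by blast
  then show ?case by (intro exI[of _ n] exI[of _ "\<lambda>i. c * v i"]) (simp add: sum_distrib_left mult_ac)
qed (auto intro!: exI[of _ "\<lambda>_. 0"])

lemma polys_zero_of_line:
  assumes f: "f \<in> polys" and "0 < e" "\<And>t. 0 < t \<Longrightarrow> t < e \<Longrightarrow> f (x + t *\<^sub>R y) = 0"
  shows "f (x + s *\<^sub>R y) = 0"
proof -
  obtain n v where v: "\<And>t. f (x + t *\<^sub>R y) = (\<Sum>i\<le>n. t ^ i * v i)"
    using polys_line[OF f] by metis
  have "v i = 0" if "i \<le> n" for i
    by (rule coefficients_zero[where v = v and I = "{..n}" and e = e]) (use assms that in \<open>auto simp: v[symmetric]\<close>)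
  then show ?thesis by (simp add: v)
qed

lemma polys_continuous: "f \<in> polys \<Longrightarrow> continuous_on UNIV f"
  by (induction rule: polys_induct) (auto intro!: continuous_intros)

lemma polys_measurable: "f \<in> polys \<Longrightarrow> f \<in> borel_measurable borel"
  by (rule borel_measurable_continuous_onI[OF polys_continuous])

section \<open>Directional derivatives and Gaussian integration by parts\<close>

definition has_dir_deriv :: "'a::real_vector \<Rightarrow> ('a \<Rightarrow> real) \<Rightarrow> ('a \<Rightarrow> real) \<Rightarrow> bool" where
  "has_dir_deriv a f f' \<longleftrightarrow> (\<forall>x. ((\<lambda>t. f (x + t *\<^sub>R a)) has_real_derivative f' x) (at 0))"

lemma has_dir_deriv_mult:
  assumes "has_dir_deriv a f f'" "has_dir_deriv a g g'"
  shows "has_dir_deriv a (\<lambda>x. f x * g x) (\<lambda>x. f' x * g x + f x * g' x)"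
  unfolding has_dir_deriv_def
proof
  fix x
  show "((\<lambda>t. f (x + t *\<^sub>R a) * g (x + t *\<^sub>R a)) has_real_derivative f' x * g x + f x * g' x) (at 0)"
    using DERIV_mult[OF assms[unfolded has_dir_deriv_def, rule_format, of x]] by (simp add: algebra_simps)
qed

lemma has_dir_deriv_power:
  assumes "has_dir_deriv a f f'"
  shows "has_dir_deriv a (\<lambda>x. f x ^ n) (\<lambda>x. n * f x ^ (n - 1) * f' x)"
  unfolding has_dir_deriv_def
proof
  fix x
  show "((\<lambda>t. f (x + t *\<^sub>R a) ^ n) has_real_derivative n * f x ^ (n - 1) * f' x) (at 0)"
    using DERIV_power[OF assms[unfolded has_dir_deriv_def, rule_format, of x], of n] by (simp add: algebra_simps)
qed

lemma has_dir_deriv_unique: "has_dir_deriv a f f' \<Longrightarrow> has_dir_deriv a f f'' \<Longrightarrow> f' = f''"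
  unfolding has_dir_deriv_def by (auto simp: fun_eq_iff intro: DERIV_unique)

text \<open>The moments of the standard normal law: (k - 1)!! for even k.\<close>

definition gauss_moment :: "nat \<Rightarrow> real" where
  "gauss_moment k = (if even k then fact k / (2 ^ (k div 2) * fact (k div 2)) else 0)"

lemma gauss_moment_0 [simp]: "gauss_moment 0 = 1"
  and gauss_moment_odd: "odd k \<Longrightarrow> gauss_moment k = 0"
  and gauss_moment_even: "gauss_moment (2 * k) = fact (2 * k) / (2 ^ k * fact k)"
  by (auto simp: gauss_moment_def)

lemma gauss_moment_Suc_Suc: "gauss_moment (Suc (Suc k)) = (k + 1) * gauss_moment k"
proof (cases "even k")
  case True
  then obtain j where j: "k = 2 * j" by (auto elim: evenE)
  have "fact (Suc (Suc (2 * j))) / (2 ^ Suc j * fact (Suc j)) = (2 * j + 1) * (fact (2 * j) / (2 ^ j * fact j) :: real)"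
    unfolding fact_Suc by (simp add: divide_simps)
  then have "gauss_moment (2 * Suc j) = (2 * j + 1) * gauss_moment (2 * j)"
    unfolding gauss_moment_even by simp
  then show ?thesis by (simp add: j)
qed (simp add: gauss_moment_odd)

text \<open>Moments of linear forms determine the expectation on \<open>polys\<close>, which is
  spanned by powers of linear forms. The case k = 0 says that the total mass is 1. The locale serves
  a single matrix as well as the pair (X, X0).\<close>

locale gaussian =
  fixes M :: "'w measure" and \<zeta> :: "'w \<Rightarrow> 'a::euclidean_space"
  assumes integrable_power: "integrable M (\<lambda>\<omega>. (a \<bullet> \<zeta> \<omega>) ^ k)"
    and integral_power: "(\<integral>\<omega>. (a \<bullet> \<zeta> \<omega>) ^ k \<partial>M) = gauss_moment k * norm a ^ k"
begin

definition E :: "('a \<Rightarrow> real) \<Rightarrow> real" where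
  "E f = (\<integral>\<omega>. f (\<zeta> \<omega>) \<partial>M)"

lemma integrable_polys: "f \<in> polys \<Longrightarrow> integrable M (\<lambda>\<omega>. f (\<zeta> \<omega>))"
  by (induction rule: polys_induct) (auto intro: integrable_power)

lemma E_power: "E (\<lambda>x. (a \<bullet> x) ^ k) = gauss_moment k * norm a ^ k"
  by (simp add: E_def integral_power)

lemma E_const: "E (\<lambda>x. c) = c"
  using integral_power[of undefined 0] by (simp add: E_def)

lemma E_add: "f \<in> polys \<Longrightarrow> g \<in> polys \<Longrightarrow> E (\<lambda>x. f x + g x) = E f + E g"
  by (simp add: E_def integrable_polys)

lemma E_scale: "E (\<lambda>x. c * f x) = c * E f"
  by (simp add: E_def)

lemma E_sum: "(\<And>i. i \<in> I \<Longrightarrow> f i \<in> polys) \<Longrightarrow> E (\<lambda>x. \<Sum>i\<in>I. f i x) = (\<Sum>i\<in>I. E (f i))"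
  by (simp add: E_def integrable_polys)

text \<open>Integration by parts for one power: the coefficient of t in the (k+1)-st moment of (b +
  t a) . x is computed once by the binomial theorem and once by differentiating the power of |b + t
  a| at t = 0.\<close>

lemma E_linear_mult_power: "E (\<lambda>x. (a \<bullet> x) * (b \<bullet> x) ^ k) = k * (a \<bullet> b) * E (\<lambda>x. (b \<bullet> x) ^ (k - 1))"
proof -
  define c where "c i = (Suc k choose i) * E (\<lambda>x. (a \<bullet> x) ^ i * (b \<bullet> x) ^ (Suc k - i))" for i
  have c: "gauss_moment (Suc k) * norm (b + t *\<^sub>R a) ^ Suc k = (\<Sum>i\<le>Suc k. t ^ i * c i)" for t
  proof -
    have eq: "((b + t *\<^sub>R a) \<bullet> x) ^ Suc k = (\<Sum>i\<le>Suc k. (t ^ i * (Suc k choose i)) * ((a \<bullet> x) ^ i * (b \<bullet> x) ^ (Suc k - i)))" for x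
      using binomial_ring[of "t * (a \<bullet> x)" "b \<bullet> x" "Suc k"]
      by (simp add: inner_add_left power_mult_distrib mult_ac add.commute del: sum.atMost_Suc)
    have "gauss_moment (Suc k) * norm (b + t *\<^sub>R a) ^ Suc k = E (\<lambda>x. ((b + t *\<^sub>R a) \<bullet> x) ^ Suc k)"
      by (simp only: E_power)
    also have "\<dots> = (\<Sum>i\<le>Suc k. E (\<lambda>x. (t ^ i * (Suc k choose i)) * ((a \<bullet> x) ^ i * (b \<bullet> x) ^ (Suc k - i))))"
      unfolding eq by (rule E_sum) (intro polys_scale polys_mult polys_power)
    also have "\<dots> = (\<Sum>i\<le>Suc k. t ^ i * c i)"
      by (simp only: E_scale c_def mult.assoc)
    finally show ?thesis .
  qed
  have c1: "c 1 = Suc k * E (\<lambda>x. (a \<bullet> x) * (b \<bullet> x) ^ k)" by (simp add: c_def)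
  have d: "((\<lambda>t. \<Sum>i\<le>Suc k. t ^ i * c i) has_real_derivative (\<Sum>i\<le>Suc k. (i * 0 ^ (i - 1)) * c i)) (at 0)"
    by (auto intro!: derivative_eq_intros simp del: sum.atMost_Suc)
  have "(\<Sum>i\<le>Suc k. (i * 0 ^ (i - 1)) * c i) = (\<Sum>i\<in>{1}. c i)"
    by (rule sum.mono_neutral_cong_right) auto
  then have s: "(\<Sum>i\<le>Suc k. (i * 0 ^ (i - 1)) * c i) = c 1" by simp
  have d1: "((\<lambda>t. gauss_moment (Suc k) * norm (b + t *\<^sub>R a) ^ Suc k) has_real_derivative c 1) (at 0)"
    using d unfolding c s .
  show ?thesis
  \<comment> \<open>If k is even, the moment of order k + 1 vanishes; if k is odd, the power of the
    norm is a polynomial in t, so the norm itself is never differentiated.\<close>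
  proof (cases "odd k")
    case False
    then have "gauss_moment (Suc k) = 0" by (simp add: gauss_moment_odd)
    with d1 have "((\<lambda>t. 0) has_real_derivative c 1) (at 0)" by simp
    from DERIV_unique[OF this DERIV_const] have "c 1 = 0" .
    then have "E (\<lambda>x. (a \<bullet> x) * (b \<bullet> x) ^ k) = 0" using c1 by simp
    moreover have "k * E (\<lambda>x. (b \<bullet> x) ^ (k - 1)) = 0"
      using False by (cases k) (auto simp: E_power gauss_moment_odd)
    ultimately show ?thesis by (simp only: mult.commute[of _ "a \<bullet> b"] mult.assoc mult_zero_right)
  next
    case True
    then obtain m where m: "k = Suc (2 * m)" by (auto elim: oddE)
    have nrm: "norm (b + t *\<^sub>R a) ^ Suc k = (b \<bullet> b + 2 * t * (a \<bullet> b) + t\<^sup>2 * (a \<bullet> a)) ^ Suc m" for t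
    proof -
      have "norm (b + t *\<^sub>R a) ^ Suc k = ((norm (b + t *\<^sub>R a))\<^sup>2) ^ Suc m"
        unfolding m power_mult[symmetric] by simp
      also have "(norm (b + t *\<^sub>R a))\<^sup>2 = b \<bullet> b + 2 * t * (a \<bullet> b) + t\<^sup>2 * (a \<bullet> a)"
        unfolding power2_norm_eq_inner by (simp add: inner_add_left inner_add_right inner_commute[of b a] power2_eq_square distrib_left mult.assoc)
      finally show ?thesis .
    qed
    have q: "((\<lambda>t. b \<bullet> b + 2 * t * (a \<bullet> b) + t\<^sup>2 * (a \<bullet> a)) has_real_derivative 2 * (a \<bullet> b)) (at 0)"
      by (auto intro!: derivative_eq_intros)
    have "((\<lambda>t. gauss_moment (Suc k) * (b \<bullet> b + 2 * t * (a \<bullet> b) + t\<^sup>2 * (a \<bullet> a)) ^ Suc m)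
        has_real_derivative gauss_moment (Suc k) * (Suc m * (b \<bullet> b) ^ m * (2 * (a \<bullet> b)))) (at 0)"
      using DERIV_cmult[OF DERIV_power[OF q, of "Suc m"], of "gauss_moment (Suc k)"] by (simp add: mult_ac)
    then have "c 1 = gauss_moment (Suc k) * (Suc m * (b \<bullet> b) ^ m * (2 * (a \<bullet> b)))"
      using DERIV_unique d1[unfolded nrm] by blast
    also have "\<dots> = gauss_moment (Suc k) * (Suc k * (a \<bullet> b) * (b \<bullet> b) ^ m)" by (simp add: m)
    also have "(b \<bullet> b) ^ m = norm b ^ (k - 1)" by (simp add: m power_mult power2_norm_eq_inner)
    also have "gauss_moment (Suc k) = k * gauss_moment (k - 1)"
      by (simp add: m gauss_moment_Suc_Suc)
    finally have "Suc k * E (\<lambda>x. (a \<bullet> x) * (b \<bullet> x) ^ k) = Suc k * (k * (a \<bullet> b) * E (\<lambda>x. (b \<bullet> x) ^ (k - 1)))"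
      unfolding c1 E_power by (simp only: mult_ac)
    then show ?thesis by (simp del: of_nat_Suc)
  qed
qed

lemma by_parts_aux:
  assumes "f \<in> polys"
  shows "\<exists>f'\<in>polys. has_dir_deriv a f f' \<and> E (\<lambda>x. (a \<bullet> x) * f x) = E f'"
  using assms
proof (induction rule: polys_induct)
  case zero
  show ?case by (intro bexI[of _ "\<lambda>x. 0"]) (auto simp: polys_zero has_dir_deriv_def)
next
  case (power b k)
  have "has_dir_deriv a (\<lambda>x. (b \<bullet> x) ^ k) (\<lambda>x. (k * (a \<bullet> b)) * (b \<bullet> x) ^ (k - 1))"
    unfolding has_dir_deriv_def
    by (auto intro!: derivative_eq_intros simp: inner_add_right inner_commute)
  moreover have "E (\<lambda>x. (a \<bullet> x) * (b \<bullet> x) ^ k) = E (\<lambda>x. (k * (a \<bullet> b)) * (b \<bullet> x) ^ (k - 1))"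
    by (simp only: E_scale E_linear_mult_power)
  ultimately show ?case using polys_scale[OF polys_power] by blast
next
  case (add f g)
  obtain f' where f: "f' \<in> polys" "has_dir_deriv a f f'" "E (\<lambda>x. (a \<bullet> x) * f x) = E f'" using add.IH(1) by blast
  obtain g' where g: "g' \<in> polys" "has_dir_deriv a g g'" "E (\<lambda>x. (a \<bullet> x) * g x) = E g'" using add.IH(2) by blast
  have "has_dir_deriv a (\<lambda>x. f x + g x) (\<lambda>x. f' x + g' x)"
    using f(2) g(2) unfolding has_dir_deriv_def by (auto intro!: DERIV_add)
  moreover have "E (\<lambda>x. (a \<bullet> x) * (f x + g x)) = E (\<lambda>x. f' x + g' x)"
    by (simp add: distrib_left E_add add.hyps polys_mult polys_linear f g)
  ultimately show ?case using polys_add[OF f(1) g(1)] by blast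
next
  case (scale c f)
  obtain f' where f: "f' \<in> polys" "has_dir_deriv a f f'" "E (\<lambda>x. (a \<bullet> x) * f x) = E f'" using scale.IH by blast
  have "has_dir_deriv a (\<lambda>x. c * f x) (\<lambda>x. c * f' x)"
    using f(2) unfolding has_dir_deriv_def by (auto intro!: DERIV_cmult)
  moreover have "E (\<lambda>x. (a \<bullet> x) * (c * f x)) = E (\<lambda>x. c * f' x)"
    by (simp add: mult.left_commute[of _ c] E_scale f)
  ultimately show ?case using polys_scale[OF f(1)] by blast
qed

text \<open>Uniqueness of derivatives carries the result of \<open>by_parts_aux\<close> over to any
  function known to be the derivative. Such a function is then a polynomial even if its formula does
  not show it, as happens for \<open>minor_grad\<close>.\<close>

lemma
  assumes "f \<in> polys" "has_dir_deriv a f f'"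
  shows dir_deriv_polys: "f' \<in> polys" and integration_by_parts: "E (\<lambda>x. (a \<bullet> x) * f x) = E f'"
  using by_parts_aux[OF assms(1), of a] has_dir_deriv_unique[OF assms(2)] by auto

end

section \<open>Hermite polynomials in one variable\<close>

text \<open>The polynomials with generating function exp (u t + v t^2 / 2). For v < 0 they are
  orthogonal for the normal law of variance - v. Both signs occur: the negative one in the Hermite
  polynomials, the positive one in the identification of the generalized binomial
  coefficients.\<close>

fun herm :: "nat \<Rightarrow> real \<Rightarrow> real \<Rightarrow> real" where
  "herm 0 v u = 1"
| "herm (Suc 0) v u = u"
| "herm (Suc (Suc k)) v u = u * herm (Suc k) v u + (k + 1) * v * herm k v u"

fun herm_coeff :: "nat \<Rightarrow> nat \<Rightarrow> real" where
  "herm_coeff 0 j = (if j = 0 then 1 else 0)"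
| "herm_coeff (Suc 0) j = (if j = 0 then 1 else 0)"
| "herm_coeff (Suc (Suc k)) j = herm_coeff (Suc k) j + (if j = 0 then 0 else (real k + 1) * herm_coeff k (j - 1))"

lemma herm_Suc: "herm (Suc k) v u = u * herm k v u + k * v * herm (k - 1) v u"
  by (cases k) auto

lemma herm_coeff_eq_0: "k < 2 * j \<Longrightarrow> herm_coeff k j = 0"
  by (induction k j rule: herm_coeff.induct) auto

text \<open>The upper limit is left free so that the two sums in the recursion can be matched. Terms
  with 2 j > k, whose exponent is truncated to 0, have coefficient 0.\<close>

lemma herm_expand: "k \<le> n \<Longrightarrow> herm k v u = (\<Sum>j\<le>n. herm_coeff k j * v ^ j * u ^ (k - 2 * j))"
proof (induction k v u rule: herm.induct)
  case (1 v u)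
  have "(\<Sum>j\<le>n. herm_coeff 0 j * v ^ j * u ^ (0 - 2 * j)) = (\<Sum>j\<in>{0::nat}. 1::real)"
    by (rule sum.mono_neutral_cong_right) auto
  then show ?case by simp
next
  case (2 v u)
  have "(\<Sum>j\<le>n. herm_coeff (Suc 0) j * v ^ j * u ^ (Suc 0 - 2 * j)) = (\<Sum>j\<in>{0::nat}. u)"
    by (rule sum.mono_neutral_cong_right) auto
  then show ?case by simp
next
  case (3 k v u)
  obtain m where m: "n = Suc m" using 3 by (cases n) auto
  have eq1: "u * (herm_coeff (Suc k) j * v ^ j * u ^ (Suc k - 2 * j)) = herm_coeff (Suc k) j * v ^ j * u ^ (Suc (Suc k) - 2 * j)" for j
    by (cases "2 * j \<le> Suc k") (auto simp: herm_coeff_eq_0 Suc_diff_le)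
  have eq2: "(k + 1) * v * (\<Sum>j\<le>m. herm_coeff k j * v ^ j * u ^ (k - 2 * j)) =
    (\<Sum>j\<le>n. (if j = 0 then 0 else (real k + 1) * herm_coeff k (j - 1)) * v ^ j * u ^ (Suc (Suc k) - 2 * j))"
    unfolding m by (subst sum.atMost_Suc_shift) (simp add: sum_distrib_left mult_ac add_ac)
  have "herm k v u = (\<Sum>j\<le>n. herm_coeff k j * v ^ j * u ^ (k - 2 * j))" by (rule 3(2)) (use 3(3) in simp)
  also have "\<dots> = (\<Sum>j\<le>m. herm_coeff k j * v ^ j * u ^ (k - 2 * j))"
    using 3(3) by (simp add: m herm_coeff_eq_0)
  finally have 2: "herm k v u = (\<Sum>j\<le>m. herm_coeff k j * v ^ j * u ^ (k - 2 * j))" .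
  have 1: "herm (Suc k) v u = (\<Sum>j\<le>n. herm_coeff (Suc k) j * v ^ j * u ^ (Suc k - 2 * j))"
    by (rule 3(1)) (use 3(3) in simp)
  have "herm (Suc (Suc k)) v u = u * (\<Sum>j\<le>n. herm_coeff (Suc k) j * v ^ j * u ^ (Suc k - 2 * j))
     + (k + 1) * v * (\<Sum>j\<le>m. herm_coeff k j * v ^ j * u ^ (k - 2 * j))" unfolding herm.simps(3) 1 2 by simp
  then show ?case unfolding eq2
    by (simp add: sum_distrib_left eq1 sum.distrib[symmetric] distrib_right del: herm.simps)
qed

lemma herm_deriv: "((\<lambda>u. herm k v u) has_real_derivative k * herm (k - 1) v u) (at u)"
proof (induction k v u rule: herm.induct)
  case (3 k v u)
  have "((\<lambda>u. herm (Suc (Suc k)) v u) has_real_derivative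
     (herm (Suc k) v u + u * (Suc k * herm k v u) + (k + 1) * v * (k * herm (k - 1) v u))) (at u)"
    using 3 by (auto intro!: derivative_eq_intros)
  also have "herm (Suc k) v u + u * (Suc k * herm k v u) + (k + 1) * v * (k * herm (k - 1) v u) = Suc (Suc k) * herm (Suc k) v u"
    unfolding herm_Suc[of k] by (simp add: algebra_simps)
  finally show ?case by simp
qed (auto intro!: derivative_eq_intros)

lemma herm_polys: "(\<lambda>x. herm k v (a \<bullet> x)) \<in> polys"
  by (induction k v "undefined :: real" rule: herm.induct)
     (auto intro!: polys_const polys_linear polys_add polys_mult)

lemma herm_dir_deriv: "has_dir_deriv b (\<lambda>x. herm k v (a \<bullet> x)) (\<lambda>x. (k * (a \<bullet> b)) * herm (k - 1) v (a \<bullet> x))"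
  unfolding has_dir_deriv_def
proof
  fix x
  have 1: "((\<lambda>t. a \<bullet> x + t * (a \<bullet> b)) has_real_derivative (a \<bullet> b)) (at 0)"
    by (auto intro!: derivative_eq_intros)
  have 2: "((\<lambda>u. herm k v u) has_real_derivative k * herm (k - 1) v (a \<bullet> x)) (at (a \<bullet> x + 0 * (a \<bullet> b)))"
    using herm_deriv by simp
  show "((\<lambda>t. herm k v (a \<bullet> (x + t *\<^sub>R b))) has_real_derivative (k * (a \<bullet> b)) * herm (k - 1) v (a \<bullet> x)) (at 0)"
    using DERIV_chain2[OF 2 1] by (simp add: inner_add_right mult_ac)
qed

context gaussian
begin

text \<open>For v \<ge> 0, \<open>herm (2 * k) v\<close> at u is the moment of order 2k of u plus a
  centred normal variable of variance v, and independent variances add up. The recursion and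
  integration by parts prove the identity for both signs of v.\<close>

lemma E_herm_even: "E (\<lambda>x. herm (2 * k) v (a \<bullet> x)) = gauss_moment (2 * k) * ((norm a)\<^sup>2 + v) ^ k"
proof (induction k)
  case (Suc k)
  let ?n = "Suc (2 * k)"
  have "E (\<lambda>x. herm (2 * Suc k) v (a \<bullet> x)) =
    E (\<lambda>x. (a \<bullet> x) * herm ?n v (a \<bullet> x) + (?n * v) * herm (2 * k) v (a \<bullet> x))" by (simp add: add_ac)
  also have "\<dots> = E (\<lambda>x. (a \<bullet> x) * herm ?n v (a \<bullet> x)) + (?n * v) * E (\<lambda>x. herm (2 * k) v (a \<bullet> x))"
    by (subst E_add) (auto simp: E_scale intro!: polys_mult polys_linear herm_polys polys_scale)
  also have "E (\<lambda>x. (a \<bullet> x) * herm ?n v (a \<bullet> x)) = (?n * (norm a)\<^sup>2) * E (\<lambda>x. herm (2 * k) v (a \<bullet> x))"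
    by (subst integration_by_parts[OF herm_polys herm_dir_deriv]) (simp only: E_scale power2_norm_eq_inner diff_Suc_1)
  finally show ?case using Suc by (simp add: gauss_moment_Suc_Suc algebra_simps)
qed (simp add: E_const)

text \<open>With the parameter - |a|^2, the term in which the first factor is differentiated cancels
  against the second term of the recursion of \<open>herm\<close>; the derivative of the second
  factor is what remains.\<close>

lemma E_herm_rec:
  "E (\<lambda>x. herm (Suc k) (- (norm a)\<^sup>2) (a \<bullet> x) * herm l w (b \<bullet> x)) =
   (l * (a \<bullet> b)) * E (\<lambda>x. herm k (- (norm a)\<^sup>2) (a \<bullet> x) * herm (l - 1) w (b \<bullet> x))"
proof -
  let ?v = "- (norm a)\<^sup>2"
  let ?h = "\<lambda>k x. herm k ?v (a \<bullet> x)" and ?g = "\<lambda>l x. herm l w (b \<bullet> x)"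
  note P = polys_mult polys_linear herm_polys polys_scale polys_add
  have "E (\<lambda>x. ?h (Suc k) x * ?g l x) = E (\<lambda>x. (a \<bullet> x) * (?h k x * ?g l x) + (k * ?v) * (?h (k - 1) x * ?g l x))"
    by (simp add: herm_Suc algebra_simps)
  also have "\<dots> = E (\<lambda>x. (a \<bullet> x) * (?h k x * ?g l x)) + (k * ?v) * E (\<lambda>x. ?h (k - 1) x * ?g l x)"
    by (subst E_add[OF _ polys_scale]) (simp_all only: E_scale, (intro P)+)
  also have "E (\<lambda>x. (a \<bullet> x) * (?h k x * ?g l x)) =
    E (\<lambda>x. (k * (a \<bullet> a)) * ?h (k - 1) x * ?g l x + ?h k x * ((l * (b \<bullet> a)) * ?g (l - 1) x))"
    by (rule integration_by_parts[OF _ has_dir_deriv_mult[OF herm_dir_deriv herm_dir_deriv]]) (intro P)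
  also have "\<dots> = E (\<lambda>x. (k * (a \<bullet> a)) * (?h (k - 1) x * ?g l x) + (l * (a \<bullet> b)) * (?h k x * ?g (l - 1) x))"
    by (simp add: mult_ac inner_commute)
  also have "\<dots> = (k * (a \<bullet> a)) * E (\<lambda>x. ?h (k - 1) x * ?g l x) + (l * (a \<bullet> b)) * E (\<lambda>x. ?h k x * ?g (l - 1) x)"
    by (subst E_add) (auto simp: E_scale intro!: P)
  finally show ?thesis by (simp add: power2_norm_eq_inner)
qed

lemma E_herm_herm:
  "E (\<lambda>x. herm k (- (norm a)\<^sup>2) (a \<bullet> x) * herm l (- (norm b)\<^sup>2) (b \<bullet> x)) =
   (if k = l then fact k * (a \<bullet> b) ^ k else 0)"
proof (induction k arbitrary: l)
  case 0
  show ?case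
  proof (cases l)
    case (Suc m)
    \<comment> \<open>The recursion lowers the index of the first factor, so the two factors change
      places; the factor of index 0 has derivative 0.\<close>
    then show ?thesis using E_herm_rec[of m b 0 0 a] by simp
  qed (simp add: E_const)
next
  case (Suc k)
  show ?case
    by (cases l) (simp_all only: E_herm_rec, simp_all add: Suc)
qed

end

section \<open>Normal random variables\<close>

lemma normal_moments:
  assumes "prob_space M" and X: "distributed M lborel X (normal_density 0 s)" and s: "0 < s"
  shows "integrable M (\<lambda>\<omega>. X \<omega> ^ k)" "(\<integral>\<omega>. X \<omega> ^ k \<partial>M) = gauss_moment k * s ^ k"
proof -
  interpret prob_space M by fact
  have m: "integrable lborel (\<lambda>x. normal_density 0 s x * x ^ k)"
    using integrable_normal_moment[OF s, of 0 k] by simp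
  have "integrable lborel (\<lambda>x. normal_density 0 s x * x ^ k) \<longleftrightarrow> integrable M (\<lambda>\<omega>. X \<omega> ^ k)"
    by (rule distributed_integrable[OF X]) (auto simp: normal_density_nonneg)
  then show "integrable M (\<lambda>\<omega>. X \<omega> ^ k)" using m by simp
  have "(\<integral>\<omega>. X \<omega> ^ k \<partial>M) = (\<integral>x. normal_density 0 s x * x ^ k \<partial>lborel)"
    by (rule distributed_integral[OF X, symmetric]) (auto simp: normal_density_nonneg)
  also have "\<dots> = gauss_moment k * s ^ k"
  proof (cases "even k")
    case True
    then obtain j where "k = 2 * j" by (auto elim: evenE)
    then show ?thesis using integral_normal_moment_even[OF s, of 0 j] s
      by (simp add: gauss_moment_even power_divide power_mult divide_simps)
  next
    case False
    then obtain j where "k = 2 * j + 1" by (auto elim: oddE)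
    then show ?thesis using integral_normal_moment_odd[OF s, of 0 j]
      by (simp add: gauss_moment_odd)
  qed
  finally show "(\<integral>\<omega>. X \<omega> ^ k \<partial>M) = gauss_moment k * s ^ k" .
qed

lemma normal_linear_combination:
  assumes "prob_space M" "finite I" and ind: "prob_space.indep_vars M (\<lambda>_. borel) Z I"
    and Z: "\<And>i. i \<in> I \<Longrightarrow> distributed M lborel (Z i) std_normal_density"
    and c: "0 < (\<Sum>i\<in>I. (c i)\<^sup>2)"
  shows "distributed M lborel (\<lambda>\<omega>. \<Sum>i\<in>I. c i * Z i \<omega>) (normal_density 0 (sqrt (\<Sum>i\<in>I. (c i)\<^sup>2)))"
proof -
  interpret prob_space M by fact
  \<comment> \<open>A vanishing coefficient would give a normal law of standard deviation 0, which
    has no density.\<close>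
  define J where "J = {i\<in>I. c i \<noteq> 0}"
  have J: "finite J" "J \<subseteq> I" "J \<noteq> {}"
    using assms(2) c by (auto simp: J_def intro: ccontr)
  have 1: "(\<Sum>i\<in>I. c i * Z i \<omega>) = (\<Sum>i\<in>J. c i * Z i \<omega>)" "(\<Sum>i\<in>I. (c i)\<^sup>2) = (\<Sum>i\<in>J. \<bar>c i\<bar>\<^sup>2)" for \<omega>
    using assms(2) by (auto simp: J_def intro!: sum.mono_neutral_cong_right)
  have "indep_vars (\<lambda>_. borel) (\<lambda>i \<omega>. c i * Z i \<omega>) J"
    using indep_vars_compose2[OF indep_vars_subset[OF ind J(2)], of "\<lambda>i x. c i * x" "\<lambda>_. borel"] by simp
  moreover have "distributed M lborel (\<lambda>\<omega>. c i * Z i \<omega>) (normal_density 0 \<bar>c i\<bar>)" if "i \<in> J" for i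
    using normal_density_affine[OF Z, of i "c i" 0] that by (auto simp: J_def)
  ultimately have "distributed M lborel (\<lambda>\<omega>. \<Sum>i\<in>J. c i * Z i \<omega>) (normal_density (\<Sum>i\<in>J. 0) (sqrt (\<Sum>i\<in>J. \<bar>c i\<bar>\<^sup>2)))"
    using J by (intro sum_indep_normal) (auto simp: J_def)
  then show ?thesis by (simp add: 1)
qed

lemma gaussianI_normal:
  assumes M: "prob_space M"
    and "\<And>a. a \<noteq> 0 \<Longrightarrow> distributed M lborel (\<lambda>\<omega>. a \<bullet> \<zeta> \<omega>) (normal_density 0 (norm a))"
  shows "gaussian M \<zeta>"
proof
  interpret prob_space M by fact
  fix a k
  show "integrable M (\<lambda>\<omega>. (a \<bullet> \<zeta> \<omega>) ^ k)"
    using normal_moments(1)[OF M assms(2), of a k] by (cases "a = 0") (auto simp: power_0_left)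
  show "(\<integral>\<omega>. (a \<bullet> \<zeta> \<omega>) ^ k \<partial>M) = gauss_moment k * norm a ^ k"
    using normal_moments(2)[OF M assms(2), of a k] by (cases "a = 0") (auto simp: power_0_left prob_space)
qed

text \<open>Several statements about zonal polynomials are proved by taking expectations although no
  probability space occurs in them; this provides one in every dimension.\<close>

lemma ex_gaussian: "\<exists>(M :: ('a \<Rightarrow> real) measure) (\<zeta> :: ('a \<Rightarrow> real) \<Rightarrow> 'a::euclidean_space). gaussian M \<zeta>"
proof -
  define N where "N = density lborel (\<lambda>x. ennreal (std_normal_density x))"
  define M where "M = PiM (Basis :: 'a set) (\<lambda>_. N)"
  interpret N: prob_space N unfolding N_def by (rule prob_space_normal_density) simp
  interpret P: product_prob_space "\<lambda>_. N" "Basis :: 'a set" ..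
  have M: "prob_space M" unfolding M_def by (rule prob_space_PiM) (rule N.prob_space_axioms)
  interpret prob_space M by (rule M)
  have sets: "sets N = sets borel" by (simp add: N_def)
  have comp: "(\<lambda>\<omega>. \<omega> b) \<in> M \<rightarrow>\<^sub>M N" if "b \<in> Basis" for b :: 'a
    using that by (simp add: M_def)
  have distr: "distr M N (\<lambda>\<omega>. \<omega> b) = N" if "b \<in> Basis" for b :: 'a
    using that unfolding M_def by (intro distr_PiM_component N.prob_space_axioms) auto
  have ind: "indep_vars (\<lambda>_. N) (\<lambda>b \<omega>. \<omega> b) (Basis :: 'a set)"
  proof (subst indep_vars_iff_distr_eq_PiM')
    have "distr M (Pi\<^sub>M Basis (\<lambda>_. N)) (\<lambda>\<omega>. \<lambda>b\<in>Basis. \<omega> b) = distr M M (\<lambda>\<omega>. \<omega>)"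
      unfolding M_def by (rule distr_cong) (auto simp: space_PiM PiE_def extensional_restrict)
    also have "\<dots> = M" by (simp add: distr_id)
    also have "\<dots> = Pi\<^sub>M Basis (\<lambda>b. distr M N (\<lambda>\<omega>. \<omega> b))"
      by (subst (1) M_def) (rule PiM_cong, auto simp: distr)
    finally show "distr M (Pi\<^sub>M Basis (\<lambda>_. N)) (\<lambda>\<omega>. \<lambda>b\<in>Basis. \<omega> b) = Pi\<^sub>M Basis (\<lambda>b. distr M N (\<lambda>\<omega>. \<omega> b))" .
  qed (use comp in auto)
  have ind': "indep_vars (\<lambda>_. borel) (\<lambda>b \<omega>. \<omega> b) (Basis :: 'a set)"
    using ind by (simp add: indep_vars_def sets cong: measurable_cong_sets)
  have nd: "distributed M lborel (\<lambda>\<omega>. \<omega> b) std_normal_density" if "b \<in> Basis" for b :: 'a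
  proof -
    have "distr M lborel (\<lambda>\<omega>. \<omega> b) = distr M N (\<lambda>\<omega>. \<omega> b)"
      by (rule distr_cong) (auto simp: sets)
    then show ?thesis using distr[OF that] comp[OF that]
      by (auto simp: distributed_def N_def[symmetric] sets cong: measurable_cong_sets)
  qed
  define \<zeta> :: "('a \<Rightarrow> real) \<Rightarrow> 'a" where "\<zeta> \<omega> = (\<Sum>b\<in>Basis. \<omega> b *\<^sub>R b)" for \<omega>
  have "gaussian M \<zeta>"
  proof (rule gaussianI_normal[OF M])
    fix a :: 'a assume "a \<noteq> 0"
    have n: "(\<Sum>b\<in>Basis. (a \<bullet> b)\<^sup>2) = (norm a)\<^sup>2"
      by (simp only: power2_norm_eq_inner) (simp only: euclidean_inner[of a a] power2_eq_square)
    then show "distributed M lborel (\<lambda>\<omega>. a \<bullet> \<zeta> \<omega>) (normal_density 0 (norm a))"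
      using normal_linear_combination[OF M finite_Basis ind' nd, of "\<lambda>b. a \<bullet> b"] \<open>a \<noteq> 0\<close>
      by (simp add: \<zeta>_def inner_sum_right mult.commute n)
  qed
  then show ?thesis by blast
qed

section \<open>Matrices\<close>

lemma linear_matrix_mult_left: "linear (\<lambda>x :: ('k::finite, 'n::finite) rmat. (A :: ('m::finite, 'k) rmat) ** x)"
  by (rule linearI)
     (auto simp: matrix_matrix_mult_def vec_eq_iff sum.distrib sum_distrib_left algebra_simps)

lemma linear_matrix_mult_right: "linear (\<lambda>x :: ('m::finite, 'k::finite) rmat. x ** (A :: ('k, 'n::finite) rmat))"
  by (rule linearI)
     (auto simp: matrix_matrix_mult_def vec_eq_iff sum.distrib sum_distrib_left algebra_simps)

lemma inner_rmat: "x \<bullet> y = (\<Sum>i\<in>UNIV. \<Sum>j\<in>UNIV. x $ i $ j * y $ i $ j)" for x y :: "('m::finite, 'n::finite) rmat"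
  by (simp add: inner_vec_def)

lemma inner_matrix_mult_left: "(A ** x) \<bullet> y = x \<bullet> (transpose A ** y)" for x :: "('k::finite, 'n::finite) rmat" and A :: "('m::finite, 'k) rmat"
proof -
  have "(A ** x) \<bullet> y = (\<Sum>i\<in>UNIV. \<Sum>j\<in>UNIV. \<Sum>k\<in>UNIV. A $ i $ k * x $ k $ j * y $ i $ j)"
    by (simp add: inner_rmat matrix_matrix_mult_def sum_distrib_right)
  also have "\<dots> = (\<Sum>i\<in>UNIV. \<Sum>k\<in>UNIV. \<Sum>j\<in>UNIV. A $ i $ k * x $ k $ j * y $ i $ j)"
    by (intro sum.cong refl sum.swap)
  also have "\<dots> = (\<Sum>k\<in>UNIV. \<Sum>i\<in>UNIV. \<Sum>j\<in>UNIV. A $ i $ k * x $ k $ j * y $ i $ j)"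
    by (rule sum.swap)
  also have "\<dots> = (\<Sum>k\<in>UNIV. \<Sum>j\<in>UNIV. \<Sum>i\<in>UNIV. A $ i $ k * x $ k $ j * y $ i $ j)"
    by (intro sum.cong refl sum.swap)
  also have "\<dots> = x \<bullet> (transpose A ** y)"
    by (simp add: inner_rmat matrix_matrix_mult_def transpose_def sum_distrib_left mult_ac)
  finally show ?thesis .
qed

lemma inner_transpose: "transpose x \<bullet> transpose y = x \<bullet> y" for x y :: "('m::finite, 'n::finite) rmat"
  by (simp add: inner_rmat transpose_def) (rule sum.swap)

lemma inner_matrix_mult_right: "(x ** A) \<bullet> y = x \<bullet> (y ** transpose A)" for x :: "('m::finite, 'k::finite) rmat" and A :: "('k, 'n::finite) rmat"
proof -
  have "(x ** A) \<bullet> y = (transpose A ** transpose x) \<bullet> transpose y"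
    by (metis inner_transpose matrix_transpose_mul)
  also have "\<dots> = transpose x \<bullet> (A ** transpose y)"
    by (simp add: inner_matrix_mult_left)
  also have "\<dots> = x \<bullet> (y ** transpose A)"
    by (metis inner_transpose matrix_transpose_mul transpose_transpose)
  finally show ?thesis .
qed

lemma entry_homs: "(\<lambda>x :: ('m::finite, 'n::finite) rmat. x $ i $ j) \<in> homs 1"
proof -
  have "x $ i $ j = axis i (axis j 1) \<bullet> x" for x :: "('m, 'n) rmat"
    by (simp add: inner_axis')
  then show ?thesis using homs_linear[of "axis i (axis j 1) :: ('m, 'n) rmat"] by simp
qed

lemma invertible_matrix_mult_eq_0_iff: "invertible A \<Longrightarrow> A *v x = 0 \<longleftrightarrow> x = (0 :: real^'n)" for A :: "('n::finite, 'n) rmat"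
  by (metis invertible_def matrix_vector_mul_assoc matrix_vector_mul_lid matrix_vector_mult_0_right)

lemma invertible_iff_ker: "invertible A \<longleftrightarrow> (\<forall>x. A *v x = 0 \<longrightarrow> x = 0)" for A :: "('n::finite, 'n) rmat"
  by (simp add: invertible_left_inverse matrix_left_invertible_ker)

lemma invertible_transpose: "invertible A \<Longrightarrow> invertible (transpose A)" for A :: "('n::finite, 'n) rmat"
  unfolding invertible_def by (metis matrix_transpose_mul transpose_mat)

text \<open>Positions are counted from 0, like the parts of a partition; the index set in
  \<open>leading_minor j\<close> consists of the i with \<open>rank_of i < j\<close>.\<close>

definition rank_of :: "'m::{finite,linorder} \<Rightarrow> nat" where
  "rank_of i = card {h. h < i}"

lemma rank_of_less_iff: "rank_of i < rank_of j \<longleftrightarrow> i < j"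
proof -
  have *: "rank_of i < rank_of j" if "i < j" for i j :: 'a
    unfolding rank_of_def using that by (intro psubset_card_mono) auto
  show ?thesis using *[of i j] *[of j i] by (cases i j rule: linorder_cases) auto
qed

lemma inj_rank_of: "inj rank_of"
  by (metis injI linorder_neq_iff order_less_irrefl rank_of_less_iff)

lemma rank_of_less_card: "rank_of (i :: 'm) < CARD('m::{finite,linorder})"
  unfolding rank_of_def by (intro psubset_card_mono) auto

lemma range_rank_of: "range (rank_of :: 'm \<Rightarrow> nat) = {..<CARD('m::{finite,linorder})}"
  by (rule card_subset_eq) (auto simp: rank_of_less_card card_image inj_rank_of)

lemma ex_rank_of:
  assumes "j < CARD('m::{finite,linorder})"
  obtains i :: "'m::{finite,linorder}" where "rank_of i = j"
  using assms range_rank_of[where 'm = 'm] by (metis imageE lessThan_iff)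

lemma card_rank_of_less: "j \<le> CARD('m::{finite,linorder}) \<Longrightarrow> card {i :: 'm. rank_of i < j} = j"
proof -
  assume j: "j \<le> CARD('m)"
  have "rank_of ` {i :: 'm. rank_of i < j} = {..<j}"
    using ex_rank_of[where 'm = 'm] j by (auto simp: image_iff) (metis order_less_le_trans)
  then show ?thesis by (metis card_image card_lessThan inj_rank_of inj_on_subset subset_UNIV)
qed

section \<open>Triangular reduction\<close>

definition lower :: "('m::{finite,linorder}, 'm) rmat \<Rightarrow> bool" where
  "lower T \<longleftrightarrow> (\<forall>i j. i < j \<longrightarrow> T $ i $ j = 0)"

text \<open>Positivity of the quadratic form of a matrix that may be non-symmetric:
  \<open>zspace_orthogonal\<close> applies it to arbitrary matrices near the identity.\<close>

definition pos_form :: "('m::finite, 'm) rmat \<Rightarrow> bool" where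
  "pos_form A \<longleftrightarrow> (\<forall>x. x \<noteq> 0 \<longrightarrow> 0 < x \<bullet> (A *v x))"

lemma lower_mult: "lower A \<Longrightarrow> lower B \<Longrightarrow> lower (A ** B)"
  unfolding lower_def matrix_matrix_mult_def
  by (auto intro!: sum.neutral) (metis linorder_neqE order_less_trans)

lemma lower_mult_diag:
  assumes "lower A" "lower B"
  shows "(A ** B) $ i $ i = A $ i $ i * B $ i $ i"
proof -
  have "(A ** B) $ i $ i = (\<Sum>k\<in>UNIV. A $ i $ k * B $ k $ i)" by (simp add: matrix_matrix_mult_def)
  also have "\<dots> = (\<Sum>k\<in>{i}. A $ i $ k * B $ k $ i)"
    by (rule sum.mono_neutral_right) (use assms in \<open>auto simp: lower_def neq_iff\<close>)
  finally show ?thesis by simp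
qed

lemma lower_invertible:
  assumes "lower T" "\<And>i. T $ i $ i \<noteq> 0"
  shows "invertible T"
  unfolding invertible_iff_ker
proof (intro allI impI)
  fix x assume x: "T *v x = 0"
  have "x $ i = 0" for i
  proof (induction i rule: measure_induct_rule[of rank_of])
    case (less i)
    have "0 = (\<Sum>j\<in>UNIV. T $ i $ j * x $ j)" using x by (simp add: matrix_vector_mult_def vec_eq_iff)
    also have "\<dots> = (\<Sum>j\<in>{i}. T $ i $ j * x $ j)"
      by (rule sum.mono_neutral_right) (use assms(1) less in \<open>auto simp: lower_def neq_iff rank_of_less_iff\<close>)
    finally show ?case using assms(2)[of i] by simp
  qed
  then show "x = 0" by (simp add: vec_eq_iff)
qed

lemma inner_matrix_vector: "(x :: real^'m::finite) \<bullet> (A *v y) = (transpose A *v x) \<bullet> y"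
  by (metis dot_lmul_matrix transpose_matrix_vector)

lemma pos_form_congruence:
  fixes A L :: "('m::finite, 'm) rmat"
  assumes "pos_form A" "invertible L"
  shows "pos_form (L ** A ** transpose L)"
  unfolding pos_form_def
proof (intro allI impI)
  fix x :: "real^'m" assume "x \<noteq> 0"
  then have "transpose L *v x \<noteq> 0"
    using invertible_matrix_mult_eq_0_iff[OF invertible_transpose[OF assms(2)], of x] by blast
  then have "0 < (transpose L *v x) \<bullet> (A *v (transpose L *v x))" using assms(1) by (simp add: pos_form_def)
  then show "0 < x \<bullet> ((L ** A ** transpose L) *v x)"
    by (simp add: matrix_vector_mul_assoc[symmetric] inner_matrix_vector[of _ L] del: transpose_matrix_vector)
qed

lemma pos_form_diag: "pos_form A \<Longrightarrow> 0 < A $ i $ i"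
  unfolding pos_form_def
  by (drule spec[of _ "axis i 1"]) (simp add: inner_axis' matrix_vector_mult_basis column_def axis_eq_0_iff)

text \<open>Gaussian elimination without exchanges: every pivot is positive because a congruence
  preserves \<open>pos_form\<close>. If A is not symmetric, the result is upper triangular rather
  than diagonal, which suffices for \<open>zspace_orthogonal\<close>.\<close>

lemma triangular_reduction:
  fixes A :: "('m::{finite,linorder}, 'm) rmat"
  assumes "pos_form A"
  obtains L where "lower L" "\<And>i. L $ i $ i = 1" "\<And>i j. j < i \<Longrightarrow> (L ** A ** transpose L) $ i $ j = 0"
proof -
  have "\<exists>L. lower L \<and> (\<forall>i. L $ i $ i = 1) \<and> (\<forall>i j. rank_of j < n \<longrightarrow> j < i \<longrightarrow> (L ** A ** transpose L) $ i $ j = 0)"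
    if "n \<le> CARD('m)" for n
    using that
  proof (induction n)
    case 0
    show ?case by (rule exI[of _ "mat 1"]) (auto simp: lower_def mat_def)
  next
    case (Suc n)
    then obtain L where L: "lower L" "\<And>i. L $ i $ i = 1"
      "\<And>i j. rank_of j < n \<Longrightarrow> j < i \<Longrightarrow> (L ** A ** transpose L) $ i $ j = 0" by auto
    define B where "B = L ** A ** transpose L"
    have "invertible L" using L by (intro lower_invertible) auto
    then have "pos_form B" unfolding B_def by (rule pos_form_congruence[OF assms])
    obtain p :: 'm where p: "rank_of p = n" using Suc.prems ex_rank_of[of n] by (metis Suc_le_lessD)
    have Bpp: "0 < B $ p $ p" by (rule pos_form_diag) fact
    \<comment> \<open>K subtracts multiples of row p from later rows, and \<open>transpose K\<close>
      on the right changes later columns only, so columns that are already cleared stay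
      cleared.\<close>
    define c where "c i = (if p < i then B $ i $ p / B $ p $ p else 0)" for i
    define K :: "('m, 'm) rmat" where "K = (\<chi> i j. if i = j then 1 else if j = p then - c i else 0)"
    have K: "lower K" "\<And>i. K $ i $ i = 1" by (auto simp: K_def lower_def c_def)
    have K1: "(K ** C) $ i $ j = C $ i $ j - c i * C $ p $ j" for C :: "('m, 'm) rmat" and i j
    proof -
      have "(K ** C) $ i $ j = (\<Sum>k\<in>UNIV. (if k = i then C $ k $ j else 0) - (if k = p then c i * C $ k $ j else 0))"
        unfolding matrix_matrix_mult_def by (auto simp: K_def c_def intro!: sum.cong)
      then show ?thesis by (simp add: sum_subtractf)
    qed
    have K2: "(C ** transpose K) $ i $ j = C $ i $ j - C $ i $ p * c j" for C :: "('m, 'm) rmat" and i j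
    proof -
      have "(C ** transpose K) $ i $ j = transpose (K ** transpose C) $ i $ j"
        by (simp add: matrix_transpose_mul)
      also have "\<dots> = (K ** transpose C) $ j $ i" by (simp add: transpose_def)
      finally show ?thesis by (simp add: K1 transpose_def)
    qed
    have KL: "(K ** L) ** A ** transpose (K ** L) = K ** B ** transpose K"
      by (simp add: B_def matrix_transpose_mul matrix_mul_assoc)
    have "(K ** B ** transpose K) $ i $ j = 0" if "rank_of j < Suc n" "j < i" for i j
    proof (cases "j = p")
      case True
      then have "c j = 0" "c i = B $ i $ p / B $ p $ p" using that by (auto simp: c_def)
      then show ?thesis using True Bpp by (simp add: K1 K2)
    next
      case False
      then have "rank_of j \<noteq> rank_of p" by (simp add: inj_eq[OF inj_rank_of])
      then have j: "rank_of j < n" using that p by simp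
      then have "j < p" using p rank_of_less_iff by metis
      then have "c j = 0" "B $ p $ j = 0" "B $ i $ j = 0" using L(3)[OF j] that by (auto simp: c_def B_def)
      then show ?thesis by (simp add: K1 K2)
    qed
    then show ?case
      using KL K L by (intro exI[of _ "K ** L"]) (auto simp: lower_mult lower_mult_diag)
  qed
  from this[of "CARD('m)"] show ?thesis using that rank_of_less_card by blast
qed

text \<open>Elimination makes a symmetric matrix diagonal, and inverse square roots of the diagonal
  entries finish. In this form the lemma moves a positive definite matrix to the identity by a lower
  triangular congruence.\<close>

lemma cholesky:
  fixes S :: "('m::{finite,linorder}, 'm) rmat"
  assumes "pos_form S" "transpose S = S"
  obtains L where "lower L" "\<And>i. 0 < L $ i $ i" "invertible L" "L ** S ** transpose L = mat 1"
proof -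
  obtain K where K: "lower K" "\<And>i. K $ i $ i = 1" "\<And>i j. j < i \<Longrightarrow> (K ** S ** transpose K) $ i $ j = 0"
    using triangular_reduction[OF assms(1)] by blast
  define B where "B = K ** S ** transpose K"
  have "invertible K" using K by (intro lower_invertible) auto
  then have "pos_form B" unfolding B_def by (rule pos_form_congruence[OF assms(1)])
  then have d: "0 < B $ i $ i" for i by (rule pos_form_diag)
  have "transpose B = B" using assms(2) by (simp add: B_def matrix_transpose_mul matrix_mul_assoc)
  then have "B $ i $ j = B $ j $ i" for i j by (metis transpose_def vec_lambda_beta)
  then have B0: "B $ i $ j = 0" if "i \<noteq> j" for i j
    using that K(3)[folded B_def] by (metis linorder_neqE)
  define D :: "('m, 'm) rmat" where "D = (\<chi> i j. if i = j then 1 / sqrt (B $ i $ i) else 0)"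
  have D: "lower D" "\<And>i. 0 < D $ i $ i" using d by (auto simp: D_def lower_def)
  have "D ** B ** transpose D = mat 1"
  proof -
    have "(D ** B ** transpose D) $ i $ j = (D $ i $ i * B $ i $ j) * D $ j $ j" for i j
      by (simp add: matrix_matrix_mult_def transpose_def D_def if_distrib if_distribR cong: if_cong)
    moreover have "D $ i $ i * B $ i $ i * D $ i $ i = 1" for i
      using d[of i] by (simp add: D_def real_sqrt_divide[symmetric] field_simps)
    ultimately show ?thesis by (simp add: vec_eq_iff mat_def B0)
  qed
  then have "(D ** K) ** S ** transpose (D ** K) = mat 1"
    by (simp add: B_def matrix_transpose_mul matrix_mul_assoc)
  moreover have DK: "lower (D ** K)" "\<And>i. 0 < (D ** K) $ i $ i"
    using D K by (auto simp: lower_mult lower_mult_diag)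
  moreover have "invertible (D ** K)" using DK by (intro lower_invertible) (auto simp: less_le)
  ultimately show ?thesis using that by blast
qed

lemma pos_form_near_mat_1:
  fixes A :: "('m::finite, 'm) rmat"
  obtains e where "0 < e" "\<And>t. 0 < t \<Longrightarrow> t < e \<Longrightarrow> pos_form (mat 1 + t *\<^sub>R A)"
proof -
  define K where "K = onorm ((*v) A)"
  have bl: "bounded_linear ((*v) A)" by (rule matrix_vector_mul_bounded_linear)
  have K: "0 \<le> K" unfolding K_def by (rule onorm_pos_le[OF bl])
  have "pos_form (mat 1 + t *\<^sub>R A)" if t: "0 < t" "t < 1 / (K + 1)" for t
    unfolding pos_form_def
  proof (intro allI impI)
    fix x :: "real^'m" assume "x \<noteq> 0"
    then have x: "0 < x \<bullet> x" by simp
    have "\<bar>x \<bullet> (A *v x)\<bar> \<le> norm x * norm (A *v x)" by (rule Cauchy_Schwarz_ineq2)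
    also have "\<dots> \<le> norm x * (K * norm x)"
      unfolding K_def by (intro mult_left_mono onorm[OF bl]) auto
    also have "\<dots> = K * (x \<bullet> x)" by (simp add: power2_norm_eq_inner[symmetric] power2_eq_square)
    finally have "\<bar>x \<bullet> (A *v x)\<bar> \<le> K * (x \<bullet> x)" .
    then have "t * \<bar>x \<bullet> (A *v x)\<bar> \<le> (t * K) * (x \<bullet> x)" using t by simp
    moreover have "t * K < 1"
    proof -
      have "t * (K + 1) < 1" using t K by (simp add: field_simps)
      moreover have "t * K \<le> t * (K + 1)" using t by simp
      ultimately show ?thesis by simp
    qed
    then have "(t * K) * (x \<bullet> x) < 1 * (x \<bullet> x)" using x by (rule mult_strict_right_mono)
    ultimately have "t * \<bar>x \<bullet> (A *v x)\<bar> < x \<bullet> x" by simp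
    moreover have "- (t * (x \<bullet> (A *v x))) \<le> t * \<bar>x \<bullet> (A *v x)\<bar>"
      using t by (metis abs_ge_minus_self mult_left_mono mult_minus_right order_less_imp_le)
    ultimately have "0 < x \<bullet> x + t * (x \<bullet> (A *v x))" by simp
    then show "0 < x \<bullet> ((mat 1 + t *\<^sub>R A) *v x)"
      by (simp add: matrix_vector_mult_add_rdistrib inner_add_right scaleR_matrix_vector_assoc[symmetric])
  qed
  then show ?thesis using that[of "1 / (K + 1)"] K by simp
qed

lemma pos_form_invertible: "pos_form A \<Longrightarrow> invertible A"
  unfolding invertible_iff_ker pos_form_def by (metis inner_zero_right order_less_irrefl)

lemma pos_form_mult_transpose:
  fixes A :: "('m::finite, 'm) rmat"
  assumes "invertible A"
  shows "pos_form (A ** transpose A)"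
proof -
  have "pos_form (mat 1 :: ('m, 'm) rmat)" by (simp add: pos_form_def)
  from pos_form_congruence[OF this assms] show ?thesis by simp
qed

section \<open>Leading minors\<close>

lemma permutes_ge_imp_id:
  fixes p :: "'m::{finite,linorder} \<Rightarrow> 'm"
  assumes "p permutes J" "\<And>i. i \<in> J \<Longrightarrow> p i \<le> i"
  shows "p = id"
proof -
  have "p i = i" for i
  proof (induction i rule: measure_induct_rule[of rank_of])
    case (less i)
    show ?case
    proof (cases "i \<in> J")
      case True
      show ?thesis
      proof (rule ccontr)
        assume "p i \<noteq> i"
        then have "p i < i" using assms(2)[OF True] by simp
        then have "p (p i) = p i" using less by (simp add: rank_of_less_iff)
        then show False using \<open>p i \<noteq> i\<close> permutes_inj[OF assms(1)] by (metis injD)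
      qed
    qed (use assms(1) in \<open>auto simp: permutes_def\<close>)
  qed
  then show ?thesis by auto
qed

lemma leading_minor_eq: "leading_minor j S =
   (\<Sum>p | p permutes {i. rank_of i < j}. of_int (sign p) * (\<Prod>i | rank_of i < j. S $ i $ p i))"
  by (simp add: leading_minor_def rank_of_def Let_def)

lemma leading_minor_lower:
  fixes T :: "('m::{finite,linorder}, 'm) rmat"
  assumes "lower T"
  shows "leading_minor j T = (\<Prod>i | rank_of i < j. T $ i $ i)"
proof -
  let ?J = "{i::'m. rank_of i < j}"
  have "leading_minor j T = (\<Sum>p\<in>{id}. of_int (sign p) * (\<Prod>i\<in>?J. T $ i $ p i))"
    unfolding leading_minor_eq
  proof (rule sum.mono_neutral_right)
    show "\<forall>p\<in>{p. p permutes ?J} - {id}. of_int (sign p) * (\<Prod>i\<in>?J. T $ i $ p i) = 0"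
    proof
      fix p assume p: "p \<in> {p. p permutes ?J} - {id}"
      then obtain i where "i \<in> ?J" "i < p i" using permutes_ge_imp_id[of p ?J] by (metis (no_types, lifting) Diff_iff insertCI linorder_not_le mem_Collect_eq)
      then have "T $ i $ p i = 0" using assms by (simp add: lower_def)
      then have "(\<Prod>i\<in>?J. T $ i $ p i) = 0" using \<open>i \<in> ?J\<close> by (intro prod_zero) auto
      then show "of_int (sign p) * (\<Prod>i\<in>?J. T $ i $ p i) = 0" by simp
    qed
  qed (auto simp: permutes_id finite_permutations)
  then show ?thesis by (simp add: sign_id)
qed

text \<open>The principal submatrix on J, filled up with the identity. A minor thus becomes a
  determinant of matrices of the same type, so that multiplicativity of \<open>det\<close>
  applies.\<close>

definition trunc :: "'m set \<Rightarrow> ('m::finite, 'm) rmat \<Rightarrow> ('m, 'm) rmat" where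
  "trunc J A = (\<chi> i j. if i \<in> J \<and> j \<in> J then A $ i $ j else if i = j then 1 else 0)"

lemma det_trunc: "det (trunc J A) = (\<Sum>p | p permutes J. of_int (sign p) * (\<Prod>i\<in>J. A $ i $ p i))"
proof -
  have "det (trunc J A) = (\<Sum>p | p permutes J. of_int (sign p) * (\<Prod>i\<in>UNIV. trunc J A $ i $ p i))"
    unfolding det_def
  proof (rule sum.mono_neutral_right)
    show "\<forall>p\<in>{p. p permutes UNIV} - {p. p permutes J}. of_int (sign p) * (\<Prod>i\<in>UNIV. trunc J A $ i $ p i) = 0"
    proof
      fix p assume p: "p \<in> {p. p permutes UNIV} - {p. p permutes J}"
      then obtain i where i: "i \<notin> J" "p i \<noteq> i"
        by (auto simp: permutes_def)
      then have "trunc J A $ i $ p i = 0" by (auto simp: trunc_def)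
      then have "(\<Prod>i\<in>UNIV. trunc J A $ i $ p i) = 0" by (intro prod_zero) auto
      then show "of_int (sign p) * (\<Prod>i\<in>UNIV. trunc J A $ i $ p i) = 0" by simp
    qed
  qed (auto intro: permutes_subset finite_permutations)
  also have "(\<Prod>i\<in>UNIV. trunc J A $ i $ p i) = (\<Prod>i\<in>J. A $ i $ p i)" if "p permutes J" for p
  proof -
    have "(\<Prod>i\<in>UNIV. trunc J A $ i $ p i) = (\<Prod>i\<in>J. trunc J A $ i $ p i)"
      by (rule prod.mono_neutral_right) (use that in \<open>auto simp: trunc_def permutes_not_in\<close>)
    also have "\<dots> = (\<Prod>i\<in>J. A $ i $ p i)"
      by (rule prod.cong) (use that in \<open>auto simp: trunc_def permutes_in_image\<close>)
    finally show ?thesis .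
  qed
  then have "(\<Sum>p | p permutes J. of_int (sign p) * (\<Prod>i\<in>UNIV. trunc J A $ i $ p i)) = (\<Sum>p | p permutes J. of_int (sign p) * (\<Prod>i\<in>J. A $ i $ p i))"
    by (intro sum.cong) auto
  finally show ?thesis .
qed

text \<open>The terms of the product that pass through the complement of J vanish. The two
  alternatives serve the outer factors of T S T^T: T on the left and its transpose on the
  right.\<close>

lemma trunc_mult:
  assumes "(\<forall>i\<in>J. \<forall>k. k \<notin> J \<longrightarrow> A $ i $ k = 0) \<or> (\<forall>k. k \<notin> J \<longrightarrow> (\<forall>j\<in>J. B $ k $ j = 0))"
  shows "trunc J (A ** B) = trunc J A ** trunc J B"
proof -
  have "(trunc J A ** trunc J B) $ i $ j = trunc J (A ** B) $ i $ j" for i j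
  proof (cases "i \<in> J \<and> j \<in> J")
    case True
    then have "(trunc J A ** trunc J B) $ i $ j = (\<Sum>k\<in>J. A $ i $ k * B $ k $ j)"
      unfolding matrix_matrix_mult_def by (auto simp: trunc_def intro!: sum.mono_neutral_cong_right)
    also have "\<dots> = (\<Sum>k\<in>UNIV. A $ i $ k * B $ k $ j)"
      by (rule sum.mono_neutral_left) (use assms True in auto)
    finally show ?thesis using True by (simp add: trunc_def matrix_matrix_mult_def)
  next
    case False
    show ?thesis
    proof (cases "i \<in> J")
      case True
      then show ?thesis using False
        by (auto simp: matrix_matrix_mult_def trunc_def intro!: sum.neutral)
    next
      case i: False
      then have "(trunc J A ** trunc J B) $ i $ j = (\<Sum>k\<in>{i}. trunc J A $ i $ k * trunc J B $ k $ j)"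
        unfolding matrix_matrix_mult_def vec_lambda_beta
        by (intro sum.mono_neutral_right) (auto simp: trunc_def)
      then show ?thesis using i by (auto simp: trunc_def)
    qed
  qed
  then show ?thesis by (simp add: vec_eq_iff)
qed

lemma leading_minor_congruence:
  fixes T :: "('m::{finite,linorder}, 'm) rmat"
  assumes "lower T"
  shows "leading_minor j (T ** S ** transpose T) = (\<Prod>i | rank_of i < j. (T $ i $ i)\<^sup>2) * leading_minor j S"
proof -
  let ?J = "{i::'m. rank_of i < j}"
  have T0: "T $ i $ k = 0" if "i \<in> ?J" "k \<notin> ?J" for i k
  proof -
    have "rank_of i < rank_of k" using that by simp
    then show ?thesis using assms by (simp add: lower_def rank_of_less_iff)
  qed
  have "trunc ?J (T ** (S ** transpose T)) = trunc ?J T ** (trunc ?J S ** trunc ?J (transpose T))"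
    using T0 by (subst trunc_mult, force, subst trunc_mult) (auto simp: transpose_def)
  moreover have "trunc ?J (transpose T) = transpose (trunc ?J T)"
    by (auto simp: trunc_def transpose_def vec_eq_iff)
  ultimately have "det (trunc ?J (T ** S ** transpose T)) = (det (trunc ?J T))\<^sup>2 * det (trunc ?J S)"
    by (simp add: matrix_mul_assoc det_mul power2_eq_square)
  then show ?thesis
    by (simp add: det_trunc leading_minor_eq[symmetric] leading_minor_lower[OF assms] prod_power_distrib)
qed

section \<open>Polynomials on symmetric matrices\<close>

lemma matrix_inv_invertible:
  assumes "invertible (A :: ('n::finite, 'n) rmat)"
  shows "A ** matrix_inv A = mat 1" "matrix_inv A ** A = mat 1"
  using someI_ex[OF assms[unfolded invertible_def]] by (auto simp: matrix_inv_def)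

lemma invertible_matrix_inv: "invertible A \<Longrightarrow> invertible (matrix_inv A)" for A :: "('n::finite, 'n) rmat"
  using matrix_inv_invertible invertible_def by blast

lemma matrix_inv_inv: "invertible A \<Longrightarrow> matrix_inv (matrix_inv A) = A" for A :: "('n::finite, 'n) rmat"
  by (metis invertible_matrix_inv matrix_inv_invertible matrix_mul_assoc matrix_mul_lid matrix_mul_rid)

definition act :: "('m::finite, 'm) rmat \<Rightarrow> (('m, 'm) rmat \<Rightarrow> real) \<Rightarrow> ('m, 'm) rmat \<Rightarrow> real" where
  "act g P S = P (g ** S ** transpose g)"

lemma act_act: "act g (act h P) = act (h ** g) P"
  by (auto simp: act_def fun_eq_iff matrix_transpose_mul matrix_mul_assoc)

lemma act_mat_1: "act (mat 1) P = P"
  by (auto simp: act_def fun_eq_iff transpose_mat)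

lemma act_add: "act g (\<lambda>S. P S + Q S) = (\<lambda>S. act g P S + act g Q S)"
  and act_scale: "act g (\<lambda>S. c * P S) = (\<lambda>S. c * act g P S)"
  by (auto simp: act_def)

lemma gl_invariant_iff:
  "gl_invariant V \<longleftrightarrow> fun_space.subspace V \<and> (\<forall>g. invertible g \<longrightarrow> (\<forall>P\<in>V. act g P \<in> V))"
proof -
  have "gl_act L P = act (matrix_inv L) P" for L and P :: "('a, 'a) rmat \<Rightarrow> real"
    by (auto simp: gl_act_def act_def)
  then show ?thesis
    unfolding gl_invariant_def using invertible_matrix_inv matrix_inv_inv by metis
qed

lemma hom_polys_entry_mult:
  fixes P :: "('m::finite, 'm) rmat \<Rightarrow> real"
  assumes "P \<in> hom_polys k"
  shows "(\<lambda>S. S $ i $ j * P S) \<in> hom_polys (Suc k)"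
  using assms unfolding hom_polys_def
proof (induction rule: span_fun_induct)
  case (base f)
  then obtain e where f: "f = on_sym (\<lambda>S. \<Prod>a\<in>UNIV. \<Prod>b\<in>UNIV. S $ a $ b ^ e a b)"
    and e: "(\<Sum>a\<in>UNIV. \<Sum>b\<in>UNIV. e a b) = k" by auto
  define d where "d a b = (if a = i then if b = j then Suc 0 else 0 else 0)" for a b :: 'm
  have "(\<Prod>a\<in>UNIV. \<Prod>b\<in>UNIV. S $ a $ b ^ d a b) = S $ i $ j" for S :: "('m, 'm) rmat"
  proof -
    have "(\<Prod>b\<in>UNIV. S $ a $ b ^ d a b) = (if a = i then S $ i $ j else 1)" for a
      by (cases "a = i") (auto simp: d_def if_distrib[of "\<lambda>x. _ ^ x"] cong: if_cong)
    then show ?thesis by simp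
  qed
  then have "(\<lambda>S. S $ i $ j * f S) = on_sym (\<lambda>S. \<Prod>a\<in>UNIV. \<Prod>b\<in>UNIV. S $ a $ b ^ (d a b + e a b))"
    by (auto simp: f on_sym_def fun_eq_iff power_add prod.distrib)
  moreover have "(\<Sum>a\<in>UNIV. \<Sum>b\<in>UNIV. d a b + e a b) = Suc k"
  proof -
    have "(\<Sum>b\<in>UNIV. d a b) = (if a = i then 1 else 0)" for a by (auto simp: d_def)
    then show ?thesis by (simp add: sum.distrib e)
  qed
  ultimately show ?case by (intro fun_space.span_base) (auto intro!: exI[of _ "\<lambda>a b. d a b + e a b"])
qed (auto simp: subspace_fun_zero distrib_left mult.left_commute intro: subspace_fun_add subspace_fun_scale)

text \<open>Entries are linear forms, so monomials are products of elements of
  \<open>homs 1\<close>; conversely a power of A . S expands into monomials by multiplying with A .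
  S repeatedly. This makes induction over powers of linear forms available for
  \<open>hom_polys\<close>.\<close>

lemma hom_polys_eq: "(hom_polys k :: (('m::finite, 'm) rmat \<Rightarrow> real) set) = on_sym ` homs k"
proof
  have "fun_space.subspace (on_sym ` homs k :: (('m, 'm) rmat \<Rightarrow> real) set)"
  proof (rule subspaceI_fun)
    show "(\<lambda>x. 0) \<in> on_sym ` homs k"
      by (rule image_eqI[of _ _ "\<lambda>x. 0"]) (auto simp: on_sym_def homs_zero)
    fix f g :: "('m, 'm) rmat \<Rightarrow> real" and c assume "f \<in> on_sym ` homs k" "g \<in> on_sym ` homs k"
    then obtain f' g' where *: "f = on_sym f'" "g = on_sym g'" "f' \<in> homs k" "g' \<in> homs k" by auto
    show "(\<lambda>x. f x + g x) \<in> on_sym ` homs k"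
      by (rule image_eqI[of _ _ "\<lambda>x. f' x + g' x"]) (auto simp: * on_sym_def homs_add)
    show "(\<lambda>x. c * f x) \<in> on_sym ` homs k"
      by (rule image_eqI[of _ _ "\<lambda>x. c * f' x"]) (auto simp: * on_sym_def homs_scale)
  qed
  moreover have "(\<lambda>S. \<Prod>i\<in>UNIV. \<Prod>j\<in>UNIV. S $ i $ j ^ e i j) \<in> homs k"
    if "(\<Sum>i\<in>UNIV. \<Sum>j\<in>UNIV. e i j) = k" for e :: "'m \<Rightarrow> 'm \<Rightarrow> nat"
  proof -
    have "(\<lambda>S. \<Prod>i\<in>UNIV. \<Prod>j\<in>UNIV. S $ i $ j ^ e i j) \<in> homs (\<Sum>i\<in>UNIV. \<Sum>j\<in>UNIV. e i j * 1)"
      by (intro homs_prod homs_pow entry_homs) auto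
    then show ?thesis using that by simp
  qed
  ultimately show "(hom_polys k :: (('m, 'm) rmat \<Rightarrow> real) set) \<subseteq> on_sym ` homs k"
    unfolding hom_polys_def by (intro fun_space.span_minimal) auto
next
  have pow: "on_sym (\<lambda>S. (A \<bullet> S) ^ k) \<in> hom_polys k" for A :: "('m, 'm) rmat" and k
  proof (induction k)
    case 0
    show ?case unfolding hom_polys_def
      by (rule fun_space.span_base) (auto intro!: exI[of _ "\<lambda>_ _. 0"])
  next
    case (Suc k)
    have "(\<lambda>S. \<Sum>i\<in>UNIV. \<Sum>j\<in>UNIV. A $ i $ j * (S $ i $ j * on_sym (\<lambda>S. (A \<bullet> S) ^ k) S)) \<in> hom_polys (Suc k)"
      unfolding hom_polys_def
      by (intro subspace_fun_sum subspace_fun_scale fun_space.subspace_span)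
         (use hom_polys_entry_mult[OF Suc] in \<open>simp add: hom_polys_def\<close>)
    moreover have "on_sym (\<lambda>S. (A \<bullet> S) ^ Suc k) = (\<lambda>S. \<Sum>i\<in>UNIV. \<Sum>j\<in>UNIV. A $ i $ j * (S $ i $ j * on_sym (\<lambda>S. (A \<bullet> S) ^ k) S))"
      by (auto simp: on_sym_def fun_eq_iff inner_rmat[of A] sum_distrib_right mult_ac)
    ultimately show ?case by simp
  qed
  have "on_sym f \<in> hom_polys k" if "f \<in> homs k" for f :: "('m, 'm) rmat \<Rightarrow> real"
    using that
  proof (induction rule: homs_induct)
    case zero
    show ?case using subspace_fun_zero[OF fun_space.subspace_span] by (simp add: hom_polys_def on_sym_def cong: if_cong)
  next
    case (add f g)
    then have "(\<lambda>S. on_sym f S + on_sym g S) \<in> hom_polys k"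
      unfolding hom_polys_def by (intro subspace_fun_add) auto
    also have "(\<lambda>S. on_sym f S + on_sym g S) = on_sym (\<lambda>x. f x + g x)" by (auto simp: on_sym_def)
    finally show ?case .
  next
    case (scale c f)
    then have "(\<lambda>S. c * on_sym f S) \<in> hom_polys k"
      unfolding hom_polys_def by (intro subspace_fun_scale) auto
    also have "(\<lambda>S. c * on_sym f S) = on_sym (\<lambda>x. c * f x)" by (auto simp: on_sym_def)
    finally show ?case .
  qed (rule pow)
  then show "on_sym ` homs k \<subseteq> (hom_polys k :: (('m, 'm) rmat \<Rightarrow> real) set)" by auto
qed

lemma on_sym_hom_polys: "f \<in> homs k \<Longrightarrow> on_sym f \<in> hom_polys k"
  by (simp add: hom_polys_eq)

lemma subspace_hom_polys: "fun_space.subspace (hom_polys k)"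
  by (simp add: hom_polys_def)

lemma hom_polys_not_sym: "P \<in> hom_polys k \<Longrightarrow> transpose S \<noteq> S \<Longrightarrow> P S = 0"
  by (auto simp: hom_polys_eq on_sym_def)

lemma transpose_congruence_iff:
  fixes S g :: "('m::finite, 'm) rmat"
  assumes "invertible g"
  shows "transpose (g ** S ** transpose g) = g ** S ** transpose g \<longleftrightarrow> transpose S = S"
proof
  assume *: "transpose (g ** S ** transpose g) = g ** S ** transpose g"
  let ?h = "matrix_inv g"
  have h: "?h ** g = mat 1" using matrix_inv_invertible[OF assms] by simp
  have inv: "?h ** (g ** A ** transpose g) ** transpose ?h = A" for A
  proof -
    have "?h ** (g ** A ** transpose g) ** transpose ?h = (?h ** g) ** A ** transpose (?h ** g)"
      by (simp add: matrix_transpose_mul matrix_mul_assoc)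
    then show ?thesis by (simp add: h transpose_mat)
  qed
  have "g ** transpose S ** transpose g = g ** S ** transpose g"
    using * by (simp add: matrix_transpose_mul matrix_mul_assoc)
  then show "transpose S = S" using inv[of S] inv[of "transpose S"] by simp
qed (simp add: matrix_transpose_mul matrix_mul_assoc)

lemma transpose_congruence: "transpose S = S \<Longrightarrow> transpose (g ** S ** transpose g) = g ** S ** transpose g"
  for S :: "('m::finite, 'm) rmat" and g :: "('k::finite, 'm) rmat"
  by (simp add: matrix_transpose_mul matrix_mul_assoc)

lemma linear_congruence: "linear (\<lambda>S :: ('m, 'm) rmat. g ** S ** transpose g)" for g :: "('k::finite, 'm::finite) rmat"
  using linear_compose[OF linear_matrix_mult_left[of g] linear_matrix_mult_right[of "transpose g"]] by (simp add: o_def)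

lemma act_hom_polys:
  assumes "P \<in> hom_polys k" "invertible g"
  shows "act g P \<in> hom_polys k"
proof -
  obtain f where f: "f \<in> homs k" "P = on_sym f" using assms by (auto simp: hom_polys_eq)
  have "act g P = on_sym (\<lambda>S. f (g ** S ** transpose g))"
    using assms(2) by (auto simp: f act_def on_sym_def fun_eq_iff transpose_congruence_iff)
  then show ?thesis
    using homs_compose[OF f(1) linear_congruence[of g]] by (simp add: on_sym_hom_polys)
qed

text \<open>Composition with the Gram map. Congruence by g becomes left multiplication by g, right
  multiplication by an orthogonal matrix has no effect, and the number of columns can be
  chosen.\<close>

definition pull :: "(('m::finite, 'm) rmat \<Rightarrow> real) \<Rightarrow> ('m, 'n::finite) rmat \<Rightarrow> real" where
  "pull P x = P (x ** transpose x)"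

lemma gram_symmetric: "transpose (x ** transpose x) = x ** transpose x" for x :: "('m::finite, 'n::finite) rmat"
  by (simp add: matrix_transpose_mul)

lemma gram_entry: "(x ** transpose x) $ i $ j = x $ i \<bullet> x $ j" for x :: "('m::finite, 'n::finite) rmat"
  by (simp add: matrix_matrix_mult_def transpose_def inner_vec_def)

lemma gram_entry_homs: "(\<lambda>x :: ('m::finite, 'n::finite) rmat. (x ** transpose x) $ i $ j) \<in> homs 2"
proof -
  have "(\<lambda>x :: ('m, 'n) rmat. \<Sum>c\<in>UNIV. x $ i $ c * x $ j $ c) \<in> homs (1 + 1)"
    by (intro homs_sum homs_mult entry_homs)
  then show ?thesis by (simp add: matrix_matrix_mult_def transpose_def numeral_2_eq_2)
qed

lemma homs_gram:
  assumes "f \<in> homs k"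
  shows "(\<lambda>x :: ('m::finite, 'n::finite) rmat. f (x ** transpose x)) \<in> homs (2 * k)"
  using assms
proof (induction rule: homs_induct)
  case (power A)
  have "(\<lambda>x :: ('m, 'n) rmat. A \<bullet> (x ** transpose x)) \<in> homs 2"
    unfolding inner_rmat by (intro homs_sum homs_scale gram_entry_homs)
  from homs_pow[OF this, of k] show ?case by (simp add: mult.commute)
qed (auto intro: homs_zero homs_add homs_scale)

lemma pull_homs: "P \<in> hom_polys k \<Longrightarrow> (pull P :: ('m, 'n::finite) rmat \<Rightarrow> real) \<in> homs (2 * k)"
  for P :: "('m::finite, 'm) rmat \<Rightarrow> real"
  using homs_gram by (auto simp: hom_polys_eq pull_def[abs_def] on_sym_def gram_symmetric)

lemma pull_act: "pull (act g P) x = pull P (g ** x)"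
  by (simp add: pull_def act_def matrix_transpose_mul matrix_mul_assoc)

lemma pull_add: "pull (\<lambda>S. P S + Q S) = (\<lambda>x. pull P x + pull Q x)"
  and pull_scale: "pull (\<lambda>S. c * P S) = (\<lambda>x. c * pull P x)"
  and pull_sum: "pull (\<lambda>S. \<Sum>i\<in>I. R i S) = (\<lambda>x. \<Sum>i\<in>I. pull (R i) x)"
  by (auto simp: pull_def)

text \<open>The segment from the identity to a symmetric S starts inside the positive definite cone,
  and a polynomial that vanishes on an initial piece vanishes on the whole segment.\<close>

lemma hom_polys_eq_0I:
  fixes P :: "('m::finite, 'm) rmat \<Rightarrow> real"
  assumes P: "P \<in> hom_polys k" and 0: "\<And>S. transpose S = S \<Longrightarrow> pos_form S \<Longrightarrow> P S = 0"
  shows "P S = 0"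
proof (cases "transpose S = S")
  case True
  obtain f where f: "f \<in> homs k" "P = on_sym f" using P by (auto simp: hom_polys_eq)
  obtain e where e: "0 < e" "\<And>t. 0 < t \<Longrightarrow> t < e \<Longrightarrow> pos_form (mat 1 + t *\<^sub>R (S - mat 1))"
    using pos_form_near_mat_1 by blast
  have sym: "transpose (mat 1 + t *\<^sub>R (S - mat 1)) = mat 1 + t *\<^sub>R (S - mat 1)" for t
    using True by (auto simp: transpose_def vec_eq_iff mat_def)
  have "f (mat 1 + 1 *\<^sub>R (S - mat 1)) = 0"
    by (rule homs_zero_of_line[OF f(1) e(1)]) (use 0[OF sym] e sym f in \<open>auto simp: on_sym_def\<close>)
  then show ?thesis by (simp add: f on_sym_def)
qed (use hom_polys_not_sym[OF P] in auto)

lemma pos_form_gram: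
  fixes S :: "('m::{finite,linorder}, 'm) rmat"
  assumes "transpose S = S" "pos_form S"
  obtains x :: "('m, 'm) rmat" where "invertible x" "S = x ** transpose x"
proof -
  obtain L :: "('m, 'm) rmat" where L: "invertible L" "L ** S ** transpose L = mat 1" by (rule cholesky[OF assms(2,1)]) blast
  let ?h = "matrix_inv L"
  have "S = (?h ** L) ** S ** transpose (?h ** L)"
    by (simp add: matrix_inv_invertible[OF L(1)] transpose_mat)
  also have "\<dots> = ?h ** (L ** S ** transpose L) ** transpose ?h"
    by (simp add: matrix_transpose_mul matrix_mul_assoc)
  finally show ?thesis using that[of ?h] invertible_matrix_inv[OF L(1)] by (simp add: L)
qed

lemma pull_inject:
  fixes P :: "('m::{finite,linorder}, 'm) rmat \<Rightarrow> real"
  assumes "P \<in> hom_polys k" "\<And>x :: ('m, 'm) rmat. invertible x \<Longrightarrow> pull P x = 0"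
  shows "P = (\<lambda>S. 0)"
proof
  fix S
  show "P S = 0"
    by (rule hom_polys_eq_0I[OF assms(1)]) (metis assms(2) pos_form_gram pull_def)
qed

section \<open>The form on symmetric polynomials\<close>

text \<open>The form depends on the number of columns, which the type argument carries. Square
  matrices are used to decompose spaces of polynomials, matrices with \<open>'n\<close> columns to
  compute covariances.\<close>

definition gram_form ::
  "'n::finite itself \<Rightarrow> nat \<Rightarrow> (('m::finite, 'm) rmat \<Rightarrow> real) \<Rightarrow> (('m, 'm) rmat \<Rightarrow> real) \<Rightarrow> real" where
  "gram_form ty k P Q = fischer (2 * k) (pull P :: ('m, 'n) rmat \<Rightarrow> real) (pull Q)"

lemma gram_form_sym: "P \<in> hom_polys k \<Longrightarrow> Q \<in> hom_polys k \<Longrightarrow> gram_form ty k P Q = gram_form ty k Q P"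
  by (simp add: gram_form_def fischer_sym pull_homs)

lemma gram_form_add:
  "P \<in> hom_polys k \<Longrightarrow> Q \<in> hom_polys k \<Longrightarrow> R \<in> hom_polys k \<Longrightarrow>
   gram_form ty k P (\<lambda>S. Q S + R S) = gram_form ty k P Q + gram_form ty k P R"
  by (simp add: gram_form_def fischer_add_right pull_homs pull_add)

lemma gram_form_scale:
  "P \<in> hom_polys k \<Longrightarrow> Q \<in> hom_polys k \<Longrightarrow> gram_form ty k P (\<lambda>S. c * Q S) = c * gram_form ty k P Q"
  by (simp add: gram_form_def fischer_scale_right pull_homs pull_scale)

lemma gram_form_adjoint:
  fixes P Q :: "('m::finite, 'm) rmat \<Rightarrow> real"
  assumes "P \<in> hom_polys k" "Q \<in> hom_polys k"
  shows "gram_form TYPE('n::finite) k (act g P) Q = gram_form TYPE('n) k P (act (transpose g) Q)"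
  using fischer_adjoint[OF pull_homs[OF assms(1)] pull_homs[OF assms(2)] linear_matrix_mult_left[of g] linear_matrix_mult_left[of "transpose g"] inner_matrix_mult_left]
  by (simp add: gram_form_def pull_act[abs_def])

lemma gram_form_definite:
  fixes P :: "('m::{finite,linorder}, 'm) rmat \<Rightarrow> real"
  assumes "P \<in> hom_polys k" "gram_form TYPE('m) k P P = 0"
  shows "P = (\<lambda>S. 0)"
  using pull_inject[OF assms(1)] fischer_eq_0_imp[OF pull_homs[OF assms(1)] assms(2)[unfolded gram_form_def]] by auto

text \<open>Induction on the spanning set. The element z found for the smaller span is corrected by
  a multiple of d, the part of s orthogonal to that span; the projection w of s comes from the
  induction hypothesis for the functional \<open>b s\<close>, which is why \<phi> is arbitrary in
  the induction.\<close>

lemma riesz_finite: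
  fixes b :: "('a \<Rightarrow> real) \<Rightarrow> ('a \<Rightarrow> real) \<Rightarrow> real"
  assumes U: "fun_space.subspace U" and "finite F" "F \<subseteq> U"
    and sym: "\<And>p q. p \<in> U \<Longrightarrow> q \<in> U \<Longrightarrow> b p q = b q p"
    and add: "\<And>p q r. p \<in> U \<Longrightarrow> q \<in> U \<Longrightarrow> r \<in> U \<Longrightarrow> b p (\<lambda>x. q x + r x) = b p q + b p r"
    and scale: "\<And>p q c. p \<in> U \<Longrightarrow> q \<in> U \<Longrightarrow> b p (\<lambda>x. c * q x) = c * b p q"
    and definite: "\<And>p. p \<in> U \<Longrightarrow> b p p = 0 \<Longrightarrow> p = (\<lambda>x. 0)"
    and \<phi>: "\<And>p q. p \<in> U \<Longrightarrow> q \<in> U \<Longrightarrow> \<phi> (\<lambda>x. p x + q x) = \<phi> p + \<phi> q"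
      "\<And>p c. p \<in> U \<Longrightarrow> \<phi> (\<lambda>x. c * p x) = c * \<phi> p"
  shows "\<exists>z\<in>fun_space.span F. \<forall>v\<in>fun_space.span F. b z v = \<phi> v"
  using assms(2,3) \<phi>
proof (induction F arbitrary: \<phi> rule: finite_induct)
  case empty
  have "\<phi> (\<lambda>x. 0) = 0" using empty(3)[OF subspace_fun_zero[OF U], of 0] by simp
  moreover have "b (\<lambda>x. 0) (\<lambda>x. 0) = 0"
    using scale[OF subspace_fun_zero[OF U] subspace_fun_zero[OF U], of 0] by simp
  ultimately show ?case by (simp add: zero_fun_def)
next
  case (insert s F)
  let ?S = "fun_space.span F"
  have sub: "?S \<subseteq> U" "s \<in> U" using insert.prems(1) U by (auto intro: fun_space.span_minimal[THEN subsetD])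
  obtain w where w: "w \<in> ?S" "\<And>v. v \<in> ?S \<Longrightarrow> b w v = b s v"
    using insert.IH[of "b s"] insert.prems(1) add[OF sub(2)] scale[OF sub(2)] by auto
  obtain z where z: "z \<in> ?S" "\<And>v. v \<in> ?S \<Longrightarrow> b z v = \<phi> v"
    using insert.IH[of \<phi>] insert.prems by auto
  define d where "d = (\<lambda>x. s x - w x)"
  have wU: "w \<in> U" "z \<in> U" using w z sub by auto
  have dU: "d \<in> U" unfolding d_def by (rule subspace_fun_diff[OF U sub(2) wU(1)])
  have add': "b (\<lambda>x. q x + r x) p = b q p + b r p" if "p \<in> U" "q \<in> U" "r \<in> U" for p q r
    using that add sym subspace_fun_add[OF U] by metis
  have scale': "b (\<lambda>x. c * q x) p = c * b q p" if "p \<in> U" "q \<in> U" for c p q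
    using that scale sym subspace_fun_scale[OF U] by metis
  have s: "s = (\<lambda>x. w x + d x)" by (auto simp: d_def)
  have bd: "b d v = 0" if "v \<in> ?S" for v
  proof -
    have "v \<in> U" using that sub by auto
    then have "b s v = b w v + b d v" using add'[OF _ wU(1) dU] s by simp
    then show ?thesis using w(2)[OF that] by simp
  qed
  \<comment> \<open>This multiple of d gives the right value at d and leaves the values on the
    smaller span alone, since d is orthogonal to it. If d is 0, then s lies in that span
    already.\<close>
  define c where "c = (\<phi> d - b z d) / b d d"
  define z' where "z' = (if d = (\<lambda>x. 0) then z else (\<lambda>x. z x + c * d x))"
  have span: "?S \<subseteq> fun_space.span (insert s F)" by (rule fun_space.span_mono) auto
  have "d \<in> fun_space.span (insert s F)"
    unfolding d_def using w(1) span by (intro subspace_fun_diff) (auto intro: fun_space.span_base)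
  then have 1: "z' \<in> fun_space.span (insert s F)"
    using z(1) span unfolding z'_def by (auto intro!: subspace_fun_add subspace_fun_scale)
  have z'U: "z' \<in> U" using wU dU U by (auto simp: z'_def intro!: subspace_fun_add subspace_fun_scale)
  have 2: "b z' v = \<phi> v" if "v \<in> ?S" for v
  proof (cases "d = (\<lambda>x. 0)")
    case False
    have "v \<in> U" using that sub by auto
    then have "b z' v = b z v + c * b d v"
      using False by (simp add: z'_def add' scale' wU dU subspace_fun_scale[OF U])
    then show ?thesis using bd z that by simp
  qed (use z that in \<open>auto simp: z'_def\<close>)
  have 3: "b z' d = \<phi> d"
  proof (cases "d = (\<lambda>x. 0)")
    case False
    then have "b d d \<noteq> 0" using definite dU by blast
    moreover have "b z' d = b z d + c * b d d"
      using False by (simp add: z'_def add' scale' wU dU subspace_fun_scale[OF U])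
    ultimately show ?thesis by (simp add: c_def)
  next
    case True
    have "b z' (\<lambda>x. 0) = 0" using scale[OF z'U z'U, of 0] by simp
    moreover have "\<phi> (\<lambda>x. 0) = 0" using insert.prems(3)[OF dU, of 0] by simp
    ultimately show ?thesis using True by simp
  qed
  have "b z' v = \<phi> v" if v: "v \<in> fun_space.span (insert s F)" for v
  proof -
    obtain c where c: "v - (\<lambda>x. c * s x) \<in> ?S" using v unfolding fun_space.span_breakdown_eq by auto
    define u where "u = (\<lambda>x. (v x - c * s x) + c * w x)"
    have u: "u \<in> ?S" unfolding u_def
      using c w(1) by (intro subspace_fun_add subspace_fun_scale) (auto simp: fun_diff_def)
    then have uU: "u \<in> U" using sub by auto
    have "v = (\<lambda>x. u x + c * d x)" by (auto simp: u_def d_def algebra_simps)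
    then show ?thesis
      using 2[OF u] 3 uU dU by (simp add: add scale insert.prems z'U subspace_fun_scale[OF U])
  qed
  then show ?case using 1 by blast
qed

lemma hom_polys_finite_basis:
  assumes "fun_space.subspace V" "V \<subseteq> (hom_polys k :: (('m::finite, 'm) rmat \<Rightarrow> real) set)"
  obtains B where "finite B" "B \<subseteq> V" "V = fun_space.span B"
proof -
  obtain F :: "(('m, 'm) rmat \<Rightarrow> real) set" where F: "finite F" "homs k \<subseteq> fun_space.span F"
    using homs_finite_span by blast
  have "on_sym f \<in> fun_space.span (on_sym ` F)" if "f \<in> fun_space.span F" for f
    using that
  proof (induction rule: span_fun_induct)
    case zero
    show ?case using subspace_fun_zero[OF fun_space.subspace_span] by (simp add: on_sym_def cong: if_cong)
  next
    case (base f)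
    then show ?case by (auto intro: fun_space.span_base)
  next
    case (add f g)
    moreover have "on_sym (\<lambda>x. f x + g x) = (\<lambda>S. on_sym f S + on_sym g S)" by (auto simp: on_sym_def)
    ultimately show ?case by (simp add: subspace_fun_add)
  next
    case (scale c f)
    moreover have "on_sym (\<lambda>x. c * f x) = (\<lambda>S. c * on_sym f S)" by (auto simp: on_sym_def)
    ultimately show ?case by (simp add: subspace_fun_scale)
  qed
  then have V: "V \<subseteq> fun_space.span (on_sym ` F)" using assms(2) F(2) by (auto simp: hom_polys_eq)
  obtain B where B: "B \<subseteq> V" "fun_space.independent B" "V \<subseteq> fun_space.span B"
    using fun_space.maximal_independent_subset by blast
  have "finite B"
    using fun_space.independent_span_bound[OF _ B(2), of "on_sym ` F"] B(1) V F(1) by blast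
  then show ?thesis using that B fun_space.span_subspace[OF B(1,3) assms(1)] by blast
qed

lemma gram_form_riesz:
  fixes V :: "(('m::{finite,linorder}, 'm) rmat \<Rightarrow> real) set"
  assumes "fun_space.subspace V" "V \<subseteq> hom_polys k"
    and "\<And>p q. p \<in> hom_polys k \<Longrightarrow> q \<in> hom_polys k \<Longrightarrow> \<phi> (\<lambda>x. p x + q x) = \<phi> p + \<phi> q"
      "\<And>p c. p \<in> hom_polys k \<Longrightarrow> \<phi> (\<lambda>x. c * p x) = c * \<phi> p"
  obtains z where "z \<in> V" "\<And>v. v \<in> V \<Longrightarrow> gram_form TYPE('m) k z v = \<phi> v"
proof -
  obtain B where B: "finite B" "B \<subseteq> V" "V = fun_space.span B"
    using hom_polys_finite_basis[OF assms(1,2)] by blast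
  have "\<exists>z\<in>fun_space.span B. \<forall>v\<in>fun_space.span B. gram_form TYPE('m) k z v = \<phi> v"
    by (rule riesz_finite[OF subspace_hom_polys B(1), where b = "gram_form TYPE('m) k"])
       (use B assms in \<open>auto simp: gram_form_add gram_form_scale intro: gram_form_sym gram_form_definite\<close>)
  then show ?thesis using that B(3) by blast
qed

section \<open>The irreducible spaces\<close>

lemma gram_form_add_left:
  "P \<in> hom_polys k \<Longrightarrow> Q \<in> hom_polys k \<Longrightarrow> R \<in> hom_polys k \<Longrightarrow>
   gram_form ty k (\<lambda>S. Q S + R S) P = gram_form ty k Q P + gram_form ty k R P"
  by (simp add: gram_form_def fischer_add_left pull_homs pull_add)

lemma gram_form_scale_left:
  "P \<in> hom_polys k \<Longrightarrow> Q \<in> hom_polys k \<Longrightarrow> gram_form ty k (\<lambda>S. c * Q S) P = c * gram_form ty k Q P"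
  by (simp add: gram_form_def fischer_scale_left pull_homs pull_scale)

section \<open>Partitions and the semi-invariant power polynomials\<close>

lemma partitionsD:
  assumes "\<kappa> \<in> partitions m k"
  shows "i \<le> j \<Longrightarrow> \<kappa> j \<le> \<kappa> i" "m \<le> i \<Longrightarrow> \<kappa> i = 0" "psize \<kappa> = k" "(\<Sum>i<m. \<kappa> i) = k"
proof -
  have 0: "m \<le> i \<Longrightarrow> \<kappa> i = 0" for i
    using assms by (auto simp: partitions_def)
  then show "m \<le> i \<Longrightarrow> \<kappa> i = 0" .
  show "psize \<kappa> = k" "i \<le> j \<Longrightarrow> \<kappa> j \<le> \<kappa> i"
    using assms by (auto simp: partitions_def antimono_def)
  have "{i. \<kappa> i \<noteq> 0} \<subseteq> {..<m}" using 0 by (metis (mono_tags) lessThan_iff mem_Collect_eq not_less subsetI)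
  then have "(\<Sum>i<m. \<kappa> i) = psize \<kappa>"
    unfolding psize_def by (intro sum.mono_neutral_right) auto
  then show "(\<Sum>i<m. \<kappa> i) = k" using \<open>psize \<kappa> = k\<close> by simp
qed

lemma partitions_mono: "l \<le> n \<Longrightarrow> \<kappa> \<in> partitions l k \<Longrightarrow> \<kappa> \<in> partitions n k"
  by (auto simp: partitions_def)

lemma partitions_finite: "finite (partitions m k)"
proof -
  have "partitions m k \<subseteq> (\<lambda>f i. if i < m then f i else 0) ` PiE {..<m} (\<lambda>_. {..k})"
  proof
    fix \<kappa> assume \<kappa>: "\<kappa> \<in> partitions m k"
    have "\<kappa> i \<le> k" if "i < m" for i
      using member_le_sum[of i "{..<m}" \<kappa>] partitionsD(4)[OF \<kappa>] that by simp
    then show "\<kappa> \<in> (\<lambda>f i. if i < m then f i else 0) ` PiE {..<m} (\<lambda>_. {..k})"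
      using partitionsD(2)[OF \<kappa>]
      by (intro image_eqI[of _ _ "restrict \<kappa> {..<m}"]) (auto simp: fun_eq_iff)
  qed
  moreover have "finite (PiE {..<m} (\<lambda>_. {..k}))" by (rule finite_PiE) auto
  ultimately show ?thesis by (meson finite_imageI finite_subset)
qed

lemma telescope_nat:
  fixes \<kappa> :: "nat \<Rightarrow> nat"
  assumes "\<And>i. \<kappa> (Suc i) \<le> \<kappa> i" "r \<le> n"
  shows "(\<Sum>j\<in>{r<..n}. \<kappa> (j - 1) - \<kappa> j) = \<kappa> r - \<kappa> n \<and> \<kappa> n \<le> \<kappa> r"
  using assms(2)
proof (induction n rule: dec_induct)
  case (step n)
  have "{r<..Suc n} = insert (Suc n) {r<..n}" using step by auto
  then show ?case using step assms(1)[of n] by simp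
qed simp

text \<open>Summation by parts; with \<open>\<kappa> n = 0\<close> it computes the degree of
  \<open>power_poly \<kappa>\<close>.\<close>

lemma abel_nat:
  fixes \<kappa> :: "nat \<Rightarrow> nat"
  assumes "\<And>i. \<kappa> (Suc i) \<le> \<kappa> i"
  shows "(\<Sum>j=1..n. (\<kappa> (j - 1) - \<kappa> j) * j) + n * \<kappa> n = (\<Sum>i<n. \<kappa> i)"
proof (induction n)
  case (Suc n)
  have "(\<Sum>j=1..Suc n. (\<kappa> (j - 1) - \<kappa> j) * j) = (\<Sum>j=1..n. (\<kappa> (j - 1) - \<kappa> j) * j) + (\<kappa> n - \<kappa> (Suc n)) * Suc n"
    by simp
  moreover have "(\<kappa> n - \<kappa> (Suc n)) * Suc n + Suc n * \<kappa> (Suc n) = Suc n * \<kappa> n"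
    using assms[of n] by (metis add_mult_distrib le_add_diff_inverse2 mult.commute)
  ultimately show ?case using Suc by simp
qed simp

lemma leading_minor_homs:
  assumes "j \<le> CARD('m)"
  shows "(leading_minor j :: ('m::{finite,linorder}, 'm) rmat \<Rightarrow> real) \<in> homs j"
proof -
  have "(\<lambda>S :: ('m, 'm) rmat. \<Prod>i | rank_of i < j. S $ i $ p i) \<in> homs (\<Sum>i\<in>{i::'m. rank_of i < j}. 1)" for p
    by (rule homs_prod) (auto intro: entry_homs[unfolded One_nat_def])
  then have "(\<lambda>S :: ('m, 'm) rmat. \<Prod>i | rank_of i < j. S $ i $ p i) \<in> homs j" for p
    using card_rank_of_less[OF assms] by simp
  then have "(\<lambda>S :: ('m, 'm) rmat. \<Sum>p | p permutes {i. rank_of i < j}. of_int (sign p) * (\<Prod>i | rank_of i < j. S $ i $ p i)) \<in> homs j"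
    by (intro homs_sum homs_scale)
  then show ?thesis by (simp add: leading_minor_eq[abs_def])
qed

text \<open>The character through which lower triangular matrices act on
  \<open>power_poly \<kappa>\<close>; the factor 2 appears because each diagonal entry of T enters T
  S T^T from both sides.\<close>

definition chi :: "(nat \<Rightarrow> nat) \<Rightarrow> ('m::{finite,linorder}, 'm) rmat \<Rightarrow> real" where
  "chi \<kappa> T = (\<Prod>i\<in>UNIV. (T $ i $ i) ^ (2 * \<kappa> (rank_of i)))"

context
  fixes \<kappa> :: "nat \<Rightarrow> nat" and k :: nat
  assumes \<kappa>: "\<kappa> \<in> partitions CARD('m::{finite,linorder}) k"
begin

lemma power_poly_hom: "(power_poly \<kappa> :: ('m, 'm) rmat \<Rightarrow> real) \<in> hom_polys k"
proof -
  have "(\<lambda>S :: ('m, 'm) rmat. \<Prod>j = 1..CARD('m). leading_minor j S ^ (\<kappa> (j - 1) - \<kappa> j)) \<in>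
    homs (\<Sum>j = 1..CARD('m). (\<kappa> (j - 1) - \<kappa> j) * j)"
    by (intro homs_prod homs_pow leading_minor_homs) auto
  also have "(\<Sum>j = 1..CARD('m). (\<kappa> (j - 1) - \<kappa> j) * j) = k"
    using abel_nat[of \<kappa> "CARD('m)"] partitionsD[OF \<kappa>] by simp
  finally show ?thesis by (simp add: power_poly_def on_sym_hom_polys)
qed

text \<open>The factor \<open>t i\<close> occurs in the products with j > \<open>rank_of i\<close>,
  and the exponents of these telescope to \<open>\<kappa> (rank_of i)\<close>.\<close>

lemma prod_rank_telescope:
  fixes t :: "'m \<Rightarrow> real"
  shows "(\<Prod>j = 1..CARD('m). (\<Prod>i | rank_of i < j. t i) ^ (\<kappa> (j - 1) - \<kappa> j)) = (\<Prod>i\<in>UNIV. t i ^ \<kappa> (rank_of i))"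
proof -
  have "(\<Prod>j = 1..CARD('m). (\<Prod>i | rank_of i < j. t i) ^ (\<kappa> (j - 1) - \<kappa> j)) =
    (\<Prod>j = 1..CARD('m). \<Prod>i\<in>UNIV. (if rank_of i < j then t i ^ (\<kappa> (j - 1) - \<kappa> j) else 1))"
    by (intro prod.cong refl) (simp add: prod_power_distrib prod.If_cases)
  also have "\<dots> = (\<Prod>i\<in>UNIV. \<Prod>j = 1..CARD('m). (if rank_of i < j then t i ^ (\<kappa> (j - 1) - \<kappa> j) else 1))"
    by (rule prod.swap)
  also have "\<dots> = (\<Prod>i\<in>UNIV. t i ^ \<kappa> (rank_of i))"
  proof (intro prod.cong refl)
    fix i :: 'm
    have "(\<Prod>j = 1..CARD('m). (if rank_of i < j then t i ^ (\<kappa> (j - 1) - \<kappa> j) else 1)) =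
      (\<Prod>j\<in>{rank_of i<..CARD('m)}. t i ^ (\<kappa> (j - 1) - \<kappa> j))"
      by (rule prod.mono_neutral_cong_right) auto
    also have "\<dots> = t i ^ (\<Sum>j\<in>{rank_of i<..CARD('m)}. \<kappa> (j - 1) - \<kappa> j)" by (simp add: power_sum)
    also have "(\<Sum>j\<in>{rank_of i<..CARD('m)}. \<kappa> (j - 1) - \<kappa> j) = \<kappa> (rank_of i)"
      using telescope_nat[of \<kappa> "rank_of i" "CARD('m)"] partitionsD[OF \<kappa>] rank_of_less_card[of i]
      by (simp add: less_imp_le)
    finally show "(\<Prod>j = 1..CARD('m). (if rank_of i < j then t i ^ (\<kappa> (j - 1) - \<kappa> j) else 1)) = t i ^ \<kappa> (rank_of i)" .
  qed
  finally show ?thesis .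
qed

lemma power_poly_congruence:
  fixes S :: "('m, 'm) rmat"
  assumes "lower T" "transpose S = S"
  shows "power_poly \<kappa> (T ** S ** transpose T) = chi \<kappa> T * power_poly \<kappa> S"
proof -
  have "(\<Prod>j = 1..CARD('m). leading_minor j (T ** S ** transpose T) ^ (\<kappa> (j - 1) - \<kappa> j)) =
    (\<Prod>j = 1..CARD('m). (\<Prod>i | rank_of i < j. (T $ i $ i)\<^sup>2) ^ (\<kappa> (j - 1) - \<kappa> j)) *
    (\<Prod>j = 1..CARD('m). leading_minor j S ^ (\<kappa> (j - 1) - \<kappa> j))"
    by (simp add: leading_minor_congruence[OF assms(1)] power_mult_distrib prod.distrib)
  also have "(\<Prod>j = 1..CARD('m). (\<Prod>i | rank_of i < j. (T $ i $ i)\<^sup>2) ^ (\<kappa> (j - 1) - \<kappa> j)) = chi \<kappa> T"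
    unfolding chi_def power_mult by (rule prod_rank_telescope)
  finally show ?thesis
    using assms(2) transpose_congruence[OF assms(2), of T] by (simp add: power_poly_def on_sym_def)
qed

lemma act_power_poly:
  assumes "lower T" "invertible T"
  shows "act T (power_poly \<kappa>) = (\<lambda>S :: ('m, 'm) rmat. chi \<kappa> T * power_poly \<kappa> S)"
proof
  fix S :: "('m, 'm) rmat"
  show "act T (power_poly \<kappa>) S = chi \<kappa> T * power_poly \<kappa> S"
    using power_poly_congruence[OF assms(1), of S] transpose_congruence_iff[OF assms(2), of S]
    by (cases "transpose S = S") (auto simp: act_def power_poly_def on_sym_def)
qed

lemma power_poly_mat_1: "power_poly \<kappa> (mat 1 :: ('m, 'm) rmat) = 1"
proof -
  have "lower (mat 1 :: ('m, 'm) rmat)" by (auto simp: lower_def mat_def)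
  then have "leading_minor j (mat 1 :: ('m, 'm) rmat) = 1" for j
    by (simp add: leading_minor_lower mat_def)
  then show ?thesis by (simp add: power_poly_def on_sym_def transpose_mat)
qed

text \<open>A lower triangular congruence carries any positive definite matrix to the identity, so
  the value at the identity determines a semi-invariant on the cone, and the cone determines the
  polynomial.\<close>

lemma semi_invariant_unique:
  fixes P :: "('m, 'm) rmat \<Rightarrow> real"
  assumes P: "P \<in> hom_polys k"
    and semi: "\<And>T. lower T \<Longrightarrow> invertible T \<Longrightarrow> act T P = (\<lambda>S. chi \<kappa> T * P S)"
  shows "P = (\<lambda>S. P (mat 1) * power_poly \<kappa> S)"
proof -
  have *: "P S - P (mat 1) * power_poly \<kappa> S = 0" for S
  proof (rule hom_polys_eq_0I[where P = "\<lambda>S. P S - P (mat 1) * power_poly \<kappa> S" and k = k])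
    show "(\<lambda>S. P S - P (mat 1) * power_poly \<kappa> S) \<in> hom_polys k"
      by (intro subspace_fun_diff subspace_fun_scale subspace_hom_polys P power_poly_hom)
    fix S :: "('m, 'm) rmat" assume S: "transpose S = S" "pos_form S"
    obtain L :: "('m, 'm) rmat" where L: "lower L" "invertible L" "L ** S ** transpose L = mat 1"
      by (rule cholesky[OF S(2,1)]) blast
    have "P (mat 1) = chi \<kappa> L * P S"
      using fun_cong[OF semi[OF L(1,2)], of S] L(3) by (simp add: act_def)
    moreover have "1 = chi \<kappa> L * power_poly \<kappa> S"
      using power_poly_congruence[OF L(1) S(1)] L(3) power_poly_mat_1 by simp
    ultimately show "P S - P (mat 1) * power_poly \<kappa> S = 0" by (simp add: mult_ac)
  qed
  show ?thesis
  proof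
    fix S
    show "P S = P (mat 1) * power_poly \<kappa> S" using *[of S] by (rule iffD2[OF eq_iff_diff_eq_0])
  qed
qed

end

section \<open>The module generated by a power polynomial\<close>

lemma invertible_mat_1: "invertible (mat 1 :: ('m::finite, 'm) rmat)"
  unfolding invertible_def by (rule exI[of _ "mat 1"]) simp

text \<open>The explicit description of V_\<kappa>; \<open>zonal_space_eq\<close> identifies it with
  the space selected by \<open>zonal_space\<close>.\<close>

definition zspace :: "(nat \<Rightarrow> nat) \<Rightarrow> (('m::{finite,linorder}, 'm) rmat \<Rightarrow> real) set" where
  "zspace \<kappa> = fun_space.span {act g (power_poly \<kappa>) | g. invertible g}"

lemma subspace_zspace: "fun_space.subspace (zspace \<kappa>)"
  by (simp add: zspace_def)

lemma power_poly_in_zspace: "power_poly \<kappa> \<in> zspace \<kappa>"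
proof -
  have "power_poly \<kappa> = act (mat 1) (power_poly \<kappa>)" by (simp add: act_mat_1)
  moreover have "invertible (mat 1 :: ('a, 'a) rmat)" by (simp add: invertible_mat_1)
  ultimately show ?thesis unfolding zspace_def by (blast intro: fun_space.span_base)
qed

lemma zspace_induct [consumes 1, case_names act add scale]:
  fixes P :: "('m::{finite,linorder}, 'm) rmat \<Rightarrow> real"
  assumes "P \<in> zspace \<kappa>" "\<And>g. invertible g \<Longrightarrow> Q (act g (power_poly \<kappa>))"
    "\<And>f g. f \<in> zspace \<kappa> \<Longrightarrow> Q f \<Longrightarrow> g \<in> zspace \<kappa> \<Longrightarrow> Q g \<Longrightarrow> Q (\<lambda>x. f x + g x)"
    "\<And>c f. f \<in> zspace \<kappa> \<Longrightarrow> Q f \<Longrightarrow> Q (\<lambda>x. c * f x)"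
  shows "Q P"
  using assms(1) unfolding zspace_def
proof (induction rule: span_fun_induct)
  case zero
  have "invertible (mat 1 :: ('m, 'm) rmat)" by (simp add: invertible_mat_1)
  then have "Q (act (mat 1) (power_poly \<kappa>))" by (rule assms(2))
  then show ?case using assms(4)[OF power_poly_in_zspace, of 0] by (simp add: act_mat_1)
qed (use assms(2-) in \<open>auto simp: zspace_def\<close>)

lemma zspace_act:
  assumes "P \<in> zspace \<kappa>" "invertible h"
  shows "act h P \<in> zspace \<kappa>"
  using assms(1)
proof (induction rule: zspace_induct)
  case (act g)
  have "invertible (g ** h)" using act assms(2) by (simp add: invertible_mult)
  then show ?case unfolding zspace_def by (auto simp: act_act intro!: fun_space.span_base)
qed (simp_all add: act_add act_scale subspace_fun_add[OF subspace_zspace] subspace_fun_scale[OF subspace_zspace])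

lemma zspace_subset_invariant:
  assumes "gl_invariant V" "power_poly \<kappa> \<in> V"
  shows "zspace \<kappa> \<subseteq> V"
  unfolding zspace_def using assms by (intro fun_space.span_minimal) (auto simp: gl_invariant_iff)

context
  fixes \<kappa> :: "nat \<Rightarrow> nat" and k :: nat
  assumes \<kappa>: "\<kappa> \<in> partitions CARD('m::{finite,linorder}) k"
begin

lemma zspace_hom_polys: "(zspace \<kappa> :: (('m, 'm) rmat \<Rightarrow> real) set) \<subseteq> hom_polys k"
  unfolding zspace_def
  by (rule fun_space.span_minimal) (auto intro: act_hom_polys power_poly_hom[OF \<kappa>] subspace_hom_polys)

text \<open>For an invariant subspace \<open>V\<close>, the orthogonal projection of \<open>power_poly \<kappa>\<close> to \<open>V\<close> is
  again semi-invariant, hence a multiple of \<open>power_poly \<kappa>\<close>.\<close>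

lemma gl_irreducible_zspace: "gl_irreducible (zspace \<kappa> :: (('m, 'm) rmat \<Rightarrow> real) set)"
  unfolding gl_irreducible_def
proof (intro conjI allI impI)
  show "gl_invariant (zspace \<kappa> :: (('m, 'm) rmat \<Rightarrow> real) set)"
    by (auto simp: gl_invariant_iff subspace_zspace zspace_act)
  have "power_poly \<kappa> \<noteq> (0 :: ('m, 'm) rmat \<Rightarrow> real)"
    using power_poly_mat_1[OF \<kappa>] by (metis zero_fun_def zero_neq_one)
  then show "zspace \<kappa> \<noteq> {0 :: ('m, 'm) rmat \<Rightarrow> real}" using power_poly_in_zspace by blast
  fix V :: "(('m, 'm) rmat \<Rightarrow> real) set" assume V: "V \<subseteq> zspace \<kappa>" "gl_invariant V"
  have sub: "fun_space.subspace V" and inv: "\<And>g P. invertible g \<Longrightarrow> P \<in> V \<Longrightarrow> act g P \<in> V"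
    using V(2) by (auto simp: gl_invariant_iff)
  have Vh: "V \<subseteq> hom_polys k" using V(1) zspace_hom_polys by blast
  let ?P = "power_poly \<kappa> :: ('m, 'm) rmat \<Rightarrow> real" and ?B = "gram_form TYPE('m) k"
  have Ph: "?P \<in> hom_polys k" by (rule power_poly_hom[OF \<kappa>])
  obtain p where p: "p \<in> V" "\<And>v. v \<in> V \<Longrightarrow> ?B p v = ?B ?P v"
    by (rule gram_form_riesz[OF sub Vh, of "?B ?P"]) (auto simp: gram_form_add gram_form_scale Ph)
  have ph: "p \<in> hom_polys k" using p Vh by blast
  have left: "?B (\<lambda>S. c * q S) v = c * ?B q v" if "q \<in> hom_polys k" "v \<in> hom_polys k" for c q v
    using that by (simp add: gram_form_scale_left)
  have leftadd: "?B (\<lambda>S. r S + q S) v = ?B r v + ?B q v" if "r \<in> hom_polys k" "q \<in> hom_polys k" "v \<in> hom_polys k" for r q v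
    using that by (simp add: gram_form_add_left)
  have "act T p = (\<lambda>S. chi \<kappa> T * p S)" if T: "lower T" "invertible T" for T
  proof -
    define c where "c = - chi \<kappa> T"
    define d where "d = (\<lambda>S. act T p S + c * p S)"
    have dV: "d \<in> V" unfolding d_def
      by (intro subspace_fun_add subspace_fun_scale sub inv T p)
    have aph: "act T p \<in> hom_polys k" using inv T p Vh by blast
    \<comment> \<open>The aim is \<open>?B d d = 0\<close>. The adjoint of \<open>act T\<close>
      keeps d in V, and on V the functionals of p and of \<open>power_poly \<kappa>\<close> agree;
      hence p can be exchanged for the semi-invariant and back.\<close>
    have "?B (act T p) d = ?B p (act (transpose T) d)"
      using gram_form_adjoint[OF ph, of d T] dV Vh by blast
    also have "\<dots> = ?B ?P (act (transpose T) d)"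
      using p(2) inv[OF invertible_transpose[OF T(2)] dV] by blast
    also have "\<dots> = ?B (act T ?P) d"
      using gram_form_adjoint[OF Ph, of d T] dV Vh by (metis subsetD)
    also have "\<dots> = chi \<kappa> T * ?B ?P d"
      using left[OF Ph] dV Vh by (auto simp: act_power_poly[OF \<kappa> T])
    also have "\<dots> = chi \<kappa> T * ?B p d" using p(2)[OF dV] by simp
    finally have 1: "?B d (act T p) = chi \<kappa> T * ?B d p"
      using gram_form_sym aph ph dV Vh by (metis subsetD)
    have dh: "d \<in> hom_polys k" using dV Vh by blast
    have "?B d d = ?B d (\<lambda>S. act T p S + c * p S)" by (simp only: d_def)
    also have "\<dots> = ?B d (act T p) + c * ?B d p"
      using gram_form_add[OF dh aph subspace_fun_scale[OF subspace_hom_polys ph], of "TYPE('m)" c] gram_form_scale[OF dh ph, of "TYPE('m)" c]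
      by simp
    finally have "?B d d = 0" using 1 by (simp add: c_def)
    then have "d = (\<lambda>S. 0)" using gram_form_definite dV Vh by blast
    then show ?thesis by (auto simp: d_def c_def fun_eq_iff)
  qed
  then have p_eq: "p = (\<lambda>S. p (mat 1) * ?P S)"
    using semi_invariant_unique[OF \<kappa> ph] by blast
  show "V = {0} \<or> V = zspace \<kappa>"
  proof (cases "p (mat 1) = 0")
    case False
    have "(\<lambda>S. inverse (p (mat 1)) * p S) \<in> V" by (intro subspace_fun_scale sub p)
    moreover have "(\<lambda>S. inverse (p (mat 1)) * p S) = ?P"
      using False by (subst (2) p_eq) (auto simp: fun_eq_iff)
    ultimately have "zspace \<kappa> \<subseteq> V" using zspace_subset_invariant[OF V(2)] by simp
    then show ?thesis using V(1) by blast
  next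
    \<comment> \<open>Now \<open>power_poly \<kappa>\<close> is orthogonal to V. As V is invariant
      under transposed matrices too, all translates of it are orthogonal to V; since V lies in their
      span, it is orthogonal to itself.\<close>
    case True
    then have p0: "p = (\<lambda>S. 0)" using p_eq by simp
    have PV: "?B ?P v = 0" if "v \<in> V" for v
    proof -
      have "?B (\<lambda>S. 0 * p S) v = 0 * ?B p v" using that Vh by (intro left ph) auto
      then have "?B p v = 0" by (simp add: p0)
      then show ?thesis using p(2)[OF that] by simp
    qed
    have "?B w v = 0" if "w \<in> zspace \<kappa>" "v \<in> V" for w v
      using that
    proof (induction arbitrary: v rule: zspace_induct)
      case (act g)
      have "?B (act g ?P) v = ?B ?P (act (transpose g) v)"
        using gram_form_adjoint[OF Ph, of v g] act Vh by blast
      then show ?case using PV inv[OF invertible_transpose] act by simp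
    next
      case (add f g)
      then have "f \<in> hom_polys k" "g \<in> hom_polys k" "v \<in> hom_polys k" using Vh zspace_hom_polys by auto
      moreover have "?B f v = 0" "?B g v = 0" using add by auto
      ultimately show ?case by (subst leftadd) simp_all
    next
      case (scale c f)
      then show ?case using left[of f v c] Vh zspace_hom_polys by auto
    qed
    then have vz: "v = 0" if "v \<in> V" for v
      unfolding zero_fun_def
      using gram_form_definite that V(1) Vh by blast
    have "V = {0}"
    proof
      show "V \<subseteq> {0}" using vz by (simp add: subset_iff)
      show "{0} \<subseteq> V" using fun_space.subspace_0[OF sub] by simp
    qed
    then show ?thesis by simp
  qed
qed

text \<open>An irreducible space that contains \<open>power_poly \<kappa>\<close> also contains the
  invariant space generated by it; the latter is nonzero, so the two coincide.\<close>

lemma zonal_space_eq: "(zonal_space \<kappa> :: (('m, 'm) rmat \<Rightarrow> real) set) = zspace \<kappa>"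
  unfolding zonal_space_def partitionsD(3)[OF \<kappa>]
proof (rule the_equality)
  show "(zspace \<kappa> :: (('m, 'm) rmat \<Rightarrow> real) set) \<subseteq> hom_polys k \<and> gl_irreducible (zspace \<kappa> :: (('m, 'm) rmat \<Rightarrow> real) set) \<and> (power_poly \<kappa> :: ('m, 'm) rmat \<Rightarrow> real) \<in> zspace \<kappa>"
    by (intro conjI zspace_hom_polys gl_irreducible_zspace power_poly_in_zspace)
  fix V :: "(('m, 'm) rmat \<Rightarrow> real) set"
  assume V: "V \<subseteq> hom_polys k \<and> gl_irreducible V \<and> power_poly \<kappa> \<in> V"
  then have irr: "gl_invariant V \<and> V \<noteq> {0} \<and> (\<forall>W\<subseteq>V. gl_invariant W \<longrightarrow> W = {0} \<or> W = V)"
    unfolding gl_irreducible_def by (elim conjE) (intro conjI)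
  have 1: "gl_invariant V" by (rule conjunct1[OF irr])
  have 2: "W = {0} \<or> W = V" if "W \<subseteq> V" "gl_invariant W" for W
    using irr that by metis
  have 3: "gl_invariant (zspace \<kappa> :: (('m, 'm) rmat \<Rightarrow> real) set)" "zspace \<kappa> \<noteq> {0 :: ('m, 'm) rmat \<Rightarrow> real}"
    using conjunct1[OF gl_irreducible_zspace[unfolded gl_irreducible_def]]
      conjunct1[OF conjunct2[OF gl_irreducible_zspace[unfolded gl_irreducible_def]]] by simp_all
  have "zspace \<kappa> \<subseteq> V" using zspace_subset_invariant[OF 1] V by simp
  from 2[OF this 3(1)] 3(2) show "V = zspace \<kappa>" by simp
qed

end

section \<open>Orthogonality of the modules for different partitions\<close>

lemma chi_single:
  assumes "\<kappa> \<in> partitions CARD('m::{finite,linorder}) k"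
  shows "chi \<kappa> ((\<chi> i j. if i = j then if i = p then 2 else 1 else 0) :: ('m, 'm) rmat) = 4 ^ \<kappa> (rank_of (p :: 'm))"
proof -
  have "chi \<kappa> ((\<chi> i j. if i = j then if i = p then 2 else 1 else 0) :: ('m, 'm) rmat) = (\<Prod>i\<in>UNIV. if i = p then 2 ^ (2 * \<kappa> (rank_of p)) else 1)"
    unfolding chi_def by (rule prod.cong) auto
  then show ?thesis by (simp add: power_mult)
qed

text \<open>For lower triangular \<open>L\<close>, the function \<open>g \<mapsto> \<langle>act g P\<^sub>\<kappa>, P\<^sub>\<tau>\<rangle>\<close> is multiplied by a
  character under \<open>g \<mapsto> L g L\<^sup>T\<close>; hence it vanishes near the identity, where every \<open>g\<close> can be
  brought to upper triangular form in this way.\<close>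

lemma zspace_orthogonal:
  fixes P Q :: "('m::{finite,linorder}, 'm) rmat \<Rightarrow> real"
  assumes \<kappa>: "\<kappa> \<in> partitions CARD('m) k" and \<tau>: "\<tau> \<in> partitions CARD('m) k" and "\<kappa> \<noteq> \<tau>"
    and "P \<in> zspace \<kappa>" "Q \<in> zspace \<tau>"
  shows "gram_form (ty :: 'n::finite itself) k P Q = 0"
proof -
  let ?P = "power_poly \<kappa> :: ('m, 'm) rmat \<Rightarrow> real" and ?Q = "power_poly \<tau> :: ('m, 'm) rmat \<Rightarrow> real"
  let ?B = "gram_form ty k"
  have h: "?P \<in> hom_polys k" "?Q \<in> hom_polys k" using power_poly_hom \<kappa> \<tau> by blast+
  have adj: "?B (act g p) q = ?B p (act (transpose g) q)" if "p \<in> hom_polys k" "q \<in> hom_polys k" for p q g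
    using gram_form_adjoint[OF that, where 'n = 'n] by (simp add: gram_form_def)
  have left: "?B (\<lambda>S. c * q S) v = c * ?B q v" if "q \<in> hom_polys k" "v \<in> hom_polys k" for c q v
    using that by (simp add: gram_form_scale_left)
  have leftadd: "?B (\<lambda>S. p S + q S) v = ?B p v + ?B q v" if "p \<in> hom_polys k" "q \<in> hom_polys k" "v \<in> hom_polys k" for p q v
    using that by (simp add: gram_form_add_left)
  have PQ: "?B ?P ?Q = 0"
  proof -
    obtain r where "\<kappa> r \<noteq> \<tau> r" using \<open>\<kappa> \<noteq> \<tau>\<close> by auto
    then have "r < CARD('m)" using partitionsD(2)[OF \<kappa>] partitionsD(2)[OF \<tau>] by (metis not_less)
    then obtain p :: 'm where p: "rank_of p = r" using ex_rank_of by blast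
    \<comment> \<open>T doubles the coordinate at a place where the partitions differ. It is
      symmetric, so its action is self-adjoint, and the two power polynomials are eigenvectors for
      the different eigenvalues 4^(\<kappa> r) and 4^(\<tau> r).\<close>
    define T :: "('m, 'm) rmat" where "T = (\<chi> i j. if i = j then if i = p then 2 else 1 else 0)"
    have T: "lower T" "transpose T = T" "invertible T"
      by (auto simp: T_def lower_def transpose_def vec_eq_iff intro!: lower_invertible split: if_splits)
    have "chi \<kappa> T * ?B ?P ?Q = ?B (act T ?P) ?Q" by (simp add: act_power_poly[OF \<kappa> T(1,3)] left h)
    also have "\<dots> = ?B ?P (act T ?Q)" using adj[OF h, of T] T by simp
    also have "\<dots> = chi \<tau> T * ?B ?P ?Q" by (simp add: act_power_poly[OF \<tau> T(1,3)] gram_form_scale h)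
    finally have "(4 ^ \<kappa> r - 4 ^ \<tau> r :: real) * ?B ?P ?Q = 0"
      using chi_single[OF \<kappa>, of p] chi_single[OF \<tau>, of p] by (simp add: T_def p left_diff_distrib)
    moreover have "(4 ^ \<kappa> r :: real) \<noteq> 4 ^ \<tau> r" using \<open>\<kappa> r \<noteq> \<tau> r\<close> by simp
    ultimately show ?thesis by simp
  qed
  define \<phi> where "\<phi> g = ?B (act g ?P) ?Q" for g
  have pos: "\<phi> g = 0" if g: "pos_form g" for g
  proof -
    obtain L where L: "lower L" "\<And>i. L $ i $ i = 1" "\<And>i j. j < i \<Longrightarrow> (L ** g ** transpose L) $ i $ j = 0"
      using triangular_reduction[OF g] by blast
    have Li: "invertible L" using L by (intro lower_invertible) auto
    have gi: "invertible g" by (rule pos_form_invertible[OF g])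
    \<comment> \<open>The adjoint of the action of the upper triangular \<open>transpose U\<close>
      is that of U, which acts on \<open>power_poly \<tau>\<close> by a character; this reduces the
      value to \<open>PQ\<close>. The characters of the unipotent L are 1, so removing L and its
      transpose does not change the value.\<close>
    define U where "U = transpose (L ** g ** transpose L)"
    have U: "lower U" using L(3) by (auto simp: lower_def U_def transpose_def)
    have Ui: "invertible U" unfolding U_def
      using Li gi by (intro invertible_transpose invertible_mult)
    have chi1: "chi \<sigma> L = 1" for \<sigma> by (simp add: chi_def L)
    have "?B (act (transpose U) ?P) ?Q = ?B ?P (act U ?Q)" using adj[OF h, of "transpose U"] by simp
    also have "\<dots> = 0" using PQ by (simp add: act_power_poly[OF \<tau> U Ui] gram_form_scale h)
    finally have "0 = ?B (act (transpose U) ?P) ?Q" by simp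
    also have "act (transpose U) ?P = act (transpose L) (act g (act L ?P))"
      by (simp add: U_def act_act matrix_mul_assoc)
    also have "act L ?P = ?P" by (simp add: act_power_poly[OF \<kappa> L(1) Li] chi1)
    also have "?B (act (transpose L) (act g ?P)) ?Q = ?B (act g ?P) (act L ?Q)"
      using adj[OF act_hom_polys[OF h(1) gi] h(2), of "transpose L"] by simp
    also have "act L ?Q = ?Q" by (simp add: act_power_poly[OF \<tau> L(1) Li] chi1)
    finally show ?thesis by (simp add: \<phi>_def)
  qed
  have \<phi>0: "\<phi> g = 0" for g
  proof -
    have "(pull ?Q :: ('m, 'n) rmat \<Rightarrow> real) \<in> homs (2 * k)" by (rule pull_homs[OF h(2)])
    then obtain A \<alpha> where A: "finite A" "pull ?Q = (\<lambda>x. \<Sum>a\<in>(A :: ('m, 'n) rmat set). \<alpha> a * (a \<bullet> x) ^ (2 * k))"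
      by (rule homs_repr)
    \<comment> \<open>Expanding the second argument into powers shows \<phi> to be a homogeneous
      polynomial in g, also at singular g.\<close>
    have eq: "\<phi> g = (\<Sum>a\<in>A. \<alpha> a * pull ?P (g ** a))" for g
    proof -
      have lin: "(\<lambda>x :: ('m, 'n) rmat. pull ?P (g ** x)) \<in> homs (2 * k)"
        by (rule homs_compose[OF pull_homs[OF h(1)] linear_matrix_mult_left])
      have "\<phi> g = fischer (2 * k) (\<lambda>x :: ('m, 'n) rmat. pull ?P (g ** x)) (pull ?Q)"
        by (simp add: \<phi>_def gram_form_def pull_act[abs_def])
      also have "\<dots> = fischer (2 * k) (pull ?Q) (\<lambda>x :: ('m, 'n) rmat. pull ?P (g ** x))"
        by (rule fischer_sym[OF lin pull_homs[OF h(2)]])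
      also have "\<dots> = (\<Sum>a\<in>A. \<alpha> a * pull ?P (g ** a))"
        by (rule fischer_eq[OF A lin])
      finally show ?thesis .
    qed
    have "(\<lambda>g. pull ?P (g ** a)) \<in> homs (2 * k)" for a :: "('m, 'n) rmat"
      by (rule homs_compose[OF pull_homs[OF h(1)] linear_matrix_mult_right])
    then have \<phi>h: "\<phi> \<in> homs (2 * k)" unfolding eq[abs_def] by (intro homs_sum homs_scale)
    obtain e where e: "0 < e" "\<And>t. 0 < t \<Longrightarrow> t < e \<Longrightarrow> pos_form (mat 1 + t *\<^sub>R (g - mat 1))"
      using pos_form_near_mat_1 by blast
    have "\<phi> (mat 1 + 1 *\<^sub>R (g - mat 1)) = 0"
      by (rule homs_zero_of_line[OF \<phi>h e(1)]) (use pos e(2) in blast)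
    then show ?thesis by simp
  qed
  have Ph: "P \<in> hom_polys k" "Q \<in> hom_polys k" using assms(4,5) zspace_hom_polys[OF \<kappa>] zspace_hom_polys[OF \<tau>] by auto
  have "?B (act g ?P) Q = 0" if "invertible g" for g
    using assms(5) that
  proof (induction arbitrary: g rule: zspace_induct)
    case (act h')
    have "?B (act g ?P) (act h' ?Q) = ?B (act (transpose h') (act g ?P)) ?Q"
      using adj[OF act_hom_polys[OF h(1) act(2)] h(2), of "transpose h'"] by simp
    then show ?case using \<phi>0[of "g ** transpose h'"] by (simp add: act_act \<phi>_def)
  next
    case (add p q)
    then show ?case using zspace_hom_polys[OF \<tau>] act_hom_polys[OF h(1)]
      by (subst gram_form_add) auto
  next
    case (scale c p)
    then show ?case using zspace_hom_polys[OF \<tau>] act_hom_polys[OF h(1)]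
      by (subst gram_form_scale) auto
  qed
  with assms(4) show ?thesis
  proof (induction rule: zspace_induct)
    case (add p q)
    then show ?case using zspace_hom_polys[OF \<kappa>] Ph by (subst leftadd) auto
  next
    case (scale c p)
    then show ?case using zspace_hom_polys[OF \<kappa>] Ph by (subst left) auto
  qed auto
qed

section \<open>Spectral decomposition\<close>

text \<open>A maximizer v of x . f x on the unit sphere of S is an eigenvector: the first variation
  in the direction of the residual h = f v - c v forces h = 0.\<close>

lemma self_adjoint_eigenvector:
  fixes f :: "'a::euclidean_space \<Rightarrow> 'a"
  assumes f: "linear f" and adj: "\<And>x y. f x \<bullet> y = x \<bullet> f y"
    and S: "subspace S" "\<And>x. x \<in> S \<Longrightarrow> f x \<in> S" "S \<noteq> {0}"
  obtains v c where "v \<in> S" "norm v = 1" "f v = c *\<^sub>R v"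
proof -
  obtain x0 where "x0 \<in> S" "x0 \<noteq> 0" using S(1,3) subspace_0 by blast
  then have "x0 /\<^sub>R norm x0 \<in> S \<inter> sphere 0 1" using S(1) by (simp add: subspace_scale)
  then have ne: "S \<inter> sphere 0 1 \<noteq> {}" by blast
  have cpt: "compact (S \<inter> sphere 0 1)"
    using closed_subspace[OF S(1)] by (simp add: closed_Int_compact)
  have "continuous_on (S \<inter> sphere 0 1) (\<lambda>x. x \<bullet> f x)"
    by (intro continuous_intros linear_continuous_on f linear_conv_bounded_linear[THEN iffD1])
  from continuous_attains_sup[OF cpt ne this] obtain v where v: "v \<in> S" "norm v = 1"
    "\<And>w. w \<in> S \<Longrightarrow> norm w = 1 \<Longrightarrow> w \<bullet> f w \<le> v \<bullet> f v" by auto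
  define c where "c = v \<bullet> f v"
  have le: "w \<bullet> f w \<le> c * (w \<bullet> w)" if "w \<in> S" for w
  proof (cases "w = 0")
    case False
    let ?w = "w /\<^sub>R norm w"
    have "?w \<bullet> f ?w \<le> c" unfolding c_def using v(3)[of ?w] that False S(1) by (simp add: subspace_scale)
    moreover have "f ?w = f w /\<^sub>R norm w" by (rule linear_cmul[OF f])
    then have "?w \<bullet> f ?w = (w \<bullet> f w) / (w \<bullet> w)"
      by (simp add: power2_norm_eq_inner[symmetric] power2_eq_square divide_simps)
    moreover have "0 < w \<bullet> w" using False by simp
    ultimately show ?thesis by (simp add: pos_divide_le_eq)
  qed (use f in \<open>simp add: linear_0\<close>)
  define h where "h = f v - c *\<^sub>R v"
  have hS: "h \<in> S" unfolding h_def using S v(1) by (simp add: subspace_diff subspace_scale)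
  have vv: "v \<bullet> v = 1" using v(2) by (simp add: norm_eq_1)
  have vh: "v \<bullet> h = 0" by (simp add: h_def inner_diff_right vv c_def)
  have hf: "h \<bullet> f v = h \<bullet> h"
  proof -
    have "f v = h + c *\<^sub>R v" by (simp add: h_def)
    then have "h \<bullet> f v = h \<bullet> h + c * (h \<bullet> v)" by (metis inner_add_right inner_scaleR_right)
    then show ?thesis using vh by (simp add: inner_commute)
  qed
  \<comment> \<open>Comparing w . f w with c |w|^2 at w = v + t h gives 2 t |h|^2 \<le> t^2 C for
    every t > 0.\<close>
  define C where "C = c * (h \<bullet> h) - h \<bullet> f h"
  have C: "0 \<le> C" using le[OF hS] by (simp add: C_def)
  have "2 * (h \<bullet> h) \<le> t * C" if "0 < t" for t
  proof -
    let ?w = "v + t *\<^sub>R h"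
    have "?w \<in> S" using S(1) v(1) hS by (simp add: subspace_add subspace_scale)
    from le[OF this] have 1: "?w \<bullet> f ?w \<le> c * (?w \<bullet> ?w)" .
    have "v \<bullet> f h = h \<bullet> h" using hf adj[of v h] by (simp add: inner_commute)
    then have 2: "?w \<bullet> f ?w = c + 2 * t * (h \<bullet> h) + t * t * (h \<bullet> f h)"
      using f hf by (simp add: linear_add linear_cmul inner_add_left inner_add_right c_def algebra_simps)
    have 3: "?w \<bullet> ?w = 1 + t * t * (h \<bullet> h)"
      using vv vh by (simp add: inner_add_left inner_add_right inner_commute[of h v])
    have "t * (2 * (h \<bullet> h)) \<le> t * (t * C)"
      using 1 unfolding 2 3 by (simp add: C_def algebra_simps)
    then show ?thesis using that by simp
  qed
  note le_C = this
  have "h \<bullet> h \<le> 0"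
  proof (rule ccontr)
    assume H: "\<not> h \<bullet> h \<le> 0"
    then have "0 < (h \<bullet> h) / (C + 1)" using C by (intro divide_pos_pos) auto
    from le_C[OF this] have "2 * (h \<bullet> h) \<le> ((h \<bullet> h) * C) / (C + 1)" by simp
    then have "2 * (h \<bullet> h) * (C + 1) \<le> (h \<bullet> h) * C" using C by (subst (asm) pos_le_divide_eq) auto
    then have "(h \<bullet> h) * (C + 2) \<le> 0" by (simp add: algebra_simps)
    moreover have "0 < (h \<bullet> h) * (C + 2)" using H C by (intro mult_pos_pos) auto
    ultimately show False by simp
  qed
  then have "h = 0" using inner_ge_zero[of h] by (metis inner_eq_zero_iff order_antisym)
  then show ?thesis using that v by (simp add: h_def)
qed

lemma self_adjoint_basis:
  fixes f :: "'a::euclidean_space \<Rightarrow> 'a"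
  assumes f: "linear f" and adj: "\<And>x y. f x \<bullet> y = x \<bullet> f y"
  shows "subspace S \<Longrightarrow> (\<And>x. x \<in> S \<Longrightarrow> f x \<in> S) \<Longrightarrow>
    \<exists>B. finite B \<and> span B = S \<and> pairwise orthogonal B \<and> (\<forall>b\<in>B. norm b = 1 \<and> (\<exists>c. f b = c *\<^sub>R b))"
proof (induction "dim S" arbitrary: S rule: less_induct)
  case less
  show ?case
  proof (cases "S = {0}")
    case True
    then show ?thesis by (intro exI[of _ "{}"]) auto
  next
    case False
    obtain v c where v: "v \<in> S" "norm v = 1" "f v = c *\<^sub>R v"
      by (rule self_adjoint_eigenvector[OF f adj less.prems False])
    have vv: "v \<bullet> v = 1" using v(2) by (simp add: norm_eq_1)
    define S' where "S' = {x \<in> S. v \<bullet> x = 0}"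
    have sub: "subspace S'" using less.prems(1) unfolding S'_def subspace_def by (auto simp: inner_add_right)
    have inv: "f x \<in> S'" if "x \<in> S'" for x
    proof -
      have "v \<bullet> f x = f v \<bullet> x" using adj by simp
      then show ?thesis using that less.prems(2) v(3) by (simp add: S'_def)
    qed
    have "v \<notin> S'" using vv by (simp add: S'_def)
    moreover have "S' \<subseteq> S" by (auto simp: S'_def)
    ultimately have "S' \<subset> S" using v(1) by blast
    then have "dim S' < dim S" using sub less.prems(1) by (intro dim_psubset) (simp add: span_eq_iff[THEN iffD2])
    then obtain B where B: "finite B" "span B = S'" "pairwise orthogonal B"
      "\<forall>b\<in>B. norm b = 1 \<and> (\<exists>c. f b = c *\<^sub>R b)" using less.hyps[OF _ sub inv] by blast
    have BS: "B \<subseteq> S'" using B(2) span_superset by blast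
    have "span (insert v B) = S"
    proof
      show "span (insert v B) \<subseteq> S" using BS v(1) less.prems(1) by (intro span_minimal) (auto simp: S'_def)
      show "S \<subseteq> span (insert v B)"
      proof
        fix x assume x: "x \<in> S"
        have "x - (v \<bullet> x) *\<^sub>R v \<in> S'"
          using x v(1) less.prems(1) vv by (auto simp: S'_def inner_diff_right subspace_diff subspace_scale)
        then show "x \<in> span (insert v B)" unfolding span_breakdown_eq B(2) by blast
      qed
    qed
    moreover have "pairwise orthogonal (insert v B)"
      using B(3) BS by (auto simp: pairwise_insert orthogonal_def S'_def inner_commute)
    ultimately show ?thesis using B v by (intro exI[of _ "insert v B"]) auto
  qed
qed

lemma orthogonal_matrixI_rows:
  fixes k :: "('m::finite, 'm) rmat"
  assumes "\<And>i j. k $ i \<bullet> k $ j = (if i = j then 1 else 0)"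
  shows "orthogonal_matrix k"
proof -
  have "k ** transpose k = mat 1" using assms by (simp add: vec_eq_iff gram_entry mat_def)
  then show ?thesis by (simp add: orthogonal_matrix_def matrix_left_right_inverse)
qed

lemma symmetric_diagonalization:
  fixes S :: "('m::finite, 'm) rmat"
  assumes "transpose S = S"
  obtains k d where "orthogonal_matrix k" "\<And>i. S *v (k $ i) = d i *\<^sub>R k $ i"
proof -
  have adj: "(S *v x) \<bullet> y = x \<bullet> (S *v y)" for x y
    using inner_matrix_vector[of x S y] assms by (simp only:)
  obtain B where B: "finite B" "span B = UNIV" "pairwise orthogonal B"
    "\<forall>b\<in>B. norm b = 1 \<and> (\<exists>c. S *v b = c *\<^sub>R b)"
    using self_adjoint_basis[OF matrix_vector_mul_linear adj, of UNIV] by auto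
  have "0 \<notin> B" using B(4) by force
  then have "independent B" using pairwise_orthogonal_independent[OF B(3)] by simp
  then have "card B = CARD('m)" using dim_eq_card[of B UNIV] B(2) by simp
  then obtain b where b: "bij_betw b (UNIV :: 'm set) B"
    using B(1) finite_same_card_bij[of "UNIV :: 'm set" B] by auto
  then have bB: "b i \<in> B" for i by (auto simp: bij_betw_def)
  have "\<forall>i. \<exists>c. S *v b i = c *\<^sub>R b i" using conjunct2[OF bspec[OF B(4) bB]] by (rule allI)
  then obtain d where "\<forall>i. S *v b i = d i *\<^sub>R b i" by (rule choice[THEN exE])
  then have d: "\<And>i. S *v b i = d i *\<^sub>R b i" by (rule spec)
  have "b i \<bullet> b j = (if i = j then 1 else 0)" for i j
  proof (cases "i = j")
    case True
    have "norm (b i) = 1" by (rule conjunct1[OF bspec[OF B(4) bB]])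
    then have "b i \<bullet> b i = 1" by (rule norm_eq_1[THEN iffD1])
    then show ?thesis using True by simp
  next
    case False
    then have "b i \<noteq> b j" using b by (auto simp: bij_betw_def inj_on_def)
    then have "orthogonal (b i) (b j)" using pairwiseD[OF B(3)] bB by blast
    then show ?thesis using False by (simp add: orthogonal_def)
  qed
  then have "orthogonal_matrix (\<chi> i. b i)" by (intro orthogonal_matrixI_rows) simp
  then show ?thesis by (rule that[of _ d]) (simp add: d)
qed

lemma orthogonal_matrix_vector_eqI:
  fixes A B :: "('m::finite, 'm) rmat"
  assumes "orthogonal_matrix k" "\<And>i. A *v (k $ i) = B *v (k $ i)"
  shows "A = B"
proof -
  have "(C ** transpose k) $ i $ j = (C *v (k $ j)) $ i" for C :: "('m, 'm) rmat" and i j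
    by (simp add: matrix_matrix_mult_def matrix_vector_mult_def transpose_def)
  then have "A ** transpose k = B ** transpose k" using assms(2) by (simp add: vec_eq_iff)
  then have "A ** (transpose k ** k) = B ** (transpose k ** k)" by (simp add: matrix_mul_assoc)
  then show ?thesis using assms(1) by (simp add: orthogonal_matrix_def)
qed

text \<open>On an eigenvector b of A with eigenvalue d one has (B + d) (B - d) b = 0. Thus y = B b -
  d b satisfies B y = - d y, and semidefiniteness of B gives y = 0 if d > 0; if d = 0, then |B b|^2
  = b . B (B b) = 0.\<close>

lemma psd_sqrt_unique:
  fixes A :: "('m::finite, 'm) rmat"
  assumes A: "pos_semidef A" "pos_semidef B" and AB: "A ** A = B ** B"
  shows "A = B"
proof -
  obtain k d where k: "orthogonal_matrix k" "\<And>i. A *v (k $ i) = d i *\<^sub>R k $ i"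
    using symmetric_diagonalization[of A] A(1) by (metis pos_semidef_def)
  have "B *v (k $ i) = d i *\<^sub>R k $ i" for i
  proof -
    let ?b = "k $ i"
    have b: "?b \<bullet> ?b = 1"
    proof -
      have "(k ** transpose k) $ i $ i = 1" using k(1) by (simp add: orthogonal_matrix_def mat_def)
      then show ?thesis by (simp add: gram_entry)
    qed
    have "0 \<le> ?b \<bullet> (A *v ?b)" using A(1) by (simp add: pos_semidef_def)
    then have d: "0 \<le> d i" by (simp add: k(2) b)
    have "B *v (B *v ?b) = (A ** A) *v ?b" unfolding AB by (simp add: matrix_vector_mul_assoc)
    also have "\<dots> = A *v (A *v ?b)" by (simp add: matrix_vector_mul_assoc)
    also have "\<dots> = (d i * d i) *\<^sub>R ?b" by (simp add: k(2) matrix_vector_mult_scaleR)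
    finally have BB: "B *v (B *v ?b) = (d i * d i) *\<^sub>R ?b" .
    have adj: "(B *v x) \<bullet> y = x \<bullet> (B *v y)" for x y
      using inner_matrix_vector[of x B y] conjunct1[OF A(2)[unfolded pos_semidef_def]] by (simp only:)
    define y where "y = B *v ?b - d i *\<^sub>R ?b"
    have "B *v y = - d i *\<^sub>R y"
      by (simp add: y_def matrix_vector_mult_diff_distrib BB matrix_vector_mult_scaleR algebra_simps)
    moreover have "0 \<le> y \<bullet> (B *v y)" using A(2) by (simp add: pos_semidef_def)
    ultimately have y: "d i * (y \<bullet> y) \<le> 0" by simp
    have "y = 0"
    proof (cases "d i = 0")
      case True
      then have "(B *v ?b) \<bullet> (B *v ?b) = 0" using BB adj[of ?b "B *v ?b"] by simp
      then show ?thesis using True by (simp add: y_def)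
    next
      case False
      then have "y \<bullet> y \<le> 0" using y d by (simp add: mult_le_0_iff)
      then show ?thesis by (metis inner_eq_zero_iff inner_ge_zero order_antisym)
    qed
    then show ?thesis by (simp add: y_def)
  qed
  then show ?thesis using orthogonal_matrix_vector_eqI[OF k(1), of A B] k(2) by simp
qed

lemma psd_sqrt_exists:
  fixes A :: "('m::finite, 'm) rmat"
  assumes "pos_semidef A"
  obtains B where "pos_semidef B" "B ** B = A"
proof -
  obtain k d where k: "orthogonal_matrix k" "\<And>i. A *v (k $ i) = d i *\<^sub>R k $ i"
    using symmetric_diagonalization[of A] assms by (metis pos_semidef_def)
  have kk: "k $ i \<bullet> k $ j = (if i = j then 1 else 0)" for i j
  proof -
    have "(k ** transpose k) $ i $ j = (if i = j then 1 else 0)" using k(1) by (simp add: orthogonal_matrix_def mat_def)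
    then show ?thesis by (simp add: gram_entry)
  qed
  have d: "0 \<le> d i" for i
  proof -
    have "0 \<le> k $ i \<bullet> (A *v (k $ i))" using assms by (simp add: pos_semidef_def)
    then show ?thesis by (simp add: k(2) kk)
  qed
  define D :: "('m, 'm) rmat" where "D = (\<chi> i j. if i = j then sqrt (d i) else 0)"
  define B where "B = transpose k ** D ** k"
  have kv: "k *v (k $ i) = axis i 1" for i
  proof -
    have "(k *v (k $ i)) $ j = axis i 1 $ j" for j
      using kk[of j i] by (simp add: matrix_vector_mul_component axis_def)
    then show ?thesis by (simp add: vec_eq_iff)
  qed
  have Dv: "D *v axis i 1 = sqrt (d i) *\<^sub>R axis i 1" for i
    unfolding matrix_vector_mult_basis by (simp add: vec_eq_iff D_def column_def axis_def)
  have kt: "transpose k *v axis i 1 = k $ i" for i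
    by (simp add: matrix_vector_mult_basis column_def transpose_def vec_eq_iff del: transpose_matrix_vector)
  have B: "B *v (k $ i) = sqrt (d i) *\<^sub>R k $ i" for i
    by (simp add: B_def matrix_vector_mul_assoc[symmetric] kv Dv kt matrix_vector_mult_scaleR del: transpose_matrix_vector)
  have "(B ** B) *v (k $ i) = A *v (k $ i)" for i
    using d[of i] by (simp add: matrix_vector_mul_assoc[symmetric] B k(2) matrix_vector_mult_scaleR)
  then have "B ** B = A" by (rule orthogonal_matrix_vector_eqI[OF k(1)])
  moreover have "pos_semidef B"
    unfolding pos_semidef_def
  proof (intro conjI allI)
    have "transpose D = D" by (auto simp: D_def transpose_def vec_eq_iff)
    then show "transpose B = B" by (simp add: B_def matrix_transpose_mul matrix_mul_assoc)
    fix x :: "real^'m"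
    have "x \<bullet> (B *v x) = (k *v x) \<bullet> (D *v (k *v x))"
      using inner_matrix_vector[of x "transpose k" "D *v (k *v x)"]
      by (simp add: B_def matrix_vector_mul_assoc[symmetric] del: transpose_matrix_vector)
    also have "\<dots> = (\<Sum>i\<in>UNIV. sqrt (d i) * ((k *v x) $ i)\<^sup>2)"
      by (simp add: inner_vec_def D_def matrix_vector_mult_def[of "\<chi> i j. _ i j"] if_distrib if_distribR power2_eq_square mult_ac cong: if_cong)
    also have "\<dots> \<ge> 0" using d by (intro sum_nonneg) auto
    finally show "0 \<le> x \<bullet> (B *v x)" .
  qed
  ultimately show ?thesis using that by blast
qed

lemma psd_sqrt:
  fixes A :: "('m::finite, 'm) rmat"
  assumes "pos_semidef A"
  shows "pos_semidef (psd_sqrt A)" "psd_sqrt A ** psd_sqrt A = A"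
proof -
  obtain B where B: "pos_semidef B" "B ** B = A" by (rule psd_sqrt_exists[OF assms])
  have "\<exists>!B. pos_semidef B \<and> B ** B = A"
  proof (rule ex1I[of _ B])
    fix C assume "pos_semidef C \<and> C ** C = A"
    then show "C = B" using psd_sqrt_unique[of C B] B by simp
  qed (use B in simp)
  from theI'[OF this] show "pos_semidef (psd_sqrt A)" "psd_sqrt A ** psd_sqrt A = A"
    unfolding psd_sqrt_def by (rule conjunct1, rule conjunct2)
qed

section \<open>Singular value decomposition\<close>

text \<open>The Householder reflection along u, which is the identity for u = 0.\<close>

definition reflection :: "'a::euclidean_space \<Rightarrow> 'a \<Rightarrow> 'a" where
  "reflection u v = v - (2 * (v \<bullet> u) / (u \<bullet> u)) *\<^sub>R u"

lemma orthogonal_transformation_reflection: "orthogonal_transformation (reflection u)"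
  unfolding orthogonal_transformation_def
proof
  show "linear (reflection u)"
    by (rule linearI) (auto simp: reflection_def inner_add_left algebra_simps add_divide_distrib)
  show "\<forall>v w. reflection u v \<bullet> reflection u w = v \<bullet> w"
  proof (cases "u = 0")
    case False
    then have "u \<bullet> u \<noteq> 0" by simp
    then show ?thesis
      by (auto simp: reflection_def inner_diff_left inner_diff_right inner_commute field_simps)
  qed (simp add: reflection_def)
qed

lemma reflection_swap:
  assumes "a \<bullet> a = b \<bullet> b"
  shows "reflection (a - b) a = b"
proof (cases "a = b")
  case False
  then have nz: "(a - b) \<bullet> (a - b) \<noteq> 0" by simp
  have "(a - b) \<bullet> (a - b) = 2 * (a \<bullet> (a - b))"
    using assms by (simp add: inner_diff_left inner_diff_right inner_commute)
  then have q: "2 * (a \<bullet> (a - b)) / ((a - b) \<bullet> (a - b)) = 1" using nz by simp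
  show ?thesis unfolding reflection_def q by simp
qed (simp add: reflection_def)

text \<open>One vector at a time: the reflection taking h (r p) to s p fixes the s i treated before,
  because equal inner products make them orthogonal to h (r p) - s p. Linearly dependent families
  are covered.\<close>

lemma isometry_extension:
  fixes r s :: "'i \<Rightarrow> 'a::euclidean_space"
  assumes "finite I" "\<And>i j. i \<in> I \<Longrightarrow> j \<in> I \<Longrightarrow> r i \<bullet> r j = s i \<bullet> s j"
  shows "\<exists>h. orthogonal_transformation h \<and> (\<forall>i\<in>I. h (r i) = s i)"
  using assms
proof (induction I rule: finite_induct)
  case empty
  show ?case using orthogonal_transformation_id by blast
next
  case (insert p I)
  then obtain h where h: "orthogonal_transformation h" "\<And>i. i \<in> I \<Longrightarrow> h (r i) = s i" by auto
  define g where "g = reflection (h (r p) - s p)"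
  have hh: "h v \<bullet> h w = v \<bullet> w" for v w using h(1) by (simp add: orthogonal_transformation_def)
  have "g (h (r p)) = s p" unfolding g_def
    by (rule reflection_swap) (simp add: hh insert.prems)
  moreover have "g (s i) = s i" if "i \<in> I" for i
  proof -
    have "s i \<bullet> h (r p) = s i \<bullet> s p" using h(2)[OF that] hh[of "r i" "r p"] insert.prems[of i p] that by simp
    then show ?thesis by (simp add: g_def reflection_def inner_diff_right)
  qed
  ultimately have "\<forall>i\<in>insert p I. (g \<circ> h) (r i) = s i" using h(2) by simp
  moreover have "orthogonal_transformation (g \<circ> h)"
    unfolding g_def by (rule orthogonal_transformation_compose[OF orthogonal_transformation_reflection h(1)])
  ultimately show ?case by blast
qed

lemma same_gram_imp_orthogonal:
  fixes x y :: "('l::finite, 'n::finite) rmat"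
  assumes "x ** transpose x = y ** transpose y"
  obtains h where "orthogonal_matrix h" "x ** h = y"
proof -
  have "x $ i \<bullet> x $ j = y $ i \<bullet> y $ j" for i j using assms by (metis gram_entry)
  then obtain f where f: "orthogonal_transformation f" "\<And>i. f (x $ i) = y $ i"
    using isometry_extension[of UNIV "\<lambda>i. x $ i" "\<lambda>i. y $ i"] by auto
  have lin: "linear f" and orth: "orthogonal_matrix (matrix f)"
    using f(1) by (auto simp: orthogonal_transformation_matrix)
  have "(x ** transpose (matrix f)) $ i $ j = (matrix f *v (x $ i)) $ j" for i j
    by (simp add: matrix_matrix_mult_def matrix_vector_mult_def transpose_def mult.commute)
  then have "x ** transpose (matrix f) = y"
    using lin f(2) by (simp add: vec_eq_iff)
  then show ?thesis using that orth by (metis orthogonal_matrix_transpose)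
qed

text \<open>Rows and columns are indexed by unrelated types, so \<iota> says where the diagonal
  is.\<close>

definition diag_matrix :: "('l \<Rightarrow> 'n) \<Rightarrow> real^'l \<Rightarrow> ('l::finite, 'n::finite) rmat" where
  "diag_matrix \<iota> d = (\<chi> i j. if j = \<iota> i then d $ i else 0)"

lemma diag_matrix_gram:
  assumes "inj \<iota>"
  shows "(diag_matrix \<iota> d ** transpose (diag_matrix \<iota> d)) $ i $ j = (if i = j then (d $ i)\<^sup>2 else 0)"
proof -
  have "diag_matrix \<iota> d $ i = d $ i *\<^sub>R axis (\<iota> i) 1" for i
    by (auto simp: diag_matrix_def axis_def vec_eq_iff)
  then show ?thesis using assms by (auto simp: gram_entry inner_axis_axis inj_eq power2_eq_square)
qed

lemma linear_diag_matrix: "linear (diag_matrix \<iota>)"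
  by (rule linearI) (auto simp: diag_matrix_def vec_eq_iff)

text \<open>Diagonalizing x x^T makes the rows of k x orthogonal. Then k x has the Gram matrix of
  the diagonal matrix of its row norms and differs from it by an orthogonal factor on the
  right.\<close>

lemma singular_values:
  fixes x :: "('l::finite, 'n::finite) rmat"
  assumes "inj (\<iota> :: 'l \<Rightarrow> 'n)"
  obtains k h d where "orthogonal_matrix k" "orthogonal_matrix h" "k ** x ** h = diag_matrix \<iota> d"
proof -
  obtain k e where k: "orthogonal_matrix k" "\<And>i. (x ** transpose x) *v (k $ i) = e i *\<^sub>R k $ i"
    using symmetric_diagonalization[OF gram_symmetric] by blast
  define y where "y = k ** x"
  define d where "d = (\<chi> i. norm (y $ i))"
  have "(y ** transpose y) $ i $ j = (if i = j then (d $ i)\<^sup>2 else 0)" for i j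
  proof (cases "i = j")
    case False
    have "y ** transpose y = k ** (x ** transpose x) ** transpose k"
      by (simp add: y_def matrix_transpose_mul matrix_mul_assoc)
    moreover have "(k ** S ** transpose k) $ i $ j = k $ i \<bullet> (S *v (k $ j))" for S :: "('l, 'l) rmat"
    proof -
      have "(k ** S ** transpose k) $ i $ j = (\<Sum>a\<in>UNIV. \<Sum>b\<in>UNIV. k $ i $ b * S $ b $ a * k $ j $ a)"
        by (simp add: matrix_matrix_mult_def transpose_def sum_distrib_right)
      also have "\<dots> = (\<Sum>b\<in>UNIV. \<Sum>a\<in>UNIV. k $ i $ b * S $ b $ a * k $ j $ a)" by (rule sum.swap)
      also have "\<dots> = k $ i \<bullet> (S *v (k $ j))"
        by (simp add: inner_vec_def matrix_vector_mult_def sum_distrib_left mult_ac)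
      finally show ?thesis .
    qed
    moreover have "k $ i \<bullet> k $ j = 0"
    proof -
      have "(k ** transpose k) $ i $ j = 0" using k(1) False by (simp add: orthogonal_matrix_def mat_def)
      then show ?thesis by (simp add: gram_entry)
    qed
    ultimately show ?thesis using k(2) False by simp
  qed (simp add: gram_entry d_def power2_norm_eq_inner)
  then have "y ** transpose y = diag_matrix \<iota> d ** transpose (diag_matrix \<iota> d)"
    by (simp add: vec_eq_iff diag_matrix_gram[OF assms])
  then obtain h where "orthogonal_matrix h" "y ** h = diag_matrix \<iota> d" by (rule same_gram_imp_orthogonal)
  then show ?thesis using that k(1) by (simp add: y_def)
qed

section \<open>Bi-invariant polynomials\<close>

definition biinv :: "nat \<Rightarrow> (('l::finite, 'n::finite) rmat \<Rightarrow> real) set" where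
  "biinv s = {f \<in> homs (2 * s). (\<forall>k x. orthogonal_matrix k \<longrightarrow> f (k ** x) = f x) \<and>
     (\<forall>h x. orthogonal_matrix h \<longrightarrow> f (x ** h) = f x)}"

lemma biinv_eq_0I:
  fixes f :: "('l::finite, 'n::finite) rmat \<Rightarrow> real"
  assumes "f \<in> biinv s" "inj (\<iota> :: 'l \<Rightarrow> 'n)" "\<And>d. f (diag_matrix \<iota> d) = 0"
  shows "f x = 0"
proof -
  obtain k h d where "orthogonal_matrix k" "orthogonal_matrix h" "k ** x ** h = diag_matrix \<iota> d"
    using singular_values[OF assms(2)] by blast
  then show ?thesis using assms(1,3) by (metis (mono_tags, lifting) biinv_def mem_Collect_eq)
qed

text \<open>A permutation of the rows is an orthogonal factor on the left; a change of signs does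
  not affect the Gram matrix and is absorbed by an orthogonal factor on the right.\<close>

lemma biinv_diag_eq:
  fixes f :: "('l::finite, 'n::finite) rmat \<Rightarrow> real"
  assumes f: "f \<in> biinv s" and "inj (\<iota> :: 'l \<Rightarrow> 'n)" and p: "p permutes UNIV"
    and d: "\<And>i. (e $ i)\<^sup>2 = (d $ p i)\<^sup>2"
  shows "f (diag_matrix \<iota> e) = f (diag_matrix \<iota> d)"
proof -
  define k :: "('l, 'l) rmat" where "k = (\<chi> i. axis (p i) 1)"
  have inj: "p i = p j \<longleftrightarrow> i = j" for i j using permutes_inj[OF p] by (simp add: inj_eq)
  have k: "orthogonal_matrix k"
    by (rule orthogonal_matrixI_rows) (auto simp: k_def inner_axis_axis inj)
  have row: "(k ** x) $ i = x $ p i" for x :: "('l, 'n) rmat" and i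
    by (simp add: k_def matrix_matrix_mult_def axis_def vec_eq_iff if_distrib[where f = "\<lambda>z. z * c" for c] cong: if_cong)
  let ?x = "k ** diag_matrix \<iota> d"
  have "(?x ** transpose ?x) $ i $ j = (diag_matrix \<iota> e ** transpose (diag_matrix \<iota> e)) $ i $ j" for i j
    using diag_matrix_gram[OF assms(2), of d "p i" "p j"] diag_matrix_gram[OF assms(2), of e i j]
    by (simp add: gram_entry row inj d)
  then have "?x ** transpose ?x = diag_matrix \<iota> e ** transpose (diag_matrix \<iota> e)" by (simp add: vec_eq_iff)
  then obtain h where "orthogonal_matrix h" "?x ** h = diag_matrix \<iota> e" by (rule same_gram_imp_orthogonal)
  then show ?thesis using f k unfolding biinv_def by (metis (mono_tags, lifting) mem_Collect_eq)
qed

section \<open>Even symmetric polynomials in the singular values\<close>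

definition monomial :: "('l \<Rightarrow> nat) \<Rightarrow> real^'l::finite \<Rightarrow> real" where
  "monomial e d = (\<Prod>i\<in>UNIV. (d $ i) ^ e i)"

text \<open>The monomial symmetric polynomial times the number of permutations that fix the
  exponents.\<close>

definition symmetrized_monomial :: "('l \<Rightarrow> nat) \<Rightarrow> real^'l::finite \<Rightarrow> real" where
  "symmetrized_monomial e d = (\<Sum>p | p permutes UNIV. \<Prod>i\<in>UNIV. (d $ p i) ^ e i)"

lemma homs_subset_span_monomials:
  "(homs k :: (real^'l::finite \<Rightarrow> real) set) \<subseteq> fun_space.span {monomial e | e. (\<Sum>i\<in>UNIV. e i) = k}"
proof -
  let ?M = "\<lambda>k. {monomial e | e. (\<Sum>i\<in>(UNIV :: 'l set). e i) = k}"
  have mult: "(\<lambda>d. d $ j * f d) \<in> fun_space.span (?M (Suc k))" if "f \<in> fun_space.span (?M k)" for f k and j :: 'l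
    using that
  proof (induction rule: span_fun_induct)
    case (base f)
    then obtain e where e: "f = monomial e" "(\<Sum>i\<in>(UNIV :: 'l set). e i) = k" by auto
    define c where "c i = (if i = j then Suc 0 else 0)" for i
    have "(\<Prod>i\<in>UNIV. (d $ i) ^ c i) = d $ j" for d :: "real^'l"
      by (simp add: c_def if_distrib[of "\<lambda>n. _ ^ n"] cong: if_cong)
    then have "(\<lambda>d. d $ j * f d) = monomial (\<lambda>i. c i + e i)"
      by (auto simp: e monomial_def power_add prod.distrib)
    moreover have "(\<Sum>i\<in>UNIV. c i + e i) = Suc k" by (simp add: sum.distrib e c_def)
    ultimately show ?case by (intro fun_space.span_base) auto
  qed (auto simp: subspace_fun_zero distrib_left mult.left_commute intro: subspace_fun_add subspace_fun_scale)
  have pow: "(\<lambda>d. (a \<bullet> d) ^ k) \<in> fun_space.span (?M k)" for a k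
  proof (induction k)
    case 0
    have "(\<lambda>d :: real^'l. (a \<bullet> d) ^ 0) = monomial (\<lambda>_. 0)" by (auto simp: monomial_def)
    then show ?case by (intro fun_space.span_base) auto
  next
    case (Suc k)
    have "(\<lambda>d. \<Sum>i\<in>UNIV. a $ i * (d $ i * (a \<bullet> d) ^ k)) \<in> fun_space.span (?M (Suc k))"
      by (intro subspace_fun_sum subspace_fun_scale fun_space.subspace_span mult Suc)
    moreover have "(\<Sum>i\<in>UNIV. a $ i * (d $ i * (a \<bullet> d) ^ k)) = (a \<bullet> d) ^ Suc k" for d
      by (simp add: inner_vec_def[of a] sum_distrib_right mult_ac)
    ultimately show ?case by simp
  qed
  show ?thesis unfolding homs_def
    by (rule fun_space.span_minimal) (use pow in auto)
qed

text \<open>Every orbit of exponents under permutation contains a partition, which bounds the number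
  of symmetrized monomials by the number of partitions.\<close>

lemma sort_exponents:
  fixes e :: "'l::{finite,linorder} \<Rightarrow> nat"
  obtains p \<kappa> where "p permutes UNIV" "\<kappa> \<in> partitions CARD('l) (\<Sum>i\<in>UNIV. e i)" "\<And>i. e (p i) = \<kappa> (rank_of i)"
proof -
  define xs where "xs = sort_key (\<lambda>i. - int (e i)) (sorted_list_of_set (UNIV :: 'l set))"
  have xs: "distinct xs" "set xs = UNIV" "sorted (map (\<lambda>i. - int (e i)) xs)" "length xs = CARD('l)"
    by (simp_all add: xs_def)
  define p where "p i = xs ! rank_of i" for i :: 'l
  define \<kappa> where "\<kappa> r = (if r < CARD('l) then e (xs ! r) else 0)" for r
  have "inj p" unfolding p_def using xs(1,4)
    by (auto intro!: injI simp: nth_eq_iff_index_eq rank_of_less_card inj_eq[OF inj_rank_of])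
  then have p: "p permutes UNIV" by (intro bij_imp_permutes) (auto simp: bij_def finite_UNIV_inj_surj)
  have anti: "\<kappa> j \<le> \<kappa> i" if "i \<le> j" for i j
    using sorted_nth_mono[OF xs(3) that] that xs(4) by (auto simp: \<kappa>_def)
  have "(\<Sum>r<CARD('l). \<kappa> r) = (\<Sum>i\<in>UNIV. e i)"
  proof -
    have "(\<Sum>i\<in>UNIV. e i) = (\<Sum>i\<in>(UNIV :: 'l set). e (p i))"
      using sum.permute[OF p, of e] by (simp add: o_def)
    also have "\<dots> = (\<Sum>i\<in>(UNIV :: 'l set). \<kappa> (rank_of i))" by (simp add: p_def \<kappa>_def rank_of_less_card)
    also have "\<dots> = (\<Sum>r\<in>range (rank_of :: 'l \<Rightarrow> nat). \<kappa> r)" by (simp add: sum.reindex[OF inj_rank_of])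
    finally show ?thesis by (simp add: range_rank_of)
  qed
  moreover have "(\<Sum>r<CARD('l). \<kappa> r) = psize \<kappa>"
    unfolding psize_def by (rule sum.mono_neutral_right) (auto simp: \<kappa>_def split: if_splits)
  ultimately have "\<kappa> \<in> partitions CARD('l) (\<Sum>i\<in>UNIV. e i)"
    using anti by (auto simp: partitions_def antimono_def \<kappa>_def)
  then show ?thesis using that p by (simp add: p_def \<kappa>_def rank_of_less_card)
qed

lemma symmetrized_monomial_permute:
  assumes "p permutes UNIV"
  shows "symmetrized_monomial (\<lambda>i. e (p i)) = symmetrized_monomial e"
proof
  fix d :: "real^'a"
  have "symmetrized_monomial (\<lambda>i. e (p i)) d = (\<Sum>q | q permutes UNIV. \<Prod>i\<in>UNIV. (d $ (q \<circ> p) i) ^ e (p i))"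
    unfolding symmetrized_monomial_def by (rule sum_permutations_compose_right[OF assms])
  also have "\<dots> = symmetrized_monomial e d"
    unfolding symmetrized_monomial_def
  proof (rule sum.cong)
    fix q
    show "(\<Prod>i\<in>UNIV. (d $ (q \<circ> p) i) ^ e (p i)) = (\<Prod>i\<in>UNIV. (d $ q i) ^ e i)"
      using prod.permute[OF assms, of "\<lambda>i. (d $ q i) ^ e i"] by (simp add: o_def)
  qed simp
  finally show "symmetrized_monomial (\<lambda>i. e (p i)) d = symmetrized_monomial e d" .
qed

text \<open>The restriction to diagonal matrices is invariant under signed permutations, so summing
  over them multiplies it by their number. The same sum turns a monomial into a multiple of a
  symmetrized monomial.\<close>

lemma biinv_diag_span:
  fixes f :: "('l::{finite,linorder}, 'n::finite) rmat \<Rightarrow> real"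
  assumes f: "f \<in> biinv s" and \<iota>: "inj (\<iota> :: 'l \<Rightarrow> 'n)"
  shows "(\<lambda>d. f (diag_matrix \<iota> d)) \<in>
    fun_space.span ((\<lambda>\<kappa>. symmetrized_monomial (\<lambda>i. 2 * \<kappa> (rank_of i))) ` partitions CARD('l) s)"
proof -
  let ?U = "fun_space.span ((\<lambda>\<kappa>. symmetrized_monomial (\<lambda>i::'l. 2 * \<kappa> (rank_of i))) ` partitions CARD('l) s)"
  let ?E = "PiE (UNIV :: 'l set) (\<lambda>_. {1, -1 :: real})"
  define avg where "avg g d = (\<Sum>p | p permutes UNIV. \<Sum>\<epsilon>\<in>?E. g (\<chi> i. \<epsilon> i * d $ p i))" for g :: "(real, 'l) vec \<Rightarrow> real" and d
  have mono: "avg (monomial e) \<in> ?U" if e: "(\<Sum>i\<in>(UNIV :: 'l set). e i) = 2 * s" for e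
  proof -
    \<comment> \<open>The sum over the signs factors into the terms 1 + (-1)^(e i), so a single odd
      exponent annihilates the monomial.\<close>
    have 1: "avg (monomial e) d = (\<Prod>i\<in>UNIV. 1 + (-1) ^ e i) * symmetrized_monomial e d" for d
    proof -
      have "(\<Sum>\<epsilon>\<in>?E. monomial e (\<chi> i. \<epsilon> i * d $ p i)) = (\<Prod>i\<in>UNIV. 1 + (-1) ^ e i) * (\<Prod>i\<in>UNIV. (d $ p i) ^ e i)" for p
      proof -
        have "(\<Prod>i\<in>UNIV. \<Sum>\<epsilon>\<in>{1, -1 :: real}. \<epsilon> ^ e i) = (\<Sum>\<epsilon>\<in>?E. \<Prod>i\<in>UNIV. \<epsilon> i ^ e i)"
          by (rule prod_sum_PiE) auto
        then show ?thesis
          by (simp add: monomial_def power_mult_distrib prod.distrib sum_distrib_right[symmetric])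
      qed
      then show ?thesis by (simp add: avg_def symmetrized_monomial_def sum_distrib_left)
    qed
    show ?thesis
    proof (cases "\<forall>i. even (e i)")
      case True
      define e' where "e' i = e i div 2" for i
      have e': "e = (\<lambda>i. 2 * e' i)" using True by (auto simp: e'_def)
      then have "(\<Sum>i\<in>UNIV. e' i) = s" using e by (simp add: sum_distrib_left[symmetric])
      obtain p \<kappa> where p: "p permutes UNIV" "\<kappa> \<in> partitions CARD('l) s" "\<And>i. e' (p i) = \<kappa> (rank_of i)"
        using sort_exponents[of e'] \<open>(\<Sum>i\<in>UNIV. e' i) = s\<close> by metis
      have "symmetrized_monomial e = symmetrized_monomial (\<lambda>i. 2 * \<kappa> (rank_of i))"
        using symmetrized_monomial_permute[OF p(1), of e] p(3) by (simp add: e')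
      then have "symmetrized_monomial e \<in> ?U" using p(2) by (intro fun_space.span_base) auto
      then show ?thesis unfolding 1[abs_def] by (intro subspace_fun_scale) auto
    next
      case False
      then obtain i where "odd (e i)" by blast
      then have z: "(\<Prod>i\<in>UNIV. 1 + (-1) ^ e i :: real) = 0" by (intro prod_zero bexI[of _ i]) auto
      show ?thesis unfolding 1[abs_def] z mult_zero_left by (rule subspace_fun_zero) simp
    qed
  qed
  have avgU: "avg g \<in> ?U" if "g \<in> fun_space.span {monomial e | e. (\<Sum>i\<in>(UNIV :: 'l set). e i) = 2 * s}" for g
    using that
  proof (induction rule: span_fun_induct)
    case zero
    have "avg (\<lambda>x. 0) = (\<lambda>d. 0)" by (simp add: avg_def fun_eq_iff)
    then show ?case by (simp only: subspace_fun_zero[OF fun_space.subspace_span])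
  next
    case (base g)
    then show ?case using mono by auto
  next
    case (add g h)
    have "avg (\<lambda>x. g x + h x) = (\<lambda>d. avg g d + avg h d)" by (auto simp: avg_def sum.distrib)
    then show ?case using subspace_fun_add[OF fun_space.subspace_span add.IH] by simp
  next
    case (scale c g)
    have "avg (\<lambda>x. c * g x) = (\<lambda>d. c * avg g d)" by (auto simp: avg_def sum_distrib_left)
    then show ?case using subspace_fun_scale[OF fun_space.subspace_span scale.IH] by simp
  qed
  let ?g = "\<lambda>d. f (diag_matrix \<iota> d)"
  have "f \<in> homs (2 * s)" using f by (simp add: biinv_def)
  then have "?g \<in> homs (2 * s)" by (rule homs_compose[OF _ linear_diag_matrix[of \<iota>]])
  then have g: "avg ?g \<in> ?U" using homs_subset_span_monomials avgU by blast
  define N where "N = real (card {p :: 'l \<Rightarrow> 'l. p permutes UNIV}) * real (card ?E)"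
  have "?E \<noteq> {}" "finite ?E" by (auto simp: PiE_eq_empty_iff intro: finite_PiE)
  moreover have "{p :: 'l \<Rightarrow> 'l. p permutes UNIV} \<noteq> {}" using permutes_id by blast
  ultimately have N: "N \<noteq> 0" by (simp add: N_def finite_permutations card_eq_0_iff)
  have "avg ?g d = N * ?g d" for d
  proof -
    have "?g (\<chi> i. \<epsilon> i * d $ p i) = ?g d" if "p permutes UNIV" "\<epsilon> \<in> ?E" for p \<epsilon>
    proof (rule biinv_diag_eq[OF f \<iota> that(1)])
      fix i
      have "\<epsilon> i \<in> {1, -1}" using that(2) by (auto simp: PiE_def)
      then show "((\<chi> i. \<epsilon> i * d $ p i) $ i)\<^sup>2 = (d $ p i)\<^sup>2" by auto
    qed
    then have "avg ?g d = (\<Sum>p :: 'l \<Rightarrow> 'l | p permutes UNIV. \<Sum>\<epsilon>\<in>?E. ?g d)"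
      unfolding avg_def by (intro sum.cong) auto
    then show ?thesis by (simp add: N_def)
  qed
  then have "?g = (\<lambda>d. inverse N * avg ?g d)" using N by auto
  then show ?thesis using subspace_fun_scale[OF fun_space.subspace_span g, of "inverse N"] by simp
qed

section \<open>Spherical elements and zonal polynomials\<close>

text \<open>The element of V_\<kappa> representing evaluation at the identity. Orthogonal
  congruences fix the identity, which is why it is orthogonally invariant.\<close>

definition sph :: "(nat \<Rightarrow> nat) \<Rightarrow> ('m::{finite,linorder}, 'm) rmat \<Rightarrow> real" where
  "sph \<kappa> = (SOME Z. Z \<in> zspace \<kappa> \<and> (\<forall>v\<in>zspace \<kappa>. gram_form TYPE('m) (psize \<kappa>) Z v = v (mat 1)))"

lemma orthogonal_imp_invertible: "orthogonal_matrix h \<Longrightarrow> invertible h" for h :: "('m::finite, 'm) rmat"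
  unfolding orthogonal_matrix_def invertible_def by blast

context
  fixes \<kappa> :: "nat \<Rightarrow> nat" and k :: nat
  assumes \<kappa>: "\<kappa> \<in> partitions CARD('m::{finite,linorder}) k"
begin

lemma sph_spec: "(sph \<kappa> :: ('m, 'm) rmat \<Rightarrow> real) \<in> zspace \<kappa> \<and>
  (\<forall>v\<in>zspace \<kappa>. gram_form TYPE('m) k (sph \<kappa>) v = (v :: ('m, 'm) rmat \<Rightarrow> real) (mat 1))"
proof -
  obtain z :: "('m, 'm) rmat \<Rightarrow> real" where z: "z \<in> zspace \<kappa>" "\<And>v. v \<in> zspace \<kappa> \<Longrightarrow> gram_form TYPE('m) k z v = v (mat 1)"
    by (rule gram_form_riesz[OF subspace_zspace zspace_hom_polys[OF \<kappa>], of "\<lambda>v. v (mat 1)"]) auto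
  then have ex: "\<exists>Z :: ('m, 'm) rmat \<Rightarrow> real. Z \<in> zspace \<kappa> \<and> (\<forall>v\<in>zspace \<kappa>. gram_form TYPE('m) k Z v = v (mat 1))"
    by blast
  show ?thesis
    unfolding sph_def partitionsD(3)[OF \<kappa>] by (rule someI_ex[OF ex])
qed

lemma sph_zspace: "(sph \<kappa> :: ('m, 'm) rmat \<Rightarrow> real) \<in> zspace \<kappa>"
  using sph_spec by blast

lemma sph_eval: "v \<in> zspace \<kappa> \<Longrightarrow> gram_form TYPE('m) k (sph \<kappa>) v = (v :: ('m, 'm) rmat \<Rightarrow> real) (mat 1)"
  using sph_spec by blast

lemma sph_hom_polys: "(sph \<kappa> :: ('m, 'm) rmat \<Rightarrow> real) \<in> hom_polys k"
  using sph_zspace zspace_hom_polys[OF \<kappa>] by blast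

lemma sph_invariant:
  fixes h :: "('m, 'm) rmat"
  assumes "orthogonal_matrix h"
  shows "act h (sph \<kappa>) = sph \<kappa>"
proof -
  let ?Z = "sph \<kappa> :: ('m, 'm) rmat \<Rightarrow> real" and ?B = "gram_form TYPE('m) k"
  have h: "invertible h" "invertible (transpose h)" "transpose h ** h = mat 1"
    using orthogonal_imp_invertible[OF assms] invertible_transpose[OF orthogonal_imp_invertible[OF assms]] assms
    by (simp_all add: orthogonal_matrix_def)
  define d where "d = (\<lambda>S. act h ?Z S - ?Z S)"
  have az: "act h ?Z \<in> zspace \<kappa>" by (rule zspace_act[OF sph_zspace h(1)])
  have dz: "d \<in> zspace \<kappa>" unfolding d_def by (rule subspace_fun_diff[OF subspace_zspace az sph_zspace])
  have hom: "act h ?Z \<in> hom_polys k" "d \<in> hom_polys k" using az dz zspace_hom_polys[OF \<kappa>] by auto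
  have "?B (act h ?Z) d = ?B ?Z (act (transpose h) d)" by (rule gram_form_adjoint[OF sph_hom_polys hom(2)])
  also have "\<dots> = act (transpose h) d (mat 1)" by (rule sph_eval[OF zspace_act[OF dz h(2)]])
  also have "\<dots> = d (mat 1)" using h(3) by (simp add: act_def)
  also have "\<dots> = ?B ?Z d" by (rule sph_eval[OF dz, symmetric])
  finally have "?B (act h ?Z) d = ?B ?Z d" .
  moreover have "?B d d = ?B (\<lambda>S. act h ?Z S + (-1) * ?Z S) d" by (simp add: d_def)
  then have "?B d d = ?B (act h ?Z) d + (-1) * ?B ?Z d"
    using gram_form_add_left[OF hom(2,1) subspace_fun_scale[OF subspace_hom_polys sph_hom_polys], of "TYPE('m)" "-1"]
      gram_form_scale_left[OF hom(2) sph_hom_polys, of "TYPE('m)" "-1"] by simp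
  ultimately have "?B d d = 0" by simp
  then have "d = (\<lambda>S. 0)" by (rule gram_form_definite[OF hom(2)])
  then show ?thesis by (simp add: d_def fun_eq_iff)
qed

text \<open>The value at the identity is the squared norm, and \<open>sph \<kappa>\<close> is
  nonzero since evaluation at the identity gives 1 on \<open>power_poly \<kappa>\<close>.\<close>

lemma sph_pos: "0 < sph \<kappa> (mat 1 :: ('m, 'm) rmat)"
proof -
  let ?Z = "sph \<kappa> :: ('m, 'm) rmat \<Rightarrow> real"
  have "gram_form TYPE('m) k ?Z ?Z = ?Z (mat 1)" by (rule sph_eval[OF sph_zspace])
  moreover have "0 \<le> gram_form TYPE('m) k ?Z ?Z"
    unfolding gram_form_def by (rule fischer_nonneg[OF pull_homs[OF sph_hom_polys]])
  moreover have "gram_form TYPE('m) k ?Z ?Z \<noteq> 0"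
  proof
    assume "gram_form TYPE('m) k ?Z ?Z = 0"
    then have "?Z = (\<lambda>S. 0)" by (rule gram_form_definite[OF sph_hom_polys])
    moreover have "gram_form TYPE('m) k ?Z (power_poly \<kappa>) = 1"
      using sph_eval[OF power_poly_in_zspace] power_poly_mat_1[OF \<kappa>] by simp
    moreover have "gram_form TYPE('m) k (\<lambda>S. 0 * ?Z S) (power_poly \<kappa>) = 0 * gram_form TYPE('m) k ?Z (power_poly \<kappa>)"
      by (rule gram_form_scale_left[OF power_poly_hom[OF \<kappa>] sph_hom_polys])
    ultimately show False by simp
  qed
  ultimately show ?thesis by linarith
qed

end

section \<open>Bi-invariant polynomials as combinations of spherical elements\<close>

lemma subspace_biinv: "fun_space.subspace (biinv s)"
  by (rule subspaceI_fun) (auto simp: biinv_def homs_zero homs_add homs_scale)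

lemma pull_biinv:
  fixes P :: "('m::finite, 'm) rmat \<Rightarrow> real"
  assumes "P \<in> hom_polys k" "\<And>h. orthogonal_matrix h \<Longrightarrow> act h P = P"
  shows "(pull P :: ('m, 'n::finite) rmat \<Rightarrow> real) \<in> biinv k"
proof -
  have "pull P (h ** x) = pull P x" if "orthogonal_matrix h" for h and x :: "('m, 'n) rmat"
    using assms(2)[OF that] by (metis pull_act)
  moreover have "pull P (x ** h) = pull P x" if "orthogonal_matrix h" for h and x :: "('m, 'n) rmat"
  proof -
    have "(x ** h) ** transpose (x ** h) = x ** (h ** transpose h) ** transpose x"
      by (simp add: matrix_transpose_mul matrix_mul_assoc)
    then show ?thesis using that by (simp add: pull_def orthogonal_matrix_def)
  qed
  ultimately show ?thesis using pull_homs[OF assms(1)] by (simp add: biinv_def)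
qed

lemma gram_form_zero: "P \<in> hom_polys k \<Longrightarrow> gram_form ty k P (\<lambda>S. 0) = 0"
  using gram_form_scale[of P k P ty 0] by simp

lemma diag_matrix_one_gram: "inj \<iota> \<Longrightarrow> diag_matrix \<iota> (\<chi> i. 1) ** transpose (diag_matrix \<iota> (\<chi> i. 1)) = mat 1"
  by (simp add: vec_eq_iff diag_matrix_gram mat_def)

lemma ex_inj_card_le:
  assumes "CARD('l::finite) \<le> CARD('n::finite)"
  obtains \<iota> :: "'l::finite \<Rightarrow> 'n::finite" where "inj \<iota>"
  using card_le_inj[of "UNIV :: 'l set" "UNIV :: 'n set"] assms by auto

lemma sph_form_nonzero:
  assumes "CARD('m::{finite,linorder}) \<le> CARD('n::finite)" "\<kappa> \<in> partitions CARD('m) k"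
  shows "gram_form TYPE('n) k (sph \<kappa> :: ('m, 'm) rmat \<Rightarrow> real) (sph \<kappa>) \<noteq> 0"
proof
  assume 0: "gram_form TYPE('n) k (sph \<kappa> :: ('m, 'm) rmat \<Rightarrow> real) (sph \<kappa>) = 0"
  obtain \<iota> :: "'m \<Rightarrow> 'n" where "inj \<iota>" using ex_inj_card_le[OF assms(1)] by blast
  have "pull (sph \<kappa>) (diag_matrix \<iota> (\<chi> i. 1) :: ('m, 'n) rmat) = 0"
    by (rule fischer_eq_0_imp[OF pull_homs[OF sph_hom_polys[OF assms(2)]]]) (use 0 in \<open>simp add: gram_form_def\<close>)
  then show False using sph_pos[OF assms(2)] by (simp add: pull_def diag_matrix_one_gram[OF \<open>inj \<iota>\<close>])
qed

lemma sph_coefficients_zero: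
  assumes "CARD('m::{finite,linorder}) \<le> CARD('n::finite)"
    and 0: "\<And>x :: ('m, 'n) rmat. (\<Sum>\<kappa>\<in>partitions CARD('m) k. c \<kappa> * pull (sph \<kappa>) x) = 0"
    and \<tau>: "\<tau> \<in> partitions CARD('m) k"
  shows "c \<tau> = 0"
proof -
  let ?P = "partitions CARD('m) k"
  let ?q = "\<lambda>\<kappa>. pull (sph \<kappa>) :: ('m, 'n) rmat \<Rightarrow> real"
  have q: "?q \<kappa> \<in> homs (2 * k)" if "\<kappa> \<in> ?P" for \<kappa> by (rule pull_homs[OF sph_hom_polys[OF that]])
  have "0 = fischer (2 * k) (?q \<tau>) (\<lambda>x. 0 * ?q \<tau> x)" by (subst fischer_scale_right[OF q[OF \<tau>] q[OF \<tau>]]) simp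
  also have "(\<lambda>x. 0 * ?q \<tau> x) = (\<lambda>x. \<Sum>\<kappa>\<in>?P. c \<kappa> * ?q \<kappa> x)" by (simp add: 0)
  also have "fischer (2 * k) (?q \<tau>) \<dots> = (\<Sum>\<kappa>\<in>?P. c \<kappa> * fischer (2 * k) (?q \<tau>) (?q \<kappa>))"
    by (subst fischer_sum_right) (auto simp: q \<tau> homs_scale fischer_scale_right)
  also have "\<dots> = (\<Sum>\<kappa>\<in>{\<tau>}. c \<kappa> * fischer (2 * k) (?q \<tau>) (?q \<kappa>))"
  proof (rule sum.mono_neutral_right)
    show "\<forall>\<kappa>\<in>?P - {\<tau>}. c \<kappa> * fischer (2 * k) (?q \<tau>) (?q \<kappa>) = 0"
    proof
      fix \<kappa> assume \<kappa>: "\<kappa> \<in> ?P - {\<tau>}"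
      then have "gram_form TYPE('n) k (sph \<tau> :: ('m, 'm) rmat \<Rightarrow> real) (sph \<kappa>) = 0"
        using zspace_orthogonal[OF \<tau>, of \<kappa>] sph_zspace[OF \<tau>] sph_zspace[of \<kappa>] by blast
      then show "c \<kappa> * fischer (2 * k) (?q \<tau>) (?q \<kappa>) = 0" by (simp add: gram_form_def)
    qed
  qed (use \<tau> partitions_finite in auto)
  finally show ?thesis using sph_form_nonzero[OF assms(1) \<tau>] by (simp add: gram_form_def)
qed

text \<open>The restrictions to diagonal matrices of the \<open>pull (sph \<kappa>)\<close> are as many as the spanning
  set of \<open>biinv_diag_span\<close> has elements, and they are linearly independent.\<close>

lemma biinv_span:
  fixes f :: "('m::{finite,linorder}, 'n::finite) rmat \<Rightarrow> real"
  assumes le: "CARD('m) \<le> CARD('n)" and f: "f \<in> biinv k"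
  obtains c where "f = (\<lambda>x. \<Sum>\<kappa>\<in>partitions CARD('m) k. c \<kappa> * pull (sph \<kappa>) x)"
proof -
  obtain \<iota> :: "'m \<Rightarrow> 'n" where \<iota>: "inj \<iota>" using ex_inj_card_le[OF le] by blast
  let ?P = "partitions CARD('m) k"
  define r :: "(('m, 'n) rmat \<Rightarrow> real) \<Rightarrow> (real, 'm) vec \<Rightarrow> real" where "r g = (\<lambda>d. g (diag_matrix \<iota> d))" for g
  let ?q = "\<lambda>\<kappa>. pull (sph \<kappa>) :: ('m, 'n) rmat \<Rightarrow> real"
  have q: "?q \<kappa> \<in> biinv k" if "\<kappa> \<in> ?P" for \<kappa>
    by (rule pull_biinv[OF sph_hom_polys[OF that] sph_invariant[OF that]])
  have fin: "finite ?P" by (rule partitions_finite)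
  have lin: "c \<kappa> = 0" if "\<And>d. (\<Sum>\<kappa>\<in>?P. c \<kappa> * r (?q \<kappa>) d) = 0" "\<kappa> \<in> ?P" for c \<kappa>
  proof (rule sph_coefficients_zero[OF le _ that(2)])
    fix x :: "('m, 'n) rmat"
    show "(\<Sum>\<kappa>\<in>?P. c \<kappa> * ?q \<kappa> x) = 0"
    proof (rule biinv_eq_0I[OF _ \<iota>])
      show "(\<lambda>x. \<Sum>\<kappa>\<in>?P. c \<kappa> * ?q \<kappa> x) \<in> biinv k"
        by (intro subspace_fun_sum subspace_fun_scale subspace_biinv q)
      show "(\<Sum>\<kappa>\<in>?P. c \<kappa> * ?q \<kappa> (diag_matrix \<iota> d)) = 0" for d using that(1)[of d] by (simp add: r_def)
    qed
  qed
  define A where "A = (\<lambda>\<kappa>. r (?q \<kappa>)) ` ?P"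
  have inj: "inj_on (\<lambda>\<kappa>. r (?q \<kappa>)) ?P"
  proof (rule inj_onI, rule ccontr)
    fix \<kappa> \<tau> assume *: "\<kappa> \<in> ?P" "\<tau> \<in> ?P" "r (?q \<kappa>) = r (?q \<tau>)" "\<kappa> \<noteq> \<tau>"
    have "(of_bool (\<kappa> = \<kappa>) - of_bool (\<kappa> = \<tau>) :: real) = 0"
    proof (rule lin[where c = "\<lambda>\<sigma>. of_bool (\<sigma> = \<kappa>) - of_bool (\<sigma> = \<tau>)", OF _ *(1)])
      fix d
      have "(\<Sum>\<sigma>\<in>?P. of_bool (\<sigma> = \<rho>) * r (?q \<sigma>) d) = r (?q \<rho>) d" if "\<rho> \<in> ?P" for \<rho>
      proof -
        have "(\<Sum>\<sigma>\<in>?P. of_bool (\<sigma> = \<rho>) * r (?q \<sigma>) d) = (\<Sum>\<sigma>\<in>{\<rho>}. r (?q \<sigma>) d)"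
          using that fin by (intro sum.mono_neutral_cong_right) auto
        then show ?thesis by simp
      qed
      then show "(\<Sum>\<sigma>\<in>?P. (of_bool (\<sigma> = \<kappa>) - of_bool (\<sigma> = \<tau>)) * r (?q \<sigma>) d) = 0"
        using * by (simp add: left_diff_distrib sum_subtractf)
    qed
    then show False using *(4) by simp
  qed
  have ind: "fun_space.independent A"
  proof (rule fun_space.independent_if_scalars_zero)
    show "finite A" using fin by (simp add: A_def)
    fix u v assume 0: "(\<Sum>v\<in>A. (\<lambda>x. u v * v x)) = 0" and "v \<in> A"
    then obtain \<kappa> where \<kappa>: "\<kappa> \<in> ?P" "v = r (?q \<kappa>)" by (auto simp: A_def)
    have "u (r (?q \<kappa>)) = 0"
    proof (rule lin[where c = "\<lambda>\<kappa>. u (r (?q \<kappa>))", OF _ \<kappa>(1)])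
      fix d
      have "(\<Sum>\<kappa>\<in>?P. u (r (?q \<kappa>)) * r (?q \<kappa>) d) = (\<Sum>v\<in>A. u v * v d)"
        unfolding A_def by (simp add: sum.reindex[OF inj])
      also have "\<dots> = 0" using fun_cong[OF 0, of d] by (simp add: sum_fun_apply)
      finally show "(\<Sum>\<kappa>\<in>?P. u (r (?q \<kappa>)) * r (?q \<kappa>) d) = 0" .
    qed
    then show "u v = 0" using \<kappa> by simp
  qed
  define B where "B = (\<lambda>\<kappa>. symmetrized_monomial (\<lambda>i::'m. 2 * \<kappa> (rank_of i))) ` ?P"
  have B: "finite B" "card B \<le> card ?P" using fin by (auto simp: B_def card_image_le)
  have rB: "r g \<in> fun_space.span B" if "g \<in> biinv k" for g
    unfolding r_def B_def by (rule biinv_diag_span[OF that \<iota>])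
  have "r f \<in> fun_space.span A"
  proof (rule ccontr)
    assume no: "r f \<notin> fun_space.span A"
    then have "fun_space.independent (insert (r f) A)" by (rule fun_space.independent_insertI[OF _ ind])
    moreover have "insert (r f) A \<subseteq> fun_space.span B" using rB f q by (auto simp: A_def)
    ultimately have "card (insert (r f) A) \<le> card B" using fun_space.independent_span_bound[OF B(1)] by blast
    moreover have "r f \<notin> A" using no fun_space.span_base by blast
    moreover have "finite A" "card A = card ?P" using fin by (auto simp: A_def card_image[OF inj])
    ultimately show False using B(2) by simp
  qed
  then obtain u where u: "r f = (\<Sum>v\<in>A. (\<lambda>x. u v * v x))"
    using fun_space.span_finite[of A] fin by (auto simp: A_def)
  define c where "c \<kappa> = u (r (?q \<kappa>))" for \<kappa>
  have rf: "r f d = (\<Sum>\<kappa>\<in>?P. c \<kappa> * r (?q \<kappa>) d)" for d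
    unfolding u by (simp add: sum_fun_apply A_def sum.reindex[OF inj] c_def)
  have "f x - (\<Sum>\<kappa>\<in>?P. c \<kappa> * ?q \<kappa> x) = 0" for x
  proof (rule biinv_eq_0I[OF _ \<iota>])
    show "(\<lambda>x. f x - (\<Sum>\<kappa>\<in>?P. c \<kappa> * ?q \<kappa> x)) \<in> biinv k"
      by (intro subspace_fun_diff subspace_fun_sum subspace_fun_scale subspace_biinv q f)
    show "f (diag_matrix \<iota> d) - (\<Sum>\<kappa>\<in>?P. c \<kappa> * ?q \<kappa> (diag_matrix \<iota> d)) = 0" for d
      using rf[of d] by (simp add: r_def)
  qed
  then show ?thesis using that by (auto simp: fun_eq_iff)
qed

lemma invariant_span:
  fixes P :: "('m::{finite,linorder}, 'm) rmat \<Rightarrow> real"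
  assumes P: "P \<in> hom_polys k" "\<And>h. orthogonal_matrix h \<Longrightarrow> act h P = P"
  obtains c where "P = (\<lambda>S. \<Sum>\<kappa>\<in>partitions CARD('m) k. c \<kappa> * sph \<kappa> S)"
proof -
  let ?P = "partitions CARD('m) k"
  obtain c where c: "(pull P :: ('m, 'm) rmat \<Rightarrow> real) = (\<lambda>x. \<Sum>\<kappa>\<in>?P. c \<kappa> * pull (sph \<kappa>) x)"
    by (rule biinv_span[OF order_refl pull_biinv[OF P]])
  have "(\<lambda>S. P S - (\<Sum>\<kappa>\<in>?P. c \<kappa> * sph \<kappa> S)) = (\<lambda>S. 0)"
  proof (rule pull_inject)
    show "(\<lambda>S. P S - (\<Sum>\<kappa>\<in>?P. c \<kappa> * sph \<kappa> S)) \<in> hom_polys k"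
      by (intro subspace_fun_diff subspace_fun_sum subspace_fun_scale subspace_hom_polys P sph_hom_polys)
    show "pull (\<lambda>S. P S - (\<Sum>\<kappa>\<in>?P. c \<kappa> * sph \<kappa> S)) x = 0" for x :: "('m, 'm) rmat"
      using fun_cong[OF c, of x] by (simp add: pull_def)
  qed
  then show ?thesis using that by (auto simp: fun_eq_iff)
qed

section \<open>Decomposition of the power of the trace\<close>

definition trace_power :: "nat \<Rightarrow> ('m::finite, 'm) rmat \<Rightarrow> real" where
  "trace_power k = on_sym (\<lambda>S. trace S ^ k)"

lemma trace_power_hom_polys: "trace_power k \<in> hom_polys k"
proof -
  have "trace S = mat 1 \<bullet> S" for S :: "('a, 'a) rmat"
    by (simp add: trace_def inner_rmat mat_def if_distrib[where f = "\<lambda>z. z * c" for c] cong: if_cong)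
  then show ?thesis unfolding trace_power_def by (intro on_sym_hom_polys) (simp add: homs_power)
qed

lemma trace_power_invariant:
  fixes h :: "('m::finite, 'm) rmat"
  assumes "orthogonal_matrix h"
  shows "act h (trace_power k) = trace_power k"
proof
  fix S :: "('m, 'm) rmat"
  have "trace (h ** S ** transpose h) = trace (transpose h ** (h ** S))"
    using trace_mul_sym[of "h ** S" "transpose h"] .
  also have "transpose h ** (h ** S) = S" using assms by (simp add: matrix_mul_assoc orthogonal_matrix_def)
  finally show "act h (trace_power k) S = trace_power k S"
    using transpose_congruence_iff[OF orthogonal_imp_invertible[OF assms], of S]
    by (simp add: act_def trace_power_def on_sym_def)
qed

lemma pull_trace_power: "pull (trace_power k) x = (x \<bullet> x) ^ k" for x :: "('m::finite, 'n::finite) rmat"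
  by (simp add: pull_def trace_power_def on_sym_def gram_symmetric trace_def gram_entry inner_vec_def[of x])

text \<open>Pairing the sum with one component isolates its squared norm, because different spaces
  are orthogonal. This is the uniqueness part of the definition of \<open>zonal\<close>.\<close>

lemma zspace_components_unique:
  fixes d :: "(nat \<Rightarrow> nat) \<Rightarrow> ('m::{finite,linorder}, 'm) rmat \<Rightarrow> real"
  assumes d: "\<And>\<tau>. \<tau> \<in> partitions CARD('m) k \<Longrightarrow> d \<tau> \<in> zspace \<tau>"
    and 0: "\<And>S. (\<Sum>\<tau>\<in>partitions CARD('m) k. d \<tau> S) = 0" and \<tau>: "\<tau> \<in> partitions CARD('m) k"
  shows "d \<tau> = (\<lambda>S. 0)"
proof -
  let ?P = "partitions CARD('m) k" and ?B = "gram_form TYPE('m) k"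
  have dh: "d \<sigma> \<in> hom_polys k" if "\<sigma> \<in> ?P" for \<sigma> using d[OF that] zspace_hom_polys[OF that] by blast
  have "0 = ?B (d \<tau>) (\<lambda>S. \<Sum>\<sigma>\<in>?P. d \<sigma> S)" by (simp add: 0 gram_form_zero[OF dh[OF \<tau>]])
  also have "\<dots> = (\<Sum>\<sigma>\<in>?P. ?B (d \<tau>) (d \<sigma>))"
    unfolding gram_form_def pull_sum by (rule fischer_sum_right) (use dh \<tau> in \<open>auto intro: pull_homs\<close>)
  also have "\<dots> = (\<Sum>\<sigma>\<in>{\<tau>}. ?B (d \<tau>) (d \<sigma>))"
  proof (rule sum.mono_neutral_right)
    show "\<forall>\<sigma>\<in>?P - {\<tau>}. ?B (d \<tau>) (d \<sigma>) = 0"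
      using zspace_orthogonal[OF \<tau>] d \<tau> by (metis DiffE singletonI)
  qed (use \<tau> partitions_finite in auto)
  finally have "?B (d \<tau>) (d \<tau>) = 0" by simp
  then show ?thesis by (rule gram_form_definite[OF dh[OF \<tau>]])
qed

text \<open>The power of the trace is orthogonally invariant, hence a combination of spherical
  elements, and the terms of this combination are the family that \<open>THE\<close> selects in
  \<open>zonal\<close>. That the factors are nonzero follows only in
  \<open>zonal_multiple_sph\<close>.\<close>

lemma zonal_sph:
  obtains c where "\<And>\<kappa>. \<kappa> \<in> partitions CARD('m) k \<Longrightarrow> zonal \<kappa> = (\<lambda>S :: ('m::{finite,linorder}, 'm) rmat. c \<kappa> * sph \<kappa> S)"
    "\<And>S :: ('m, 'm) rmat. trace_power k S = (\<Sum>\<kappa>\<in>partitions CARD('m) k. zonal \<kappa> S)"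
proof -
  let ?P = "partitions CARD('m) k"
  obtain c where c: "trace_power k = (\<lambda>S :: ('m, 'm) rmat. \<Sum>\<kappa>\<in>?P. c \<kappa> * sph \<kappa> S)"
    by (rule invariant_span[OF trace_power_hom_polys trace_power_invariant])
  define C where "C \<tau> = (if \<tau> \<in> ?P then (\<lambda>S :: ('m, 'm) rmat. c \<tau> * sph \<tau> S) else 0)" for \<tau>
  have Cz: "C \<tau> \<in> zspace \<tau>" if "\<tau> \<in> ?P" for \<tau>
    using that subspace_fun_scale[OF subspace_zspace sph_zspace[OF that], of "c \<tau>"] by (simp add: C_def)
  have sumC: "on_sym (\<lambda>S :: ('m, 'm) rmat. trace S ^ k) = (\<Sum>\<tau>\<in>?P. C \<tau>)"
    unfolding trace_power_def[symmetric] c by (auto simp: fun_eq_iff sum_fun_apply C_def)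
  have zonal: "zonal \<kappa> = C \<kappa>" if \<kappa>: "\<kappa> \<in> ?P" for \<kappa>
    unfolding zonal_def partitionsD(3)[OF \<kappa>]
  proof (rule fun_cong[where x = \<kappa>], rule the_equality)
    show "(\<forall>\<tau>\<in>?P. C \<tau> \<in> zonal_space \<tau>) \<and> (\<forall>\<tau>. \<tau> \<notin> ?P \<longrightarrow> C \<tau> = 0) \<and> on_sym (\<lambda>S. trace S ^ k) = (\<Sum>\<tau>\<in>?P. C \<tau>)"
      using Cz sumC zonal_space_eq by (auto simp: C_def)
    fix c' :: "(nat \<Rightarrow> nat) \<Rightarrow> ('m, 'm) rmat \<Rightarrow> real"
    assume c': "(\<forall>\<tau>\<in>?P. c' \<tau> \<in> zonal_space \<tau>) \<and> (\<forall>\<tau>. \<tau> \<notin> ?P \<longrightarrow> c' \<tau> = 0) \<and> on_sym (\<lambda>S. trace S ^ k) = (\<Sum>\<tau>\<in>?P. c' \<tau>)"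
    show "c' = C"
    proof
      fix \<tau>
      show "c' \<tau> = C \<tau>"
      proof (cases "\<tau> \<in> ?P")
        case True
        have "(\<lambda>S. c' \<tau> S - C \<tau> S) = (\<lambda>S. 0)"
        proof (rule zspace_components_unique[where d = "\<lambda>\<tau> S. c' \<tau> S - C \<tau> S", OF _ _ True])
          fix \<sigma> assume \<sigma>: "\<sigma> \<in> ?P"
          then have "c' \<sigma> \<in> zspace \<sigma>" using c' zonal_space_eq[OF \<sigma>] by blast
          then show "(\<lambda>S. c' \<sigma> S - C \<sigma> S) \<in> zspace \<sigma>" by (rule subspace_fun_diff[OF subspace_zspace _ Cz[OF \<sigma>]])
        next
          fix S
          have "(\<Sum>\<tau>\<in>?P. c' \<tau>) = (\<Sum>\<tau>\<in>?P. C \<tau>)" using c' sumC by simp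
          then have "(\<Sum>\<tau>\<in>?P. c' \<tau> S) = (\<Sum>\<tau>\<in>?P. C \<tau> S)" by (metis sum_fun_apply)
          then show "(\<Sum>\<tau>\<in>?P. c' \<tau> S - C \<tau> S) = 0" by (simp add: sum_subtractf)
        qed
        then show ?thesis by (simp add: fun_eq_iff)
      qed (use c' in \<open>simp add: C_def\<close>)
    qed
  qed
  show ?thesis
  proof (rule that[of c])
    show "zonal \<kappa> = (\<lambda>S :: ('m, 'm) rmat. c \<kappa> * sph \<kappa> S)" if "\<kappa> \<in> ?P" for \<kappa>
      using zonal[OF that] that by (simp add: C_def)
    show "trace_power k S = (\<Sum>\<kappa>\<in>?P. zonal \<kappa> S)" for S :: "('m, 'm) rmat"
      unfolding c using zonal by (auto simp: C_def intro!: sum.cong)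
  qed
qed

section \<open>The expectation of a generalized power of a Wishart matrix\<close>

definition onb :: "'a::euclidean_space set \<Rightarrow> 'a set" where
  "onb S = (SOME B. pairwise orthogonal B \<and> (\<forall>x\<in>B. norm x = 1) \<and> finite B \<and> card B = dim S \<and> span B = S)"

text \<open>The orthogonal projection to the complement of S.\<close>

definition resid :: "'a::euclidean_space set \<Rightarrow> 'a \<Rightarrow> 'a" where
  "resid S v = v - (\<Sum>b\<in>onb S. (v \<bullet> b) *\<^sub>R b)"

context
  fixes S :: "'a::euclidean_space set"
  assumes S: "subspace S"
begin

lemma onb: "pairwise orthogonal (onb S)" "\<forall>x\<in>onb S. norm x = 1" "finite (onb S)" "card (onb S) = dim S" "span (onb S) = S"
proof -
  obtain B where "pairwise orthogonal B" "\<And>x. x \<in> B \<Longrightarrow> norm x = 1" "independent B" "card B = dim S" "span B = S"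
    by (rule orthonormal_basis_subspace[OF S]) blast
  then have "\<exists>B. pairwise orthogonal B \<and> (\<forall>x\<in>B. norm x = 1) \<and> finite B \<and> card B = dim S \<and> span B = S"
    by (intro exI[of _ B]) (auto dest: independent_imp_finite)
  from someI_ex[OF this] show "pairwise orthogonal (onb S)" "\<forall>x\<in>onb S. norm x = 1" "finite (onb S)" "card (onb S) = dim S" "span (onb S) = S"
    unfolding onb_def by auto
qed

lemma linear_resid: "linear (resid S)"
  by (rule linearI) (auto simp: resid_def inner_add_left sum.distrib scaleR_add_left scaleR_sum_right algebra_simps)

lemma resid_orthogonal: "w \<in> S \<Longrightarrow> resid S v \<bullet> w = 0"
proof -
  assume "w \<in> S"
  then have "w \<in> span (onb S)" by (simp add: onb(5))
  then show ?thesis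
  proof (induction rule: span_induct_alt)
    case (step c b y)
    have "(\<Sum>a\<in>onb S. (v \<bullet> a) * (a \<bullet> b)) = (\<Sum>a\<in>{b}. v \<bullet> b)"
    proof (rule sum.mono_neutral_cong_right)
      show "\<forall>a\<in>onb S - {b}. (v \<bullet> a) * (a \<bullet> b) = 0"
        using pairwiseD[OF onb(1)] step(1) by (auto simp: orthogonal_def)
      have "b \<bullet> b = 1" using onb(2) step(1) by (simp add: norm_eq_1)
      then show "(v \<bullet> a) * (a \<bullet> b) = v \<bullet> b" if "a \<in> {b}" for a using that by simp
    qed (use onb(3) step(1) in auto)
    then have "resid S v \<bullet> b = 0" by (simp add: resid_def inner_diff_left inner_sum_left)
    then show ?case using step(2) by (simp add: inner_add_right)
  qed simp
qed

lemma resid_diff_in: "v - resid S v \<in> S"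
proof -
  have "(\<Sum>b\<in>onb S. (v \<bullet> b) *\<^sub>R b) \<in> span (onb S)" by (intro span_sum span_scale span_base)
  then show ?thesis by (simp add: resid_def onb(5))
qed

lemma resid_eq_0: "v \<in> S \<Longrightarrow> resid S v = 0"
proof -
  assume "v \<in> S"
  then have "resid S v \<in> S" using subspace_diff[OF S _ resid_diff_in[of v]] by fastforce
  then have "resid S v \<bullet> resid S v = 0" by (rule resid_orthogonal)
  then show ?thesis by simp
qed

lemma inner_resid: "v \<bullet> resid S w = resid S v \<bullet> resid S w"
proof -
  have "(v - resid S v) \<bullet> resid S w = 0"
    using resid_orthogonal[OF resid_diff_in] by (metis inner_commute)
  then show ?thesis by (simp add: inner_diff_left)
qed

end

text \<open>The trace of a projection is the dimension of its image; this is the source of the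
  shifts by half-integers in (n/2)_\<kappa>.\<close>

lemma resid_trace:
  fixes S :: "(real^'n::finite) set"
  assumes "subspace S"
  shows "(\<Sum>c\<in>UNIV. resid S (axis c 1) $ c) = real CARD('n) - real (dim S)"
proof -
  have "(\<Sum>c\<in>UNIV. resid S (axis c 1) $ c) = (\<Sum>c\<in>(UNIV :: 'n set). 1) - (\<Sum>c\<in>UNIV. \<Sum>b\<in>onb S. (b $ c) * (b $ c))"
    by (simp add: resid_def sum_subtractf inner_axis')
  also have "(\<Sum>c\<in>UNIV. \<Sum>b\<in>onb S. (b $ c) * (b $ c)) = (\<Sum>b\<in>onb S. b \<bullet> b)"
    by (subst sum.swap) (simp add: inner_vec_def)
  also have "\<dots> = (\<Sum>b\<in>onb S. 1)" using onb(2)[OF assms] by (intro sum.cong) (auto simp: norm_eq_1)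
  finally show ?thesis using onb(4)[OF assms] by simp
qed

section \<open>Leading minors of Gram matrices and their gradients\<close>

lemma span_image_finite:
  assumes "finite I" "v \<in> span (f ` I)"
  obtains c where "v = (\<Sum>i\<in>I. c i *\<^sub>R f i)"
proof -
  have "\<exists>c. v = (\<Sum>i\<in>I. c i *\<^sub>R f i)"
    using assms(2)
  proof (induction rule: span_induct_alt)
    case base
    show ?case by (intro exI[of _ "\<lambda>_. 0"]) simp
  next
    case (step a b y)
    then obtain i c where i: "i \<in> I" "b = f i" "y = (\<Sum>i\<in>I. c i *\<^sub>R f i)" by auto
    have "(\<Sum>j\<in>I. (if j = i then a else 0) *\<^sub>R f j) = (\<Sum>j\<in>{i}. a *\<^sub>R f j)"
      using assms(1) i by (intro sum.mono_neutral_cong_right) auto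
    then show ?case
      by (intro exI[of _ "\<lambda>j. (if j = i then a else 0) + c j"]) (simp add: i scaleR_add_left sum.distrib)
  qed
  then show ?thesis using that by blast
qed

lemma leading_minor_cong:
  fixes S S' :: "('m::{finite,linorder}, 'm) rmat"
  assumes "\<And>i k. rank_of i < j \<Longrightarrow> rank_of k < j \<Longrightarrow> S $ i $ k = S' $ i $ k"
  shows "leading_minor j S = leading_minor j S'"
  unfolding leading_minor_eq
proof (intro sum.cong refl)
  fix p assume "p \<in> {p. p permutes {i :: 'm. rank_of i < j}}"
  then have "rank_of (p i) < j" if "rank_of i < j" for i
    using permutes_in_image[of p "{i. rank_of i < j}" i] that by simp
  then show "of_int (sign p) * (\<Prod>i | rank_of i < j. S $ i $ p i) = of_int (sign p) * (\<Prod>i | rank_of i < j. S' $ i $ p i)"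
    using assms by (intro arg_cong2[where f = "(*)"] prod.cong) auto
qed

lemma leading_minor_Suc_block:
  fixes S :: "('m::{finite,linorder}, 'm) rmat"
  assumes p: "rank_of p = r" and 0: "\<And>i. rank_of i < r \<Longrightarrow> S $ p $ i = 0"
  shows "leading_minor (Suc r) S = S $ p $ p * leading_minor r S"
proof -
  let ?J = "{i :: 'm. rank_of i < r}"
  have J: "{i :: 'm. rank_of i < Suc r} = insert p ?J"
    using p inj_eq[OF inj_rank_of] by (auto simp: less_Suc_eq)
  have pJ: "p \<notin> ?J" using p by simp
  have "leading_minor (Suc r) S = (\<Sum>q | q permutes insert p ?J. of_int (sign q) * (\<Prod>i\<in>insert p ?J. S $ i $ q i))"
    by (simp add: leading_minor_eq J)
  also have "\<dots> = (\<Sum>q | q permutes ?J. of_int (sign q) * (\<Prod>i\<in>insert p ?J. S $ i $ q i))"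
  proof (rule sum.mono_neutral_right)
    show "\<forall>q\<in>{q. q permutes insert p ?J} - {q. q permutes ?J}. of_int (sign q) * (\<Prod>i\<in>insert p ?J. S $ i $ q i) = 0"
    proof
      fix q assume q: "q \<in> {q. q permutes insert p ?J} - {q. q permutes ?J}"
      have "q p \<noteq> p"
      proof
        assume "q p = p"
        then have "q permutes ?J" using q by (auto intro: permutes_superset)
        then show False using q by simp
      qed
      moreover have "q p \<in> insert p ?J" using q permutes_in_image[of q "insert p ?J" p] by blast
      ultimately have "S $ p $ q p = 0" using 0 by simp
      then have "(\<Prod>i\<in>insert p ?J. S $ i $ q i) = 0" by (intro prod_zero bexI[of _ p]) auto
      then show "of_int (sign q) * (\<Prod>i\<in>insert p ?J. S $ i $ q i) = 0" by simp
    qed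
  qed (auto intro: permutes_subset finite_permutations)
  also have "\<dots> = S $ p $ p * leading_minor r S"
    unfolding leading_minor_eq sum_distrib_left
  proof (intro sum.cong refl)
    fix q assume "q \<in> {q. q permutes ?J}"
    then have "q p = p" using pJ by (auto simp: permutes_not_in)
    then show "of_int (sign q) * (\<Prod>i\<in>insert p ?J. S $ i $ q i) = S $ p $ p * (of_int (sign q) * (\<Prod>i\<in>?J. S $ i $ q i))"
      using pJ by simp
  qed
  finally show ?thesis .
qed

definition gram_minor :: "nat \<Rightarrow> ('m::{finite,linorder}, 'n::finite) rmat \<Rightarrow> real" where
  "gram_minor j x = leading_minor j (x ** transpose x)"

definition row_space :: "nat \<Rightarrow> ('m::{finite,linorder}, 'n::finite) rmat \<Rightarrow> (real, 'n) vec set" where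
  "row_space r x = span ((\<lambda>i. x $ i) ` {i. rank_of i < r})"

lemma subspace_row_space: "subspace (row_space r x)"
  by (simp add: row_space_def)

lemma gram_minor_0: "gram_minor 0 x = 1"
  by (simp add: gram_minor_def leading_minor_eq sign_id)

lemma gram_minor_homs:
  "j \<le> CARD('m::{finite,linorder}) \<Longrightarrow> (gram_minor j :: ('m, 'n::finite) rmat \<Rightarrow> real) \<in> homs (2 * j)"
  unfolding gram_minor_def[abs_def] by (rule homs_gram[OF leading_minor_homs])

lemma gram_minor_polys:
  "j \<le> CARD('m::{finite,linorder}) \<Longrightarrow> (gram_minor j :: ('m, 'n::finite) rmat \<Rightarrow> real) \<in> polys"
  by (rule homs_subset_polys[OF gram_minor_homs])

lemma gram_minor_cong: "(\<And>i. rank_of i < j \<Longrightarrow> x $ i = y $ i) \<Longrightarrow> gram_minor j x = gram_minor j y"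
  unfolding gram_minor_def by (rule leading_minor_cong) (simp add: gram_entry)

text \<open>Base times height: subtracting from row p its projection to the span of the earlier rows
  is a unipotent lower triangular operation. It preserves all leading minors and makes the relevant
  block of the Gram matrix block diagonal.\<close>

lemma gram_minor_Suc:
  fixes x :: "('m::{finite,linorder}, 'n::finite) rmat"
  assumes p: "rank_of p = r"
  shows "gram_minor (Suc r) x = gram_minor r x * (resid (row_space r x) (x $ p) \<bullet> resid (row_space r x) (x $ p))"
proof -
  let ?Q = "resid (row_space r x)"
  let ?I = "{i :: 'm. rank_of i < r}"
  note sub = subspace_row_space[of r x]
  obtain c where c: "x $ p - ?Q (x $ p) = (\<Sum>i\<in>?I. c i *\<^sub>R x $ i)"
    using span_image_finite[of ?I "x $ p - ?Q (x $ p)" "\<lambda>i. x $ i"] resid_diff_in[OF sub, of "x $ p"]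
    unfolding row_space_def by auto
  define T :: "('m, 'm) rmat" where "T = (\<chi> i j. if i = j then 1 else if i = p \<and> rank_of j < r then - c j else 0)"
  have T: "lower T" "\<And>i. T $ i $ i = 1"
    using p by (auto simp: T_def lower_def) (metis order_less_asym rank_of_less_iff)
  define y where "y = T ** x"
  have yp: "y $ p = ?Q (x $ p)"
  proof -
    have "y $ p = (\<Sum>j\<in>UNIV. T $ p $ j *\<^sub>R x $ j)"
      by (simp add: y_def vec_eq_iff matrix_matrix_mult_def)
    also have "\<dots> = (\<Sum>j\<in>insert p ?I. T $ p $ j *\<^sub>R x $ j)"
      by (rule sum.mono_neutral_right) (auto simp: T_def)
    also have "\<dots> = x $ p + (\<Sum>j\<in>?I. T $ p $ j *\<^sub>R x $ j)" using p by (simp add: T_def)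
    also have "(\<Sum>j\<in>?I. T $ p $ j *\<^sub>R x $ j) = (\<Sum>j\<in>?I. - (c j *\<^sub>R x $ j))"
      using p by (intro sum.cong) (auto simp: T_def)
    also have "\<dots> = - (x $ p - ?Q (x $ p))" unfolding c by (simp add: sum_negf)
    finally show ?thesis by simp
  qed
  have yi: "y $ i = x $ i" if "i \<noteq> p" for i
  proof -
    have "y $ i = (\<Sum>j\<in>UNIV. T $ i $ j *\<^sub>R x $ j)"
      by (simp add: y_def vec_eq_iff matrix_matrix_mult_def)
    also have "\<dots> = (\<Sum>j\<in>{i}. T $ i $ j *\<^sub>R x $ j)"
      using that by (intro sum.mono_neutral_right) (auto simp: T_def)
    finally show ?thesis by (simp add: T)
  qed
  have "gram_minor j y = gram_minor j x" for j
  proof -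
    have "y ** transpose y = T ** (x ** transpose x) ** transpose T"
      by (simp add: y_def matrix_transpose_mul matrix_mul_assoc)
    then show ?thesis using leading_minor_congruence[OF T(1)] by (simp add: gram_minor_def T)
  qed
  then have "gram_minor (Suc r) x = leading_minor (Suc r) (y ** transpose y)" by (simp add: gram_minor_def)
  also have "\<dots> = (y ** transpose y) $ p $ p * leading_minor r (y ** transpose y)"
  proof (rule leading_minor_Suc_block[OF p])
    fix i :: 'm assume i: "rank_of i < r"
    then have "x $ i \<in> row_space r x" unfolding row_space_def by (intro span_base) auto
    moreover have "i \<noteq> p" using i p by auto
    ultimately show "(y ** transpose y) $ p $ i = 0"
      using resid_orthogonal[OF sub] by (simp add: gram_entry yp yi)
  qed
  also have "leading_minor r (y ** transpose y) = gram_minor r x"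
    using \<open>\<And>j. gram_minor j y = gram_minor j x\<close> by (simp add: gram_minor_def)
  finally show ?thesis by (simp add: gram_entry yp mult.commute)
qed

text \<open>By base times height a nonzero minor forces every further row to have a nonzero
  residual, so each row raises the dimension by 1.\<close>

lemma dim_row_space:
  fixes x :: "('m::{finite,linorder}, 'n::finite) rmat"
  assumes "r \<le> CARD('m)" "gram_minor r x \<noteq> 0"
  shows "dim (row_space r x) = r"
  using assms
proof (induction r)
  case 0
  show ?case by (simp add: row_space_def)
next
  case (Suc r)
  obtain p :: 'm where p: "rank_of p = r" using Suc.prems ex_rank_of[of r] by (metis Suc_le_lessD)
  have "gram_minor r x \<noteq> 0" "resid (row_space r x) (x $ p) \<noteq> 0"
    using Suc.prems(2) by (auto simp: gram_minor_Suc[OF p])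
  then have 1: "dim (row_space r x) = r" "x $ p \<notin> row_space r x"
    using Suc resid_eq_0[OF subspace_row_space] by auto
  have "{i :: 'm. rank_of i < Suc r} = insert p {i. rank_of i < r}"
    using p inj_eq[OF inj_rank_of] by (auto simp: less_Suc_eq)
  then have "dim (row_space (Suc r) x) = dim (insert (x $ p) ((\<lambda>i. x $ i) ` {i. rank_of i < r}))"
    by (simp add: row_space_def)
  also have "\<dots> = Suc r" using 1 by (simp add: dim_insert row_space_def)
  finally show ?case .
qed

abbreviation entry_dir :: "'m \<Rightarrow> 'n \<Rightarrow> ('m::finite, 'n::finite) rmat" where
  "entry_dir p c \<equiv> axis p (axis c 1)"

lemma entry_dir_row: "(x + t *\<^sub>R entry_dir p c) $ i = (if i = p then x $ p + t *\<^sub>R axis c 1 else x $ i)"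
  by (auto simp: axis_def)

lemma entry_dir_inner: "entry_dir p c \<bullet> x = x $ p $ c"
  by (simp add: inner_axis')

lemma row_space_cong: "(\<And>i. rank_of i < r \<Longrightarrow> x $ i = y $ i) \<Longrightarrow> row_space r x = row_space r y"
  unfolding row_space_def by (intro arg_cong[where f = span] image_cong) auto

lemma gram_minor_dir_0:
  assumes "j \<le> rank_of p"
  shows "has_dir_deriv (entry_dir p c) (gram_minor j) (\<lambda>x. 0)"
proof -
  have "gram_minor j (x + t *\<^sub>R entry_dir p c) = gram_minor j x" for x t
    by (rule gram_minor_cong) (use assms in \<open>auto simp: axis_def\<close>)
  then show ?thesis by (simp add: has_dir_deriv_def)
qed

context
  fixes p :: "'m::{finite,linorder}" and r :: nat
  assumes p: "rank_of p = r"
begin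

text \<open>Half the gradient of \<open>gram_minor (Suc r)\<close> with respect to row p, the last
  row on which this minor depends.\<close>

definition minor_grad :: "'n \<Rightarrow> ('m, 'n::finite) rmat \<Rightarrow> real" where
  "minor_grad c x = gram_minor r x * resid (row_space r x) (x $ p) $ c"

lemma entry_dir_shift:
  fixes x :: "('m, 'n::finite) rmat"
  shows "gram_minor r (x + t *\<^sub>R entry_dir p c) = gram_minor r x"
    "row_space r (x + t *\<^sub>R entry_dir p c) = row_space r x"
    "resid (row_space r x) ((x + t *\<^sub>R entry_dir p c) $ p) = resid (row_space r x) (x $ p) + t *\<^sub>R resid (row_space r x) (axis c 1)"
proof -
  show "gram_minor r (x + t *\<^sub>R entry_dir p c) = gram_minor r x"
    by (rule gram_minor_cong) (use p in \<open>auto simp: axis_def\<close>)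
  show "row_space r (x + t *\<^sub>R entry_dir p c) = row_space r x"
    by (rule row_space_cong) (use p in \<open>auto simp: axis_def\<close>)
  have "linear (resid (row_space r x))" by (rule linear_resid[OF subspace_row_space])
  then show "resid (row_space r x) ((x + t *\<^sub>R entry_dir p c) $ p) = resid (row_space r x) (x $ p) + t *\<^sub>R resid (row_space r x) (axis c 1)"
    by (simp only: entry_dir_row simp_thms if_True linear_add linear_cmul)
qed

lemma gram_minor_dir:
  "has_dir_deriv (entry_dir p c) (gram_minor (Suc r)) (\<lambda>x :: ('m, 'n::finite) rmat. 2 * minor_grad c x)"
  unfolding has_dir_deriv_def
proof
  fix x :: "('m, 'n) rmat"
  let ?Q = "resid (row_space r x)"
  have "gram_minor (Suc r) (x + t *\<^sub>R entry_dir p c) =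
    gram_minor r x * (?Q (x $ p) \<bullet> ?Q (x $ p) + 2 * t * (?Q (x $ p) \<bullet> ?Q (axis c 1)) + t\<^sup>2 * (?Q (axis c 1) \<bullet> ?Q (axis c 1)))" for t
    unfolding gram_minor_Suc[OF p] entry_dir_shift
    by (simp add: inner_add_left inner_add_right inner_commute[of "?Q (axis c 1)" "?Q (x $ p)"] power2_eq_square distrib_left mult.assoc)
  moreover have "?Q (x $ p) \<bullet> ?Q (axis c 1) = ?Q (x $ p) $ c"
    using inner_resid[OF subspace_row_space, of "axis c 1" r x "x $ p"] by (simp add: inner_axis' inner_commute)
  ultimately have "gram_minor (Suc r) (x + t *\<^sub>R entry_dir p c) =
    gram_minor r x * (?Q (x $ p) \<bullet> ?Q (x $ p) + 2 * t * (?Q (x $ p) $ c) + t\<^sup>2 * (?Q (axis c 1) \<bullet> ?Q (axis c 1)))" for t by simp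
  moreover have "((\<lambda>t. gram_minor r x * (?Q (x $ p) \<bullet> ?Q (x $ p) + 2 * t * (?Q (x $ p) $ c) + t\<^sup>2 * (?Q (axis c 1) \<bullet> ?Q (axis c 1)))) has_real_derivative
    2 * minor_grad c x) (at 0)"
    unfolding minor_grad_def by (auto intro!: derivative_eq_intros)
  ultimately show "((\<lambda>t. gram_minor (Suc r) (x + t *\<^sub>R entry_dir p c)) has_real_derivative 2 * minor_grad c x) (at 0)"
    by simp
qed

lemma minor_grad_dir:
  "has_dir_deriv (entry_dir p c) (minor_grad c) (\<lambda>x :: ('m, 'n::finite) rmat. gram_minor r x * resid (row_space r x) (axis c 1) $ c)"
  unfolding has_dir_deriv_def
proof
  fix x :: "('m, 'n) rmat"
  let ?Q = "resid (row_space r x)"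
  have "minor_grad c (x + t *\<^sub>R entry_dir p c) = gram_minor r x * (?Q (x $ p) $ c + t * ?Q (axis c 1) $ c)" for t
    unfolding minor_grad_def entry_dir_shift by simp
  moreover have "((\<lambda>t. gram_minor r x * (?Q (x $ p) $ c + t * ?Q (axis c 1) $ c)) has_real_derivative gram_minor r x * ?Q (axis c 1) $ c) (at 0)"
    by (auto intro!: derivative_eq_intros)
  ultimately show "((\<lambda>t. minor_grad c (x + t *\<^sub>R entry_dir p c)) has_real_derivative gram_minor r x * ?Q (axis c 1) $ c) (at 0)"
    by simp
qed

text \<open>These are Euler's identity, the squared length and the divergence of the field
  \<open>minor_grad\<close> in the entries of row p.\<close>

lemma minor_grad_sums:
  fixes x :: "('m, 'n::finite) rmat"
  shows "(\<Sum>c\<in>UNIV. x $ p $ c * minor_grad c x) = gram_minor (Suc r) x"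
    and "(\<Sum>c\<in>UNIV. minor_grad c x * minor_grad c x) = gram_minor r x * gram_minor (Suc r) x"
    and "(\<Sum>c\<in>UNIV. gram_minor r x * resid (row_space r x) (axis c 1) $ c) = (real CARD('n) - real r) * gram_minor r x"
proof -
  let ?Q = "resid (row_space r x)"
  note sub = subspace_row_space[of r x]
  have "(\<Sum>c\<in>UNIV. x $ p $ c * minor_grad c x) = gram_minor r x * (x $ p \<bullet> ?Q (x $ p))"
    by (simp add: minor_grad_def inner_vec_def sum_distrib_left mult_ac)
  then show "(\<Sum>c\<in>UNIV. x $ p $ c * minor_grad c x) = gram_minor (Suc r) x"
    by (simp add: gram_minor_Suc[OF p] inner_resid[OF sub, of "x $ p"])
  have "(\<Sum>c\<in>UNIV. minor_grad c x * minor_grad c x) = gram_minor r x * (gram_minor r x * (?Q (x $ p) \<bullet> ?Q (x $ p)))"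
    by (simp add: minor_grad_def inner_vec_def sum_distrib_left mult_ac)
  then show "(\<Sum>c\<in>UNIV. minor_grad c x * minor_grad c x) = gram_minor r x * gram_minor (Suc r) x"
    by (simp add: gram_minor_Suc[OF p])
  \<comment> \<open>If the minor is 0, both sides vanish; otherwise the earlier rows span a space of
    dimension r and the trace is n - r.\<close>
  have "r \<le> CARD('m)" using rank_of_less_card[of p] p by simp
  then show "(\<Sum>c\<in>UNIV. gram_minor r x * ?Q (axis c 1) $ c) = (real CARD('n) - real r) * gram_minor r x"
    using dim_row_space[of r x] resid_trace[OF sub]
    by (cases "gram_minor r x = 0") (simp_all add: sum_distrib_left[symmetric])
qed

end

section \<open>Integrating out one row of a Gaussian matrix\<close>

locale gaussian_matrix = gaussian M \<zeta> for M :: "'w measure" and \<zeta> :: "'w \<Rightarrow> ('m::{finite,linorder}, 'n::finite) rmat"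
begin

text \<open>Integration by parts in row p for the field \<open>minor_grad\<close> times A q^e, where
  q is the minor: Euler's identity produces q^(e+1), the divergence of the field n - r, and the
  derivative of q^e the term 2 e.\<close>

lemma E_gram_minor_Suc_power:
  fixes p :: 'm
  assumes p: "rank_of p = r" and A: "A \<in> polys" "\<And>c. has_dir_deriv (entry_dir p c) A (\<lambda>x. 0)"
  shows "E (\<lambda>x. A x * gram_minor (Suc r) x ^ Suc e) =
    (real CARD('n) - real r + 2 * real e) * E (\<lambda>x. (A x * gram_minor r x) * gram_minor (Suc r) x ^ e)"
proof -
  let ?q = "gram_minor (Suc r) :: ('m, 'n) rmat \<Rightarrow> real" and ?d = "gram_minor r :: ('m, 'n) rmat \<Rightarrow> real" and ?y = "minor_grad p r :: 'n \<Rightarrow> ('m, 'n) rmat \<Rightarrow> real"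
  let ?z = "\<lambda>c x :: ('m, 'n) rmat. gram_minor r x * resid (row_space r x) (axis c 1) $ c"
  have r: "Suc r \<le> CARD('m)" using rank_of_less_card[of p] p by simp
  have q: "?q \<in> polys" "?d \<in> polys" using r by (simp_all add: gram_minor_polys)
  \<comment> \<open>The formula of \<open>minor_grad\<close> contains a projection that depends on
    x; being the derivative of a polynomial, it is a polynomial all the same.\<close>
  have "(\<lambda>x. 2 * ?y c x) \<in> polys" for c by (rule dir_deriv_polys[OF q(1) gram_minor_dir[OF p]])
  then have "(\<lambda>x. (1/2) * (2 * ?y c x)) \<in> polys" for c by (rule polys_scale)
  then have y: "?y c \<in> polys" for c by simp
  have z: "?z c \<in> polys" for c by (rule dir_deriv_polys[OF y minor_grad_dir[OF p]])
  note P = polys_mult polys_pow polys_scale polys_add A(1) q y z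
  define G where "G c x = ?y c x * (A x * ?q x ^ e)" for c x
  define G' where "G' c x = ?z c x * (A x * ?q x ^ e) + ?y c x * (0 * ?q x ^ e + A x * (e * ?q x ^ (e - 1) * (2 * ?y c x)))" for c x
  have G: "G c \<in> polys" for c unfolding G_def by (intro P)
  have dG: "has_dir_deriv (entry_dir p c) (G c) (G' c)" for c
    unfolding G_def G'_def
    by (intro has_dir_deriv_mult minor_grad_dir[OF p] A(2) has_dir_deriv_power gram_minor_dir[OF p])
  have "E (\<lambda>x. A x * ?q x ^ Suc e) = E (\<lambda>x. \<Sum>c\<in>UNIV. (entry_dir p c \<bullet> x) * G c x)"
  proof -
    have "A x * ?q x ^ Suc e = (\<Sum>c\<in>UNIV. (entry_dir p c \<bullet> x) * G c x)" for x
    proof -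
      have "(\<Sum>c\<in>UNIV. (entry_dir p c \<bullet> x) * G c x) = (\<Sum>c\<in>UNIV. x $ p $ c * ?y c x) * (A x * ?q x ^ e)"
        by (simp only: G_def entry_dir_inner sum_distrib_right mult.assoc)
      then show ?thesis by (simp add: minor_grad_sums[OF p] mult_ac)
    qed
    then show ?thesis by simp
  qed
  also have "\<dots> = (\<Sum>c\<in>UNIV. E (\<lambda>x. (entry_dir p c \<bullet> x) * G c x))"
    by (rule E_sum) (intro polys_mult polys_linear G)
  also have "\<dots> = (\<Sum>c\<in>UNIV. E (G' c))"
    by (intro sum.cong refl integration_by_parts[OF G dG])
  also have "\<dots> = E (\<lambda>x. \<Sum>c\<in>UNIV. G' c x)"
    by (rule E_sum[symmetric]) (rule dir_deriv_polys[OF G dG])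
  also have "(\<lambda>x. \<Sum>c\<in>UNIV. G' c x) = (\<lambda>x. (real CARD('n) - real r + 2 * real e) * ((A x * ?d x) * ?q x ^ e))"
  proof
    fix x
    have "(\<Sum>c\<in>UNIV. G' c x) = (\<Sum>c\<in>UNIV. ?z c x) * (A x * ?q x ^ e) + (\<Sum>c\<in>UNIV. ?y c x * ?y c x) * (2 * e * A x * ?q x ^ (e - 1))"
      unfolding G'_def sum_distrib_right sum.distrib[symmetric] by (rule sum.cong) (simp_all add: algebra_simps)
    also have "\<dots> = (real CARD('n) - real r + 2 * real e) * ((A x * ?d x) * ?q x ^ e)"
      unfolding minor_grad_sums[OF p] by (cases e) (simp_all add: algebra_simps)
    finally show "(\<Sum>c\<in>UNIV. G' c x) = (real CARD('n) - real r + 2 * real e) * ((A x * ?d x) * ?q x ^ e)" .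
  qed
  finally show ?thesis by (simp only: E_scale)
qed

text \<open>Each step lowers the exponent by 1 and moves one factor \<open>gram_minor r\<close> into
  A; the factors n - r + 2 j for j < e multiply to 2^e ((n - r)/2)_e.\<close>

lemma E_gram_minor_power:
  fixes p :: 'm
  assumes p: "rank_of p = r" and "A \<in> polys" "\<And>c. has_dir_deriv (entry_dir p c) A (\<lambda>x. 0)"
  shows "E (\<lambda>x. A x * gram_minor (Suc r) x ^ e) =
    2 ^ e * pochhammer ((real CARD('n) - real r) / 2) e * E (\<lambda>x. A x * gram_minor r x ^ e)"
  using assms(2,3)
proof (induction e arbitrary: A)
  case (Suc e)
  have r: "r \<le> CARD('m)" using rank_of_less_card[of p] p by simp
  have "E (\<lambda>x. A x * gram_minor (Suc r) x ^ Suc e) =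
    (real CARD('n) - real r + 2 * real e) * E (\<lambda>x. (A x * gram_minor r x) * gram_minor (Suc r) x ^ e)"
    by (rule E_gram_minor_Suc_power[OF p Suc.prems])
  also have "E (\<lambda>x. (A x * gram_minor r x) * gram_minor (Suc r) x ^ e) =
    2 ^ e * pochhammer ((real CARD('n) - real r) / 2) e * E (\<lambda>x. (A x * gram_minor r x) * gram_minor r x ^ e)"
  proof (rule Suc.IH)
    show "(\<lambda>x. A x * gram_minor r x) \<in> polys" by (intro polys_mult Suc.prems gram_minor_polys r)
    show "has_dir_deriv (entry_dir p c) (\<lambda>x. A x * gram_minor r x) (\<lambda>x. 0)" for c
      using has_dir_deriv_mult[OF Suc.prems(2) gram_minor_dir_0[of r p c]] p by simp
  qed
  finally show ?case by (simp add: pochhammer_Suc mult_ac field_simps)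
qed simp

lemma has_dir_deriv_prod_0:
  assumes "finite I" "\<And>i. i \<in> I \<Longrightarrow> has_dir_deriv a (f i) (\<lambda>x. 0)"
  shows "has_dir_deriv a (\<lambda>x. \<Prod>i\<in>I. f i x) (\<lambda>x. 0)"
  using assms
proof (induction I rule: finite_induct)
  case (insert i I)
  then show ?case using has_dir_deriv_mult[of a "f i" "\<lambda>x. 0" "\<lambda>x. \<Prod>i\<in>I. f i x" "\<lambda>x. 0"] by simp
qed (simp add: has_dir_deriv_def)

lemma E_power_poly:
  assumes \<kappa>: "\<kappa> \<in> partitions CARD('m) k"
  shows "E (pull (power_poly \<kappa>)) = 2 ^ k * gen_pochhammer CARD('m) (real CARD('n) / 2) \<kappa>"
proof -
  \<comment> \<open>\<open>A r\<close> holds the minors up to order r with their final exponents.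
    Absorbing the minor of order r + 1 raises its exponent from \<open>\<kappa> (Suc r)\<close> to
    \<open>\<kappa> r\<close>, the exponent with which it is then exchanged for the minor of order
    r.\<close>
  define A where "A r x = (\<Prod>j = 1..r. gram_minor j x ^ (\<kappa> (j - 1) - \<kappa> j))" for r and x :: "('m, 'n) rmat"
  have main: "r \<le> CARD('m) \<Longrightarrow> E (\<lambda>x. A r x * gram_minor r x ^ \<kappa> r) = (\<Prod>i<r. 2 ^ \<kappa> i * pochhammer ((real CARD('n) - real i) / 2) (\<kappa> i))" for r
  proof (induction r)
    case 0
    show ?case by (simp add: A_def gram_minor_0 E_const)
  next
    case (Suc r)
    obtain p :: 'm where p: "rank_of p = r" using Suc.prems ex_rank_of[of r] by (metis Suc_le_lessD)
    have "A (Suc r) x * gram_minor (Suc r) x ^ \<kappa> (Suc r) = A r x * gram_minor (Suc r) x ^ \<kappa> r" for x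
      using partitionsD(1)[OF \<kappa>, of r "Suc r"] by (simp add: A_def power_add[symmetric])
    then have "E (\<lambda>x. A (Suc r) x * gram_minor (Suc r) x ^ \<kappa> (Suc r)) = E (\<lambda>x. A r x * gram_minor (Suc r) x ^ \<kappa> r)" by simp
    also have "\<dots> = 2 ^ \<kappa> r * pochhammer ((real CARD('n) - real r) / 2) (\<kappa> r) * E (\<lambda>x. A r x * gram_minor r x ^ \<kappa> r)"
    proof (rule E_gram_minor_power[OF p])
      show "A r \<in> polys" unfolding A_def[abs_def] using Suc.prems
        by (intro polys_prod polys_pow gram_minor_polys) auto
      show "has_dir_deriv (entry_dir p c) (A r) (\<lambda>x. 0)" for c
        unfolding A_def[abs_def]
      proof (rule has_dir_deriv_prod_0)
        fix j assume "j \<in> {1..r}"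
        then show "has_dir_deriv (entry_dir p c) (\<lambda>x. gram_minor j x ^ (\<kappa> (j - 1) - \<kappa> j)) (\<lambda>x. 0)"
          using has_dir_deriv_power[OF gram_minor_dir_0[of j p c], of "\<kappa> (j - 1) - \<kappa> j"] p by simp
      qed simp
    qed
    finally show ?case using Suc by (simp add: mult_ac)
  qed
  have "pull (power_poly \<kappa>) = (\<lambda>x. A CARD('m) x * gram_minor CARD('m) x ^ \<kappa> CARD('m))"
    using partitionsD(2)[OF \<kappa>, of "CARD('m)"]
    by (simp add: fun_eq_iff pull_def power_poly_def on_sym_def gram_symmetric A_def gram_minor_def)
  then have "E (pull (power_poly \<kappa>)) = (\<Prod>i<CARD('m). 2 ^ \<kappa> i * pochhammer ((real CARD('n) - real i) / 2) (\<kappa> i))"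
    using main[of "CARD('m)"] by simp
  also have "\<dots> = 2 ^ k * (\<Prod>i<CARD('m). pochhammer ((real CARD('n) - real i) / 2) (\<kappa> i))"
    using partitionsD(4)[OF \<kappa>] by (simp add: prod.distrib power_sum[symmetric])
  also have "(\<Prod>i<CARD('m). pochhammer ((real CARD('n) - real i) / 2) (\<kappa> i)) = gen_pochhammer CARD('m) (real CARD('n) / 2) \<kappa>"
    unfolding gen_pochhammer_def
    by (rule prod.reindex_bij_witness[of _ "\<lambda>j. j - 1" "\<lambda>i. i + 1"]) (auto simp: diff_divide_distrib)
  finally show ?thesis .
qed

end

section \<open>Zonal polynomials of Wishart matrices\<close>

text \<open>The expectation of a power of a linear form depends only on the norm of the form;
  applied to an orthogonal matrix this is rotation invariance.\<close>

lemma (in gaussian) E_linear_cong: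
  assumes "linear g" "linear g'" "\<And>x y. g x \<bullet> y = x \<bullet> h y" "\<And>x y. g' x \<bullet> y = x \<bullet> h' y"
    and n: "\<And>a. norm (h a) = norm (h' a)" and "f \<in> polys"
  shows "E (\<lambda>x. f (g x)) = E (\<lambda>x. f (g' x))"
  using assms(6)
proof (induction rule: polys_induct)
  case (power a k)
  have "a \<bullet> g x = h a \<bullet> x" "a \<bullet> g' x = h' a \<bullet> x" for x using assms(3,4) by (metis inner_commute)+
  then show ?case using n by (simp add: E_power)
next
  case (add f f')
  then show ?case using assms(1,2) by (simp add: E_add polys_compose)
qed (simp_all add: E_scale)

lemma orthogonal_matrix_norm:
  fixes a :: "('m::finite, 'n::finite) rmat"
  assumes "orthogonal_matrix h"
  shows "norm (transpose h ** a) = norm a"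
proof -
  have "(transpose h ** a) \<bullet> (transpose h ** a) = a \<bullet> ((h ** transpose h) ** a)"
    by (simp add: inner_matrix_mult_left matrix_mul_assoc)
  then show ?thesis using assms by (simp add: norm_eq_sqrt_inner orthogonal_matrix_def)
qed

lemma inner_self_homs: "(\<lambda>x. x \<bullet> x) \<in> homs 2"
proof -
  have "(\<lambda>x. \<Sum>b\<in>Basis. (b \<bullet> x) * (b \<bullet> x)) \<in> homs (1 + 1)"
    by (intro homs_sum homs_mult homs_linear)
  also have "(\<lambda>x :: 'a. \<Sum>b\<in>Basis. (b \<bullet> x) * (b \<bullet> x)) = (\<lambda>x. x \<bullet> x)"
    by (intro ext, subst (3) euclidean_inner) (simp add: inner_commute)
  finally show ?thesis by (simp add: numeral_2_eq_2)
qed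

lemma inner_self_power_homs: "(\<lambda>x. (x \<bullet> x) ^ k) \<in> homs (2 * k)"
  using homs_pow[OF inner_self_homs, of k] by (simp add: mult.commute)

lemma norm_power_even: "norm a ^ (2 * k) = (a \<bullet> a) ^ k"
  by (simp add: power_mult power2_norm_eq_inner)

text \<open>On a power (a . x)^(2k) both sides are the moment times |a|^(2k).\<close>

lemma (in gaussian) E_eq_fischer:
  assumes "f \<in> homs (2 * k)"
  shows "E f = gauss_moment (2 * k) * fischer (2 * k) (\<lambda>x. (x \<bullet> x) ^ k) f"
proof -
  obtain A \<alpha> where A: "finite A" "f = (\<lambda>x. \<Sum>a\<in>(A :: 'a set). \<alpha> a * (a \<bullet> x) ^ (2 * k))"
    using homs_repr[OF assms] by blast
  have "fischer (2 * k) f (\<lambda>x. (x \<bullet> x) ^ k) = (\<Sum>a\<in>A. \<alpha> a * (a \<bullet> a) ^ k)"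
    by (rule fischer_eq[OF A inner_self_power_homs])
  then have "fischer (2 * k) (\<lambda>x. (x \<bullet> x) ^ k) f = (\<Sum>a\<in>A. \<alpha> a * (a \<bullet> a) ^ k)"
    using fischer_sym[OF assms inner_self_power_homs] by simp
  moreover have "E f = (\<Sum>a\<in>A. E (\<lambda>x. \<alpha> a * (a \<bullet> x) ^ (2 * k)))"
    unfolding A(2) by (rule E_sum) (intro polys_scale polys_power)
  moreover have "E (\<lambda>x. \<alpha> a * (a \<bullet> x) ^ (2 * k)) = gauss_moment (2 * k) * (\<alpha> a * (a \<bullet> a) ^ k)" for a
    by (simp add: E_scale E_power norm_power_even)
  ultimately show ?thesis by (simp add: sum_distrib_left)
qed

lemma gen_pochhammer_pos:
  assumes "m \<le> n"
  shows "0 < gen_pochhammer m (real n / 2) \<kappa>"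
  unfolding gen_pochhammer_def
proof (rule prod_pos)
  fix j assume j: "j \<in> {1..m}"
  then have "0 < real n / 2 - real (j - 1) / 2" using assms by (simp add: diff_divide_distrib[symmetric])
  then show "0 < pochhammer (real n / 2 - real (j - 1) / 2) (\<kappa> (j - 1))" by (rule pochhammer_pos)
qed

context gaussian_matrix
begin

text \<open>The eigenvalue on V_\<kappa> of averaging over a Wishart matrix, by
  \<open>E_wishart\<close>.\<close>

definition weight :: "(nat \<Rightarrow> nat) \<Rightarrow> real" where
  "weight \<kappa> = 2 ^ psize \<kappa> * gen_pochhammer CARD('m) (real CARD('n) / 2) \<kappa>"

text \<open>With L (B B^T) L^T the identity, h = L B is orthogonal. Rotation invariance evaluates
  the expectation at h x, and semi-invariance under L leads back to B.\<close>

lemma E_wishart_power_poly: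
  fixes B :: "('m, 'm) rmat"
  assumes \<kappa>: "\<kappa> \<in> partitions CARD('m) k" and B: "invertible B"
  shows "E (\<lambda>x. pull (power_poly \<kappa>) (B ** x)) = weight \<kappa> * power_poly \<kappa> (B ** transpose B)"
proof -
  obtain L :: "('m, 'm) rmat" where L: "lower L" "invertible L" "L ** (B ** transpose B) ** transpose L = mat 1"
    by (rule cholesky[OF pos_form_mult_transpose[OF B] gram_symmetric]) blast
  define h where "h = L ** B"
  have "h ** transpose h = mat 1" using L(3) by (simp add: h_def matrix_transpose_mul matrix_mul_assoc)
  then have h: "orthogonal_matrix h" by (simp add: orthogonal_matrix_def matrix_left_right_inverse)
  have pol: "(pull (power_poly \<kappa>) :: ('m, 'n) rmat \<Rightarrow> real) \<in> polys"
    by (rule homs_subset_polys[OF pull_homs[OF power_poly_hom[OF \<kappa>]]])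
  have "pull (power_poly \<kappa>) (h ** x) = chi \<kappa> L * pull (power_poly \<kappa>) (B ** x)" for x :: "('m, 'n) rmat"
  proof -
    have "(h ** x) ** transpose (h ** x) = L ** ((B ** x) ** transpose (B ** x)) ** transpose L"
      by (simp add: h_def matrix_transpose_mul matrix_mul_assoc)
    then show ?thesis using power_poly_congruence[OF \<kappa> L(1) gram_symmetric] by (simp add: pull_def)
  qed
  then have "chi \<kappa> L * E (\<lambda>x. pull (power_poly \<kappa>) (B ** x)) = E (\<lambda>x. pull (power_poly \<kappa>) (h ** x))"
    by (simp add: E_scale)
  also have "\<dots> = E (\<lambda>x. pull (power_poly \<kappa>) x)"
    by (rule E_linear_cong[OF linear_matrix_mult_left linear_id[unfolded id_def] inner_matrix_mult_left _ _ pol, where h' = "\<lambda>x. x"])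
       (simp_all add: orthogonal_matrix_norm[OF h])
  also have "\<dots> = weight \<kappa>" using E_power_poly[OF \<kappa>] partitionsD(3)[OF \<kappa>] by (simp add: weight_def)
  finally have 1: "chi \<kappa> L * E (\<lambda>x. pull (power_poly \<kappa>) (B ** x)) = weight \<kappa>" .
  have 2: "chi \<kappa> L * power_poly \<kappa> (B ** transpose B) = 1"
    using power_poly_congruence[OF \<kappa> L(1) gram_symmetric[of B]] L(3) power_poly_mat_1[OF \<kappa>] by simp
  have "chi \<kappa> L * E (\<lambda>x. pull (power_poly \<kappa>) (B ** x)) = chi \<kappa> L * (weight \<kappa> * power_poly \<kappa> (B ** transpose B))"
    using 1 2 by (simp add: mult_ac)
  moreover have "chi \<kappa> L \<noteq> 0" using 2 by auto
  ultimately show ?thesis by simp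
qed

lemma E_wishart:
  fixes A :: "('m, 'm) rmat"
  assumes \<kappa>: "\<kappa> \<in> partitions CARD('m) k" and P: "P \<in> zspace \<kappa>" and A: "invertible A"
  shows "E (\<lambda>x. pull P (A ** x)) = weight \<kappa> * P (A ** transpose A)"
  using P
proof (induction rule: zspace_induct)
  case (act g)
  have "pull (act g (power_poly \<kappa>)) (A ** x) = pull (power_poly \<kappa>) ((g ** A) ** x)" for x :: "('m, 'n) rmat"
    by (simp add: pull_act matrix_mul_assoc)
  then have "E (\<lambda>x. pull (act g (power_poly \<kappa>)) (A ** x)) = weight \<kappa> * power_poly \<kappa> ((g ** A) ** transpose (g ** A))"
    using E_wishart_power_poly[OF \<kappa> invertible_mult[OF act A]] by simp
  moreover have "power_poly \<kappa> ((g ** A) ** transpose (g ** A)) = act g (power_poly \<kappa>) (A ** transpose A)"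
    by (simp add: act_def matrix_transpose_mul matrix_mul_assoc)
  ultimately show ?case by simp
next
  case (add P Q)
  have "(\<lambda>x :: ('m, 'n) rmat. pull P (A ** x)) \<in> polys" if "P \<in> zspace \<kappa>" for P :: "('m, 'm) rmat \<Rightarrow> real"
    by (rule homs_subset_polys[OF homs_compose[OF pull_homs linear_matrix_mult_left]])
       (use that zspace_hom_polys[OF \<kappa>] in blast)
  then show ?case using add by (simp add: pull_add E_add distrib_left)
next
  case (scale c P)
  then show ?case by (simp add: pull_scale E_scale)
qed

lemma weight_pos: "CARD('m) \<le> CARD('n) \<Longrightarrow> 0 < weight \<kappa>"
  by (simp add: weight_def gen_pochhammer_pos)

text \<open>The expectation of P at a Wishart matrix in two ways: by \<open>E_eq_fischer\<close>, as
  |x|^(2k) is the trace power of x x^T, and by \<open>E_wishart\<close>.\<close>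

lemma fischer_trace_power:
  fixes P :: "('m, 'm) rmat \<Rightarrow> real"
  assumes \<kappa>: "\<kappa> \<in> partitions CARD('m) k" and P: "P \<in> zspace \<kappa>"
  shows "gauss_moment (2 * k) * gram_form TYPE('n) k (trace_power k) P = weight \<kappa> * P (mat 1)"
proof -
  have "P \<in> hom_polys k" using P zspace_hom_polys[OF \<kappa>] by blast
  then have "E (pull P) = gauss_moment (2 * k) * gram_form TYPE('n) k (trace_power k) P"
    unfolding gram_form_def pull_trace_power[abs_def] by (intro E_eq_fischer pull_homs)
  then show ?thesis using E_wishart[OF \<kappa> P invertible_mat_1] by (simp add: transpose_mat)
qed

end

context
  fixes \<kappa> :: "nat \<Rightarrow> nat" and k :: nat
  assumes \<kappa>: "\<kappa> \<in> partitions CARD('m::{finite,linorder}) k"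
begin

text \<open>If the factor were 0, the trace power would be orthogonal to
  \<open>sph \<kappa>\<close>; but by \<open>fischer_trace_power\<close> their product is a positive
  multiple of the value of \<open>sph \<kappa>\<close> at the identity.\<close>

lemma zonal_multiple_sph:
  obtains c where "c \<noteq> 0" "zonal \<kappa> = (\<lambda>S :: ('m, 'm) rmat. c * sph \<kappa> S)"
proof -
  let ?P = "partitions CARD('m) k" and ?B = "gram_form TYPE('m) k" and ?Z = "\<lambda>\<tau>. sph \<tau> :: ('m, 'm) rmat \<Rightarrow> real"
  obtain c where c: "\<And>\<tau>. \<tau> \<in> ?P \<Longrightarrow> zonal \<tau> = (\<lambda>S :: ('m, 'm) rmat. c \<tau> * sph \<tau> S)"
    "\<And>S :: ('m, 'm) rmat. trace_power k S = (\<Sum>\<tau>\<in>?P. zonal \<tau> S)" by (rule zonal_sph[where 'm = 'm and k = k]) blast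
  obtain M :: "(('m, 'm) rmat \<Rightarrow> real) measure" and \<zeta> where "gaussian M (\<zeta> :: _ \<Rightarrow> ('m, 'm) rmat)"
    using ex_gaussian by blast
  then interpret gaussian_matrix M \<zeta> by (simp add: gaussian_matrix_def)
  have "weight \<kappa> * ?Z \<kappa> (mat 1) > 0" using weight_pos sph_pos[OF \<kappa>] by simp
  then have ne: "?B (trace_power k) (?Z \<kappa>) \<noteq> 0"
    using fischer_trace_power[OF \<kappa> sph_zspace[OF \<kappa>]] by auto
  have h: "?Z \<tau> \<in> hom_polys k" if "\<tau> \<in> ?P" for \<tau> by (rule sph_hom_polys[OF that])
  have eq: "trace_power k = (\<lambda>S. \<Sum>\<tau>\<in>?P. c \<tau> * ?Z \<tau> S)" using c by (auto simp: fun_eq_iff)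
  have "?B (trace_power k) (?Z \<kappa>) = (\<Sum>\<tau>\<in>?P. c \<tau> * ?B (?Z \<tau>) (?Z \<kappa>))"
    unfolding gram_form_def eq pull_sum pull_scale
    by (subst fischer_sum_left) (auto intro!: sum.cong fischer_scale_left homs_scale pull_homs h \<kappa>)
  also have "\<dots> = (\<Sum>\<tau>\<in>{\<kappa>}. c \<tau> * ?B (?Z \<tau>) (?Z \<kappa>))"
    using zspace_orthogonal[OF _ \<kappa> _ sph_zspace sph_zspace[OF \<kappa>]] \<kappa> partitions_finite
    by (intro sum.mono_neutral_right) auto
  finally have "c \<kappa> \<noteq> 0" using ne by auto
  then show ?thesis using that c(1)[OF \<kappa>] by blast
qed

lemma zonal_zspace: "(zonal \<kappa> :: ('m, 'm) rmat \<Rightarrow> real) \<in> zspace \<kappa>"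
  by (rule zonal_multiple_sph) (simp add: subspace_fun_scale[OF subspace_zspace sph_zspace[OF \<kappa>]])

lemma zonal_hom_polys: "(zonal \<kappa> :: ('m, 'm) rmat \<Rightarrow> real) \<in> hom_polys k"
  using zonal_zspace zspace_hom_polys[OF \<kappa>] by blast

lemma zonal_invariant: "orthogonal_matrix h \<Longrightarrow> act h (zonal \<kappa>) = (zonal \<kappa> :: ('m, 'm) rmat \<Rightarrow> real)"
  by (rule zonal_multiple_sph) (simp add: act_scale sph_invariant[OF \<kappa>])

lemma zonal_one_nonzero: "zonal \<kappa> (mat 1 :: ('m, 'm) rmat) \<noteq> 0"
  by (rule zonal_multiple_sph) (use sph_pos[OF \<kappa>] in simp)

end

lemma trace_power_zonal: "trace_power k S = (\<Sum>\<kappa>\<in>partitions CARD('m) k. zonal \<kappa> S)"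
  for S :: "('m::{finite,linorder}, 'm) rmat"
  by (rule zonal_sph[where 'm = 'm and k = k]) blast

lemma biinv_span_zonal:
  fixes f :: "('m::{finite,linorder}, 'n::finite) rmat \<Rightarrow> real"
  assumes "CARD('m) \<le> CARD('n)" "f \<in> biinv k"
  obtains c where "f = (\<lambda>x. \<Sum>\<kappa>\<in>partitions CARD('m) k. c \<kappa> * pull (zonal \<kappa>) x)"
proof -
  let ?P = "partitions CARD('m) k"
  obtain c where c: "f = (\<lambda>x. \<Sum>\<kappa>\<in>?P. c \<kappa> * pull (sph \<kappa>) x)" by (rule biinv_span[OF assms])
  have "\<exists>d. \<forall>x :: ('m, 'n) rmat. pull (sph \<kappa>) x = d * pull (zonal \<kappa>) x" if "\<kappa> \<in> ?P" for \<kappa>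
  proof (rule zonal_multiple_sph[OF that])
    fix e assume e: "e \<noteq> 0" "zonal \<kappa> = (\<lambda>S :: ('m, 'm) rmat. e * sph \<kappa> S)"
    show ?thesis by (intro exI[of _ "inverse e"]) (use e in \<open>simp add: pull_def\<close>)
  qed
  then obtain d where d: "\<And>\<kappa> x. \<kappa> \<in> ?P \<Longrightarrow> pull (sph \<kappa>) (x :: ('m, 'n) rmat) = d \<kappa> * pull (zonal \<kappa>) x" by metis
  show ?thesis
    by (rule that[of "\<lambda>\<kappa>. c \<kappa> * d \<kappa>"]) (auto simp: c d fun_eq_iff mult.assoc intro!: sum.cong)
qed

section \<open>Linear independence of zonal polynomials\<close>

lemma zonal_coefficients_zero:
  assumes "\<And>S :: ('m::{finite,linorder}, 'm) rmat. transpose S = S \<Longrightarrow> (\<Sum>\<kappa>\<in>partitions CARD('m) k. c \<kappa> * zonal \<kappa> S) = 0"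
    and \<tau>: "\<tau> \<in> partitions CARD('m) k"
  shows "c \<tau> = 0"
proof -
  have 0: "(\<Sum>\<kappa>\<in>partitions CARD('m) k. c \<kappa> * zonal \<kappa> S) = 0" for S :: "('m, 'm) rmat"
  proof (cases "transpose S = S")
    case False
    have "zonal \<kappa> S = 0" if "\<kappa> \<in> partitions CARD('m) k" for \<kappa>
      by (rule hom_polys_not_sym[OF zonal_hom_polys[OF that] False])
    then show ?thesis by simp
  qed (rule assms(1))
  have "(\<lambda>S :: ('m, 'm) rmat. c \<tau> * zonal \<tau> S) = (\<lambda>S. 0)"
    by (rule zspace_components_unique[where d = "\<lambda>\<kappa> S. c \<kappa> * zonal \<kappa> S", OF _ 0 \<tau>])
       (rule subspace_fun_scale[OF subspace_zspace zonal_zspace])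
  from fun_cong[OF this, of "mat 1"] show ?thesis using zonal_one_nonzero[OF \<tau>] by simp
qed

lemma zonal_scaleR:
  assumes "\<kappa> \<in> partitions CARD('m::{finite,linorder}) k" "transpose S = S"
  shows "zonal \<kappa> (c *\<^sub>R S) = c ^ k * zonal \<kappa> (S :: ('m, 'm) rmat)"
proof -
  obtain f where f: "f \<in> homs k" "(zonal \<kappa> :: ('m, 'm) rmat \<Rightarrow> real) = on_sym f"
    using zonal_hom_polys[OF assms(1)] by (auto simp: hom_polys_eq)
  have "transpose (c *\<^sub>R S) = c *\<^sub>R S" using assms(2) by (simp add: transpose_scalar)
  then show ?thesis using assms(2) homs_homogeneous[OF f(1)] by (simp add: f(2) on_sym_def)
qed

text \<open>Replacing S by t S separates the degrees.\<close>

lemma zonal_coefficients_zero_inhomogeneous: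
  assumes 0: "\<And>S :: ('m::{finite,linorder}, 'm) rmat. transpose S = S \<Longrightarrow>
      (\<Sum>s\<le>k. \<Sum>\<sigma>\<in>partitions CARD('m) s. c \<sigma> * zonal \<sigma> S) = 0"
    and \<tau>: "\<tau> \<in> partitions CARD('m) s" "s \<le> k"
  shows "c \<tau> = 0"
proof (rule zonal_coefficients_zero[OF _ \<tau>(1)])
  fix S :: "('m, 'm) rmat" assume S: "transpose S = S"
  show "(\<Sum>\<kappa>\<in>partitions CARD('m) s. c \<kappa> * zonal \<kappa> S) = 0"
  proof (rule coefficients_zero[where I = "{..k}" and e = 1 and v = "\<lambda>s. \<Sum>\<kappa>\<in>partitions CARD('m) s. c \<kappa> * zonal \<kappa> S"])
    fix t :: real
    have "transpose (t *\<^sub>R S) = t *\<^sub>R S" using S by (simp add: transpose_scalar)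
    from 0[OF this] show "(\<Sum>s\<le>k. t ^ s * (\<Sum>\<kappa>\<in>partitions CARD('m) s. c \<kappa> * zonal \<kappa> S)) = 0"
      by (simp add: zonal_scaleR[OF _ S] sum_distrib_left mult_ac cong: sum.cong)
  qed (use \<tau> in auto)
qed

section \<open>Laguerre and Hermite polynomials\<close>

lemma polys_translate: "f \<in> polys \<Longrightarrow> (\<lambda>x. f (x + y)) \<in> polys"
proof (induction rule: polys_induct)
  case (power a k)
  obtain v where v: "\<And>i. i \<le> k \<Longrightarrow> v i \<in> homs (k - i)" "\<And>t x. (a \<bullet> (x + t *\<^sub>R y)) ^ k = (\<Sum>i\<le>k. t ^ i * v i x)"
    using homs_line[OF homs_power[of a k], of y] by metis
  have "(a \<bullet> (x + y)) ^ k = (\<Sum>i\<le>k. v i x)" for x using v(2)[of x 1] by simp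
  moreover have "(\<lambda>x. \<Sum>i\<le>k. v i x) \<in> polys"
    by (rule polys_sum) (use v(1) homs_subset_polys in auto)
  ultimately show ?case by simp
qed (auto intro: polys_zero polys_add polys_scale)

lemma ex_gram_add_one:
  fixes A :: "('m::{finite,linorder}, 'm) rmat"
  obtains B :: "('m, 'm) rmat" where "invertible B" "B ** transpose B = A ** transpose A + mat 1"
proof -
  have v: "(A ** transpose A + mat 1) *v x = A *v (transpose A *v x) + x" for x :: "(real, 'm) vec"
    by (simp only: matrix_vector_mult_add_rdistrib matrix_vector_mul_lid matrix_vector_mul_assoc)
  have "pos_form (A ** transpose A + mat 1)"
    unfolding pos_form_def
  proof (intro allI impI)
    fix x :: "(real, 'm) vec" assume "x \<noteq> 0"
    have "x \<bullet> ((A ** transpose A + mat 1) *v x) = (transpose A *v x) \<bullet> (transpose A *v x) + x \<bullet> x"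
      unfolding v inner_add_right inner_matrix_vector[of x A] ..
    also have "\<dots> > 0" using \<open>x \<noteq> 0\<close> by (intro add_nonneg_pos) auto
    finally show "0 < x \<bullet> ((A ** transpose A + mat 1) *v x)" .
  qed
  moreover have "transpose (M + N) = transpose M + transpose N" for M N :: "('m, 'm) rmat"
    by (simp add: transpose_def vec_eq_iff)
  then have "transpose (A ** transpose A + mat 1) = A ** transpose A + mat 1"
    by (simp add: gram_symmetric transpose_mat)
  ultimately show ?thesis using that by (metis pos_form_gram)
qed

section \<open>Heat flow of a zonal polynomial and the generalized binomial coefficients\<close>

context
  fixes \<kappa> :: "nat \<Rightarrow> nat" and k :: nat and A and \<alpha> :: "('m::{finite,linorder}, 'n::finite) rmat \<Rightarrow> real"
  assumes \<kappa>: "\<kappa> \<in> partitions CARD('m) k" and le: "CARD('m) \<le> CARD('n)"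
    and A: "finite A" "(pull (zonal \<kappa>) :: ('m, 'n) rmat \<Rightarrow> real) = (\<lambda>x. \<Sum>a\<in>A. \<alpha> a * (a \<bullet> x) ^ (2 * k))"
begin

text \<open>This is 1 / (2^j j!) times the j-th power of the Laplacian applied to the zonal
  polynomial of x x^T, in other words the coefficient of \<epsilon>^j in its heat flow exp
  (\<epsilon> \<Delta> / 2).\<close>

definition herm_part :: "nat \<Rightarrow> ('m, 'n) rmat \<Rightarrow> real" where
  "herm_part j x = (\<Sum>a\<in>A. \<alpha> a * (herm_coeff (2 * k) j * (((norm a)\<^sup>2) ^ j * (a \<bullet> x) ^ (2 * k - 2 * j))))"

lemma sum_herm_part: "(\<Sum>a\<in>A. \<alpha> a * herm (2 * k) (\<epsilon> * (norm a)\<^sup>2) (a \<bullet> x)) = (\<Sum>j\<le>k. \<epsilon> ^ j * herm_part j x)"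
proof -
  have "herm (2 * k) v u = (\<Sum>j\<le>k. herm_coeff (2 * k) j * v ^ j * u ^ (2 * k - 2 * j))" for v u
  proof -
    have "herm (2 * k) v u = (\<Sum>j\<le>2*k. herm_coeff (2 * k) j * v ^ j * u ^ (2 * k - 2 * j))"
      by (rule herm_expand) simp
    also have "\<dots> = (\<Sum>j\<le>k. herm_coeff (2 * k) j * v ^ j * u ^ (2 * k - 2 * j))"
      by (rule sum.mono_neutral_right) (auto simp: herm_coeff_eq_0)
    finally show ?thesis .
  qed
  then have "(\<Sum>a\<in>A. \<alpha> a * herm (2 * k) (\<epsilon> * (norm a)\<^sup>2) (a \<bullet> x)) =
    (\<Sum>a\<in>A. \<Sum>j\<le>k. \<epsilon> ^ j * (\<alpha> a * (herm_coeff (2 * k) j * (((norm a)\<^sup>2) ^ j * (a \<bullet> x) ^ (2 * k - 2 * j)))))"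
    by (simp add: sum_distrib_left power_mult_distrib mult_ac)
  also have "\<dots> = (\<Sum>j\<le>k. \<epsilon> ^ j * herm_part j x)"
    unfolding herm_part_def sum_distrib_left by (rule sum.swap)
  finally show ?thesis .
qed

text \<open>Up to a factor, \<open>herm_part j x\<close> is the Fischer product of \<open>pull (zonal \<kappa>)\<close> and
  \<open>y \<mapsto> |y|\<^bsup>2j\<^esup> (x \<bullet> y)\<^bsup>2k-2j\<^esup>\<close>, which makes its invariance visible.\<close>

lemma herm_part_orthogonal:
  assumes "j \<le> k" "linear g" "linear h" "\<And>x y. g x \<bullet> y = x \<bullet> h y" "\<And>y. h y \<bullet> h y = y \<bullet> y"
    and inv: "\<And>x. pull (zonal \<kappa>) (g x) = pull (zonal \<kappa>) x"
  shows "herm_part j (g x) = herm_part j x"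
proof -
  let ?q = "pull (zonal \<kappa>) :: ('m, 'n) rmat \<Rightarrow> real"
  define r where "r x y = (y \<bullet> y) ^ j * (x \<bullet> y) ^ (2 * k - 2 * j)" for x y :: "('m, 'n) rmat"
  have "r x \<in> homs (2 * j + (2 * k - 2 * j))" for x
    unfolding r_def by (intro homs_mult inner_self_power_homs homs_power)
  then have r: "r x \<in> homs (2 * k)" for x using assms(1) by simp
  have q: "?q \<in> homs (2 * k)" by (rule pull_homs[OF zonal_hom_polys[OF \<kappa>]])
  have herm_part: "herm_part j x = herm_coeff (2 * k) j * fischer (2 * k) ?q (r x)" for x
    unfolding fischer_eq[OF A r]
    by (simp add: herm_part_def r_def sum_distrib_left power2_norm_eq_inner inner_commute mult_ac)
  have "r (g x) = (\<lambda>y. r x (h y))" using assms(4,5) by (auto simp: r_def)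
  then have "fischer (2 * k) ?q (r (g x)) = fischer (2 * k) (\<lambda>x. ?q (g x)) (r x)"
    using fischer_adjoint[OF q r assms(2,3,4)] by simp
  then show ?thesis by (simp add: herm_part inv)
qed

lemma herm_part_biinv: "j \<le> k \<Longrightarrow> herm_part j \<in> biinv (k - j)"
proof -
  assume j: "j \<le> k"
  have q: "(pull (zonal \<kappa>) :: ('m, 'n) rmat \<Rightarrow> real) \<in> biinv k"
    by (rule pull_biinv[OF zonal_hom_polys[OF \<kappa>] zonal_invariant[OF \<kappa>]])
  have "herm_part j \<in> homs (2 * k - 2 * j)"
    unfolding herm_part_def[abs_def] by (intro homs_sum homs_scale homs_power)
  then have hom: "herm_part j \<in> homs (2 * (k - j))" by (simp add: diff_mult_distrib2)
  have "herm_part j (h ** x) = herm_part j x" if h: "orthogonal_matrix h" for h x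
  proof (rule herm_part_orthogonal[OF j linear_matrix_mult_left linear_matrix_mult_left inner_matrix_mult_left])
    show "(transpose h ** y) \<bullet> (transpose h ** y) = y \<bullet> y" for y :: "('m, 'n) rmat"
      using orthogonal_matrix_norm[OF h, of y] by (simp add: norm_eq_sqrt_inner)
    show "pull (zonal \<kappa>) (h ** x) = pull (zonal \<kappa>) x" for x :: "('m, 'n) rmat" using q h by (simp add: biinv_def)
  qed
  moreover have "herm_part j (x ** h) = herm_part j x" if h: "orthogonal_matrix h" for h x
  proof (rule herm_part_orthogonal[OF j linear_matrix_mult_right linear_matrix_mult_right inner_matrix_mult_right])
    show "(y ** transpose h) \<bullet> (y ** transpose h) = y \<bullet> y" for y :: "('m, 'n) rmat"
    proof -
      have "(y ** transpose h) \<bullet> (y ** transpose h) = y \<bullet> (y ** (transpose h ** h))"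
        by (simp add: inner_matrix_mult_right matrix_mul_assoc)
      then show ?thesis using h by (simp add: orthogonal_matrix_def)
    qed
    show "pull (zonal \<kappa>) (x ** h) = pull (zonal \<kappa>) x" for x :: "('m, 'n) rmat" using q h by (simp add: biinv_def)
  qed
  ultimately show ?thesis using hom by (simp add: biinv_def)
qed

text \<open>A single coefficient function serves all degrees because \<sigma> determines s as its
  size; the index is k - s since each step in j lowers the degree by 2.\<close>

lemma herm_part_zonal:
  obtains \<gamma> where "\<And>s x. s \<le> k \<Longrightarrow> herm_part (k - s) x = (\<Sum>\<sigma>\<in>partitions CARD('m) s. \<gamma> \<sigma> * pull (zonal \<sigma>) x)"
proof -
  have "\<exists>c. s \<le> k \<longrightarrow> (\<forall>x. herm_part (k - s) x = (\<Sum>\<sigma>\<in>partitions CARD('m) s. c \<sigma> * pull (zonal \<sigma>) x))" for s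
  proof (cases "s \<le> k")
    case True
    then have "herm_part (k - s) \<in> biinv s" using herm_part_biinv[of "k - s"] by simp
    then show ?thesis by (rule biinv_span_zonal[OF le]) auto
  qed simp
  then obtain c where c: "\<And>s x. s \<le> k \<Longrightarrow> herm_part (k - s) x = (\<Sum>\<sigma>\<in>partitions CARD('m) s. c s \<sigma> * pull (zonal \<sigma>) x)" by metis
  show ?thesis
    by (rule that[of "\<lambda>\<sigma>. c (psize \<sigma>) \<sigma>"]) (simp add: c partitionsD(3) cong: sum.cong)
qed

text \<open>The sum with \<open>+|a|\<^sup>2\<close> in place of \<open>-|a|\<^sup>2\<close> has the expectation of \<open>C\<^sub>\<kappa>\<close> at a Wishart matrix of
  covariance \<open>S + Id\<close>, so expanding it into \<open>herm_part j\<close> exhibits the generalized binomial coefficients.\<close>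

lemma hermite_eq:
  "hermite \<kappa> x = inverse (4 ^ k) * inverse (gen_pochhammer CARD('m) (real CARD('n) / 2) \<kappa>) *
     (\<Sum>a\<in>A. \<alpha> a * herm (2 * k) (- (norm a)\<^sup>2) (a \<bullet> x))"
proof -
  obtain \<gamma> where \<gamma>: "\<And>s x. s \<le> k \<Longrightarrow> herm_part (k - s) x = (\<Sum>\<sigma>\<in>partitions CARD('m) s. \<gamma> \<sigma> * pull (zonal \<sigma>) x)"
    using herm_part_zonal by blast
  obtain M :: "(('m, 'n) rmat \<Rightarrow> real) measure" and \<zeta> where "gaussian M (\<zeta> :: _ \<Rightarrow> ('m, 'n) rmat)"
    using ex_gaussian by blast
  then interpret gaussian_matrix M \<zeta> by (simp add: gaussian_matrix_def)
  let ?P = "partitions CARD('m)" and ?p = "gen_pochhammer CARD('m) (real CARD('n) / 2)"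
  note wp = weight_pos[OF le]
  have p: "0 < ?p \<sigma>" for \<sigma> by (rule gen_pochhammer_pos[OF le])
  have rev: "(\<Sum>j\<le>k. f j) = (\<Sum>s\<le>k. f (k - s))" for f :: "nat \<Rightarrow> real"
    by (rule sum.reindex_bij_witness[of _ "\<lambda>s. k - s" "\<lambda>s. k - s"]) auto
  \<comment> \<open>Here S = C C^T and B B^T = S + Id, so |C^T a|^2 + |a|^2 = |B^T a|^2; the sum
    with positive sign is averaged at C x, once as a whole and once after its expansion.\<close>
  have key: "weight \<kappa> * zonal \<kappa> (S + mat 1) = (\<Sum>s\<le>k. \<Sum>\<sigma>\<in>?P s. \<gamma> \<sigma> * weight \<sigma> * zonal \<sigma> S)"
    if S: "transpose S = S" "pos_form S" for S :: "('m, 'm) rmat"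
  proof -
    obtain C :: "('m, 'm) rmat" where C: "invertible C" "S = C ** transpose C" by (rule pos_form_gram[OF S])
    obtain B :: "('m, 'm) rmat" where B: "invertible B" "B ** transpose B = C ** transpose C + mat 1"
      by (rule ex_gram_add_one)
    have "E (\<lambda>x. \<Sum>a\<in>A. \<alpha> a * herm (2 * k) (1 * (norm a)\<^sup>2) (a \<bullet> (C ** x))) =
      (\<Sum>a\<in>A. \<alpha> a * (gauss_moment (2 * k) * ((norm (transpose C ** a))\<^sup>2 + (norm a)\<^sup>2) ^ k))"
    proof -
      have adj: "a \<bullet> (C ** x) = (transpose C ** a) \<bullet> x" for a x :: "('m, 'n) rmat"
        using inner_matrix_mult_left[of C x a] by (simp add: inner_commute)
      show ?thesis
        unfolding adj by (subst E_sum) (simp_all add: polys_scale herm_polys E_scale E_herm_even)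
    qed
    also have "\<dots> = (\<Sum>a\<in>A. \<alpha> a * (gauss_moment (2 * k) * norm (transpose B ** a) ^ (2 * k)))"
    proof -
      have "(norm (transpose C ** a))\<^sup>2 + (norm a)\<^sup>2 = (norm (transpose B ** a))\<^sup>2" for a :: "('m, 'n) rmat"
      proof -
        have *: "(transpose D ** a) \<bullet> (transpose D ** a) = a \<bullet> ((D ** transpose D) ** a)" for D :: "('m, 'm) rmat"
          by (simp add: inner_matrix_mult_left matrix_mul_assoc)
        have "(C ** transpose C + mat 1) ** a = (C ** transpose C) ** a + a"
          by (simp add: vec_eq_iff matrix_matrix_mult_def[of "_ + _"] distrib_right sum.distrib)
             (simp add: matrix_matrix_mult_def mat_def if_distrib[where f = "\<lambda>z. z * c" for c] cong: if_cong)
        then show ?thesis unfolding power2_norm_eq_inner * B(2) by (simp add: inner_add_right)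
      qed
      then show ?thesis by (simp add: power_mult)
    qed
    also have "\<dots> = E (\<lambda>x. \<Sum>a\<in>A. \<alpha> a * (a \<bullet> (B ** x)) ^ (2 * k))"
    proof -
      have adj: "a \<bullet> (B ** x) = (transpose B ** a) \<bullet> x" for a x :: "('m, 'n) rmat"
        using inner_matrix_mult_left[of B x a] by (simp add: inner_commute)
      show ?thesis
        unfolding adj by (subst E_sum) (simp_all add: polys_scale polys_power E_scale E_power)
    qed
    also have "\<dots> = E (\<lambda>x. pull (zonal \<kappa>) (B ** x))" by (simp add: A(2))
    also have "\<dots> = weight \<kappa> * zonal \<kappa> (S + mat 1)"
      using E_wishart[OF \<kappa> zonal_zspace[OF \<kappa>] B(1)] by (simp add: B(2) C(2))
    finally have 1: "E (\<lambda>x. \<Sum>a\<in>A. \<alpha> a * herm (2 * k) (1 * (norm a)\<^sup>2) (a \<bullet> (C ** x))) = weight \<kappa> * zonal \<kappa> (S + mat 1)" .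
    have pol: "(\<lambda>x :: ('m, 'n) rmat. \<gamma> \<sigma> * pull (zonal \<sigma>) (C ** x)) \<in> polys" if "\<sigma> \<in> ?P s" for s \<sigma>
      by (rule polys_scale[OF homs_subset_polys[OF homs_compose[OF pull_homs[OF zonal_hom_polys[OF that]] linear_matrix_mult_left]]])
    have "(\<Sum>a\<in>A. \<alpha> a * herm (2 * k) (1 * (norm a)\<^sup>2) (a \<bullet> (C ** x))) = (\<Sum>s\<le>k. \<Sum>\<sigma>\<in>?P s. \<gamma> \<sigma> * pull (zonal \<sigma>) (C ** x))" for x
      unfolding sum_herm_part by (subst rev) (simp add: \<gamma>)
    then have "E (\<lambda>x. \<Sum>a\<in>A. \<alpha> a * herm (2 * k) (1 * (norm a)\<^sup>2) (a \<bullet> (C ** x))) =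
      E (\<lambda>x. \<Sum>s\<le>k. \<Sum>\<sigma>\<in>?P s. \<gamma> \<sigma> * pull (zonal \<sigma>) (C ** x))" by simp
    also have "\<dots> = (\<Sum>s\<le>k. E (\<lambda>x. \<Sum>\<sigma>\<in>?P s. \<gamma> \<sigma> * pull (zonal \<sigma>) (C ** x)))"
      by (rule E_sum) (rule polys_sum[OF pol])
    also have "\<dots> = (\<Sum>s\<le>k. \<Sum>\<sigma>\<in>?P s. E (\<lambda>x. \<gamma> \<sigma> * pull (zonal \<sigma>) (C ** x)))"
      by (intro sum.cong refl E_sum pol)
    also have "\<dots> = (\<Sum>s\<le>k. \<Sum>\<sigma>\<in>?P s. \<gamma> \<sigma> * weight \<sigma> * zonal \<sigma> S)"
      by (intro sum.cong refl) (simp only: E_scale E_wishart[OF _ zonal_zspace C(1)] C(2) mult.assoc)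
    finally show ?thesis using 1 by simp
  qed
  \<comment> \<open>The defining identity of the binomial coefficients ranges over all symmetric S.
    The polynomials f representing the zonal polynomials carry the identity out of the positive
    definite cone.\<close>
  have key': "weight \<kappa> * zonal \<kappa> (S + mat 1) = (\<Sum>s\<le>k. \<Sum>\<sigma>\<in>?P s. \<gamma> \<sigma> * weight \<sigma> * zonal \<sigma> S)"
    if S: "transpose S = S" for S :: "('m, 'm) rmat"
  proof -
    have "\<exists>f. f \<in> polys \<and> (zonal \<sigma> :: ('m, 'm) rmat \<Rightarrow> real) = on_sym f" if "\<sigma> \<in> ?P s" for s \<sigma>
      using zonal_hom_polys[OF that] homs_subset_polys unfolding hom_polys_eq by blast
    then obtain f where f: "\<And>s \<sigma>. \<sigma> \<in> ?P s \<Longrightarrow> f \<sigma> \<in> polys \<and> (zonal \<sigma> :: ('m, 'm) rmat \<Rightarrow> real) = on_sym (f \<sigma>)" by metis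
    have sym1: "transpose (S + mat 1) = S + mat 1" if "transpose S = S" for S :: "('m, 'm) rmat"
      using that by (auto simp: transpose_def vec_eq_iff mat_def)
    define D where "D S = weight \<kappa> * f \<kappa> (S + mat 1) - (\<Sum>s\<le>k. \<Sum>\<sigma>\<in>?P s. \<gamma> \<sigma> * weight \<sigma> * f \<sigma> S)" for S
    have D: "D S = weight \<kappa> * zonal \<kappa> (S + mat 1) - (\<Sum>s\<le>k. \<Sum>\<sigma>\<in>?P s. \<gamma> \<sigma> * weight \<sigma> * zonal \<sigma> S)"
      if "transpose S = S" for S
      unfolding D_def using f that sym1[OF that] \<kappa> by (simp add: on_sym_def cong: sum.cong)
    have "(\<lambda>S. weight \<kappa> * f \<kappa> (S + mat 1)) \<in> polys" using f \<kappa> by (intro polys_scale polys_translate) blast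
    moreover have "(\<lambda>S. \<Sum>s\<le>k. \<Sum>\<sigma>\<in>?P s. \<gamma> \<sigma> * weight \<sigma> * f \<sigma> S) \<in> polys" using f by (intro polys_sum polys_scale) blast
    ultimately have Dp: "D \<in> polys" unfolding D_def[abs_def] by (rule polys_diff)
    obtain e where e: "0 < e" "\<And>t. 0 < t \<Longrightarrow> t < e \<Longrightarrow> pos_form (mat 1 + t *\<^sub>R (S - mat 1))"
      using pos_form_near_mat_1 by blast
    have sym: "transpose (mat 1 + t *\<^sub>R (S - mat 1)) = mat 1 + t *\<^sub>R (S - mat 1)" for t
      using S by (auto simp: transpose_def vec_eq_iff mat_def)
    have "D (mat 1 + 1 *\<^sub>R (S - mat 1)) = 0"
      by (rule polys_zero_of_line[OF Dp e(1)]) (use key[OF sym e(2)] D[OF sym] in simp)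
    then show ?thesis using D[OF S] by simp
  qed
  \<comment> \<open>The candidate is read off from \<open>key'\<close> by dividing by
    \<open>weight \<kappa>\<close> and normalizing at the identity; the default 0 is what
    \<open>gen_binomial\<close> prescribes.\<close>
  define b where "b \<sigma> = (if \<sigma> \<in> (\<Union>s\<le>k. ?P s) then \<gamma> \<sigma> * weight \<sigma> * zonal \<sigma> (mat 1 :: ('m, 'm) rmat) / (weight \<kappa> * zonal \<kappa> (mat 1 :: ('m, 'm) rmat)) else 0)" for \<sigma>
  let ?z1 = "\<lambda>\<sigma>. zonal \<sigma> (mat 1 :: ('m, 'm) rmat)"
  note z1 = zonal_one_nonzero[where 'm = 'm]
  have beq: "b \<sigma> * (zonal \<sigma> S / ?z1 \<sigma>) = \<gamma> \<sigma> * weight \<sigma> * zonal \<sigma> S / (weight \<kappa> * ?z1 \<kappa>)" if "\<sigma> \<in> ?P s" "s \<le> k" for \<sigma> s S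
    using that z1[OF that(1)] by (auto simp: b_def)
  have gb: "gen_binomial TYPE('m) \<kappa> = b"
    unfolding gen_binomial_def partitionsD(3)[OF \<kappa>]
  proof (rule the_equality)
    have "zonal \<kappa> (S + mat 1) / ?z1 \<kappa> = (\<Sum>s\<le>k. \<Sum>\<sigma>\<in>?P s. b \<sigma> * (zonal \<sigma> S / ?z1 \<sigma>))"
      if "transpose S = S" for S :: "('m, 'm) rmat"
    proof -
      have "(\<Sum>s\<le>k. \<Sum>\<sigma>\<in>?P s. b \<sigma> * (zonal \<sigma> S / ?z1 \<sigma>)) = (\<Sum>s\<le>k. \<Sum>\<sigma>\<in>?P s. \<gamma> \<sigma> * weight \<sigma> * zonal \<sigma> S / (weight \<kappa> * ?z1 \<kappa>))"
        by (intro sum.cong refl beq) auto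
      also have "\<dots> = (weight \<kappa> * zonal \<kappa> (S + mat 1)) / (weight \<kappa> * ?z1 \<kappa>)"
        unfolding key'[OF that] by (simp add: sum_divide_distrib)
      finally show ?thesis using wp[of \<kappa>] by simp
    qed
    moreover have "\<forall>\<sigma>. \<sigma> \<notin> (\<Union>s\<le>k. ?P s) \<longrightarrow> b \<sigma> = 0" unfolding b_def by simp
    ultimately show ex: "(\<forall>\<sigma>. \<sigma> \<notin> (\<Union>s\<le>k. ?P s) \<longrightarrow> b \<sigma> = 0) \<and> (\<forall>S :: ('m, 'm) rmat. transpose S = S \<longrightarrow>
      zonal \<kappa> (S + mat 1) / ?z1 \<kappa> = (\<Sum>s\<le>k. \<Sum>\<sigma>\<in>?P s. b \<sigma> * (zonal \<sigma> S / ?z1 \<sigma>)))"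
      by (intro conjI allI impI) blast+
    fix b' assume b': "(\<forall>\<sigma>. \<sigma> \<notin> (\<Union>s\<le>k. ?P s) \<longrightarrow> b' \<sigma> = 0) \<and> (\<forall>S :: ('m, 'm) rmat. transpose S = S \<longrightarrow>
      zonal \<kappa> (S + mat 1) / ?z1 \<kappa> = (\<Sum>s\<le>k. \<Sum>\<sigma>\<in>?P s. b' \<sigma> * (zonal \<sigma> S / ?z1 \<sigma>)))"
    show "b' = b"
    proof
      fix \<tau>
      show "b' \<tau> = b \<tau>"
      proof (cases "\<tau> \<in> (\<Union>s\<le>k. ?P s)")
        case True
        then obtain s where s: "\<tau> \<in> ?P s" "s \<le> k" by auto
        have "(b' \<tau> - b \<tau>) / ?z1 \<tau> = 0"
        proof (rule zonal_coefficients_zero_inhomogeneous[where c = "\<lambda>\<sigma>. (b' \<sigma> - b \<sigma>) / ?z1 \<sigma>", OF _ s])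
          fix S :: "('m, 'm) rmat" assume S: "transpose S = S"
          have "(\<Sum>s\<le>k. \<Sum>\<sigma>\<in>?P s. b' \<sigma> * (zonal \<sigma> S / ?z1 \<sigma>)) = (\<Sum>s\<le>k. \<Sum>\<sigma>\<in>?P s. b \<sigma> * (zonal \<sigma> S / ?z1 \<sigma>))"
            using conjunct2[OF ex, rule_format, OF S] conjunct2[OF b', rule_format, OF S] by (simp only:)
          moreover have "(b' \<sigma> - b \<sigma>) / ?z1 \<sigma> * zonal \<sigma> S = b' \<sigma> * (zonal \<sigma> S / ?z1 \<sigma>) - b \<sigma> * (zonal \<sigma> S / ?z1 \<sigma>)" for \<sigma>
            by (simp add: left_diff_distrib diff_divide_distrib)
          ultimately show "(\<Sum>s\<le>k. \<Sum>\<sigma>\<in>?P s. (b' \<sigma> - b \<sigma>) / ?z1 \<sigma> * zonal \<sigma> S) = 0"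
            by (simp add: sum_subtractf)
        qed
        then show ?thesis using z1[OF s(1)] by simp
      qed (use b' in \<open>simp add: b_def\<close>)
    qed
  qed
  let ?S = "x ** transpose x"
  have "laguerre ((real CARD('n) - real CARD('m) - 1) / 2) \<kappa> ((1/2) *\<^sub>R ?S) =
    ?p \<kappa> * ?z1 \<kappa> * (\<Sum>s\<le>k. \<Sum>\<sigma>\<in>?P s. b \<sigma> * ((-1) ^ s / ?p \<sigma>) * (zonal \<sigma> ((1/2) *\<^sub>R ?S) / ?z1 \<sigma>))"
  proof -
    have "(real CARD('n) - real CARD('m) - 1) / 2 + (real CARD('m) + 1) / 2 = real CARD('n) / 2"
      by (simp add: field_simps)
    then show ?thesis by (simp only: laguerre_def gb partitionsD(3)[OF \<kappa>])
  qed
  \<comment> \<open>\<open>weight \<sigma>\<close> is 2^s times (n/2)_\<sigma>: this cancels the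
    denominator in the Laguerre polynomial and the factor 2^(-s) caused by its argument S /
    2.\<close>
  also have "\<dots> = ?p \<kappa> * ?z1 \<kappa> * (\<Sum>s\<le>k. \<Sum>\<sigma>\<in>?P s. (-1) ^ s * (\<gamma> \<sigma> * pull (zonal \<sigma>) x) / (2 ^ k * ?p \<kappa> * ?z1 \<kappa>))"
  proof (intro arg_cong[where f = "\<lambda>z. ?p \<kappa> * ?z1 \<kappa> * z"] sum.cong refl)
    fix s \<sigma> assume s: "s \<in> {..k}" and \<sigma>: "\<sigma> \<in> ?P s"
    have "b \<sigma> * ((-1) ^ s / ?p \<sigma>) * (zonal \<sigma> ((1/2) *\<^sub>R ?S) / ?z1 \<sigma>) =
      (b \<sigma> * (zonal \<sigma> ?S / ?z1 \<sigma>)) * ((-1) ^ s * (1/2) ^ s / ?p \<sigma>)"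
      by (simp add: zonal_scaleR[OF \<sigma> gram_symmetric] mult_ac)
    also have "\<dots> = (\<gamma> \<sigma> * weight \<sigma> * zonal \<sigma> ?S / (weight \<kappa> * ?z1 \<kappa>)) * ((-1) ^ s * (1/2) ^ s / ?p \<sigma>)"
      using beq[OF \<sigma>, of ?S] s by (simp only: atMost_iff)
    also have "\<dots> = (-1) ^ s * (\<gamma> \<sigma> * pull (zonal \<sigma>) x) / (2 ^ k * ?p \<kappa> * ?z1 \<kappa>)"
      using p[of \<sigma>] p[of \<kappa>] z1[OF \<kappa>]
      by (simp add: weight_def partitionsD(3)[OF \<sigma>] partitionsD(3)[OF \<kappa>] pull_def power_one_over field_simps)
    finally show "b \<sigma> * ((-1) ^ s / ?p \<sigma>) * (zonal \<sigma> ((1/2) *\<^sub>R ?S) / ?z1 \<sigma>) =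
      (-1) ^ s * (\<gamma> \<sigma> * pull (zonal \<sigma>) x) / (2 ^ k * ?p \<kappa> * ?z1 \<kappa>)" .
  qed
  also have "\<dots> = (\<Sum>s\<le>k. \<Sum>\<sigma>\<in>?P s. (-1) ^ s * (\<gamma> \<sigma> * pull (zonal \<sigma>) x)) / 2 ^ k"
    using p[of \<kappa>] z1[OF \<kappa>] by (simp add: sum_divide_distrib[symmetric])
  also have "(\<Sum>s\<le>k. \<Sum>\<sigma>\<in>?P s. (-1) ^ s * (\<gamma> \<sigma> * pull (zonal \<sigma>) x)) = (\<Sum>s\<le>k. (-1) ^ s * herm_part (k - s) x)"
    by (intro sum.cong refl) (simp add: \<gamma> sum_distrib_left)
  also have "\<dots> = (\<Sum>j\<le>k. (-1) ^ (k - j) * herm_part j x)" by (subst rev) simp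
  also have "\<dots> = (-1) ^ k * (\<Sum>j\<le>k. (-1) ^ j * herm_part j x)"
    unfolding sum_distrib_left
    by (intro sum.cong refl) (auto simp: mult.assoc[symmetric] power_add[symmetric] minus_one_power_iff)
  also have "(\<Sum>j\<le>k. (-1) ^ j * herm_part j x) = (\<Sum>a\<in>A. \<alpha> a * herm (2 * k) (- (norm a)\<^sup>2) (a \<bullet> x))"
    using sum_herm_part[of "-1" x] by simp
  finally have L: "laguerre ((real CARD('n) - real CARD('m) - 1) / 2) \<kappa> ((1/2) *\<^sub>R ?S) =
    (-1) ^ k * (\<Sum>a\<in>A. \<alpha> a * herm (2 * k) (- (norm a)\<^sup>2) (a \<bullet> x)) / 2 ^ k" .
  \<comment> \<open>One factor 2^k stems from \<open>weight \<kappa>\<close>, the other from the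
    definition of \<open>hermite\<close>, and the two signs cancel.\<close>
  have four: "inverse ((-2) ^ k) * ((-1) ^ k / 2 ^ k) = (inverse (4 ^ k) :: real)"
  proof -
    have "(-2 :: real) ^ k = (-1) ^ k * 2 ^ k" "(4 :: real) ^ k = 2 ^ k * 2 ^ k"
      by (simp_all add: power_mult_distrib[symmetric])
    then show ?thesis by (simp add: field_simps power_mult_distrib[symmetric])
  qed
  let ?H = "\<Sum>a\<in>A. \<alpha> a * herm (2 * k) (- (norm a)\<^sup>2) (a \<bullet> x)"
  have "hermite \<kappa> x = (inverse ((-2) ^ k) * ((-1) ^ k / 2 ^ k)) * (inverse (?p \<kappa>) * ?H)"
    unfolding hermite_def L partitionsD(3)[OF \<kappa>] by simp
  then show ?thesis unfolding four by (simp only: mult.assoc)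
qed

end

section \<open>Zonal polynomials in different dimensions\<close>

lemma homs_congruence:
  fixes A :: "('n::finite, 'n) rmat"
  assumes "f \<in> homs k"
  shows "(\<lambda>x :: ('m::finite, 'n) rmat. f (x ** A ** transpose x)) \<in> homs (2 * k)"
  using assms
proof (induction rule: homs_induct)
  case (power B)
  have "(\<lambda>x :: ('m, 'n) rmat. (x ** A ** transpose x) $ i $ j) \<in> homs 2" for i j
  proof -
    have "(\<lambda>x :: ('m, 'n) rmat. \<Sum>d\<in>UNIV. \<Sum>c\<in>UNIV. A $ c $ d * (x $ i $ c * x $ j $ d)) \<in> homs (1 + 1)"
      by (intro homs_sum homs_scale homs_mult entry_homs)
    moreover have "(x ** A ** transpose x) $ i $ j = (\<Sum>d\<in>UNIV. \<Sum>c\<in>UNIV. A $ c $ d * (x $ i $ c * x $ j $ d))" for x :: "('m, 'n) rmat"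
      by (simp add: matrix_matrix_mult_def transpose_def sum_distrib_right sum_distrib_left mult_ac)
    ultimately show ?thesis by (simp add: numeral_2_eq_2)
  qed
  then have "(\<lambda>x :: ('m, 'n) rmat. B \<bullet> (x ** A ** transpose x)) \<in> homs 2"
    unfolding inner_rmat by (intro homs_sum homs_scale)
  from homs_pow[OF this, of k] show ?case by (simp add: mult.commute)
qed (auto intro: homs_zero homs_add homs_scale)

context
  fixes \<iota> :: "'l::{finite,linorder} \<Rightarrow> 'n::{finite,linorder}"
  assumes \<iota>: "\<And>i. rank_of (\<iota> i) = rank_of i"
begin

lemma \<iota>_less_iff: "\<iota> i < \<iota> j \<longleftrightarrow> i < j"
  by (metis \<iota> rank_of_less_iff)

lemma \<iota>_inj: "inj \<iota>"
  by (metis \<iota> inj_onI inj_eq[OF inj_rank_of])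

lemma not_range_\<iota>: "j \<notin> range \<iota> \<longleftrightarrow> CARD('l) \<le> rank_of j"
proof
  assume "j \<notin> range \<iota>"
  then show "CARD('l) \<le> rank_of j"
    by (metis \<iota> ex_rank_of inj_eq[OF inj_rank_of] not_less rangeI)
next
  assume "CARD('l) \<le> rank_of j"
  then show "j \<notin> range \<iota>" using \<iota> rank_of_less_card by (metis not_less rangeE)
qed

text \<open>Selects the first rows, as \<iota> preserves positions;
  \<open>sel ** A ** transpose sel\<close> is a leading principal block of A.\<close>

definition sel :: "('l, 'n) rmat" where
  "sel = (\<chi> i j. if j = \<iota> i then 1 else 0)"

lemma sel_mult: "(sel ** A) $ i = A $ \<iota> i" for A :: "('n, 'k::finite) rmat"
  by (simp add: vec_eq_iff sel_def matrix_matrix_mult_def if_distrib[where f = "\<lambda>z. z * c" for c] cong: if_cong)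

lemma mult_sel_transpose: "(A ** transpose sel) $ i $ j = A $ i $ \<iota> j" for A :: "('k::finite, 'n) rmat"
  by (simp add: transpose_def sel_def matrix_matrix_mult_def if_distrib[where f = "\<lambda>z. c * z" for c] cong: if_cong)

lemma sel_sel: "sel ** transpose sel = mat 1"
  by (simp add: vec_eq_iff mult_sel_transpose mat_def inj_eq[OF \<iota>_inj]) (auto simp: sel_def inj_eq[OF \<iota>_inj])

text \<open>The first rows of a lower triangular matrix vanish beyond the leading block.\<close>

lemma lower_sel:
  assumes "lower T"
  shows "sel ** T = (sel ** T ** transpose sel) ** sel" "lower (sel ** T ** transpose sel)"
proof -
  have e: "(sel ** T ** transpose sel) $ i $ j = T $ \<iota> i $ \<iota> j" for i j
    by (simp add: mult_sel_transpose sel_mult)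
  show "lower (sel ** T ** transpose sel)" using assms by (simp add: lower_def e \<iota>_less_iff)
  have "((sel ** T ** transpose sel) ** sel) $ i $ j = T $ \<iota> i $ j" for i j
  proof (cases "j \<in> range \<iota>")
    case True
    then obtain a where a: "j = \<iota> a" by auto
    have "((sel ** T ** transpose sel) ** sel) $ i $ j = (\<Sum>b\<in>UNIV. T $ \<iota> i $ \<iota> b * sel $ b $ j)"
      by (simp add: matrix_matrix_mult_def[of _ sel] e)
    also have "\<dots> = (\<Sum>b\<in>{a}. T $ \<iota> i $ \<iota> b)"
      by (rule sum.mono_neutral_cong_right) (auto simp: sel_def a inj_eq[OF \<iota>_inj])
    finally show ?thesis using a by simp
  next
    case False
    then have "rank_of (\<iota> i) < rank_of j" using not_range_\<iota>[of j] rank_of_less_card[of i] by (simp add: \<iota>)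
    then have "T $ \<iota> i $ j = 0" using assms by (simp add: lower_def rank_of_less_iff)
    moreover have "sel $ b $ j = 0" for b using False by (auto simp: sel_def)
    ultimately show ?thesis by (simp add: matrix_matrix_mult_def[of _ sel])
  qed
  then show "sel ** T = (sel ** T ** transpose sel) ** sel" by (simp add: vec_eq_iff sel_mult)
qed

context
  fixes \<sigma> :: "nat \<Rightarrow> nat" and s :: nat
  assumes \<sigma>: "\<sigma> \<in> partitions CARD('l) s" "\<sigma> \<in> partitions CARD('n) s"
begin

lemma chi_sel: "chi \<sigma> (sel ** T ** transpose sel) = chi \<sigma> T"
proof -
  have z: "\<sigma> (rank_of j) = 0" if "j \<notin> range \<iota>" for j
    using that partitionsD(2)[OF \<sigma>(1), of "rank_of j"] by (simp only: not_range_\<iota>)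
  have "chi \<sigma> T = (\<Prod>j\<in>range \<iota>. (T $ j $ j) ^ (2 * \<sigma> (rank_of j)))"
    unfolding chi_def by (rule prod.mono_neutral_right) (simp_all add: z)
  also have "\<dots> = chi \<sigma> (sel ** T ** transpose sel)"
    by (simp add: prod.reindex[OF \<iota>_inj] chi_def mult_sel_transpose sel_mult \<iota>)
  finally show ?thesis by simp
qed

text \<open>As a function of the larger matrix, the value at the leading block is semi-invariant
  with the same character, since the parts of \<sigma> beyond \<ell> are 0. Uniqueness of
  semi-invariants then spares a comparison of minors across two index types.\<close>

lemma power_poly_corner:
  fixes A :: "('n, 'n) rmat"
  assumes A: "transpose A = A"
  shows "power_poly \<sigma> (sel ** A ** transpose sel) = power_poly \<sigma> A"
proof -
  obtain f where f: "f \<in> homs s" "(power_poly \<sigma> :: ('l, 'l) rmat \<Rightarrow> real) = on_sym f"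
    using power_poly_hom[OF \<sigma>(1)] by (auto simp: hom_polys_eq)
  define P where "P = on_sym (\<lambda>A :: ('n, 'n) rmat. f (sel ** A ** transpose sel))"
  have P: "P \<in> hom_polys s" unfolding P_def
    by (intro on_sym_hom_polys homs_compose[OF f(1) linear_congruence])
  have PA: "P A = power_poly \<sigma> (sel ** A ** transpose sel)" if "transpose A = A" for A
    using that transpose_congruence[OF that, of sel] by (simp add: P_def f(2) on_sym_def)
  have "act T P = (\<lambda>S. chi \<sigma> T * P S)" if T: "lower T" "invertible T" for T
  proof
    fix S :: "('n, 'n) rmat"
    show "act T P S = chi \<sigma> T * P S"
    proof (cases "transpose S = S")
      case True
      let ?K = "sel ** T ** transpose sel"
      have "sel ** (T ** S ** transpose T) ** transpose sel = (sel ** T) ** S ** transpose (sel ** T)"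
        by (simp add: matrix_transpose_mul matrix_mul_assoc)
      also have "\<dots> = (?K ** sel) ** S ** transpose (?K ** sel)" by (simp only: lower_sel(1)[OF T(1), symmetric])
      also have "\<dots> = ?K ** (sel ** S ** transpose sel) ** transpose ?K"
        by (simp add: matrix_transpose_mul matrix_mul_assoc)
      finally have "act T P S = power_poly \<sigma> (?K ** (sel ** S ** transpose sel) ** transpose ?K)"
        using PA[OF transpose_congruence[OF True, of T]] by (simp add: act_def)
      also have "\<dots> = chi \<sigma> ?K * power_poly \<sigma> (sel ** S ** transpose sel)"
        by (rule power_poly_congruence[OF \<sigma>(1) lower_sel(2)[OF T(1)] transpose_congruence[OF True]])
      finally show ?thesis by (simp add: chi_sel PA[OF True])
    next
      case False
      then show ?thesis
        using hom_polys_not_sym[OF P False] hom_polys_not_sym[OF act_hom_polys[OF P T(2)] False] by simp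
    qed
  qed
  then have "P = (\<lambda>S. P (mat 1) * power_poly \<sigma> S)" by (rule semi_invariant_unique[OF \<sigma>(2) P])
  moreover have "P (mat 1) = 1"
    by (simp add: PA transpose_mat sel_sel power_poly_mat_1[OF \<sigma>(1)])
  ultimately have "P A = power_poly \<sigma> A" by (metis mult_1)
  then show ?thesis using PA[OF A] by simp
qed

text \<open>If x = sel h with h invertible, the function is a translate of
  \<open>power_poly \<sigma>\<close> of the larger size. On the line from \<open>sel\<close> to x
  this is the case for small parameters; hence all coefficients in the parameter lie in V_\<sigma>,
  and so does the value at the end.\<close>

lemma power_poly_congruence_zspace:
  fixes x :: "('l, 'n) rmat"
  shows "on_sym (\<lambda>A :: ('n, 'n) rmat. power_poly \<sigma> (x ** A ** transpose x)) \<in> zspace \<sigma>"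
proof -
  obtain f where f: "f \<in> homs s" "(power_poly \<sigma> :: ('l, 'l) rmat \<Rightarrow> real) = on_sym f"
    using power_poly_hom[OF \<sigma>(1)] by (auto simp: hom_polys_eq)
  define D where "D = x - sel"
  have "\<exists>v. \<forall>t. f ((sel + t *\<^sub>R D) ** A ** transpose (sel + t *\<^sub>R D)) = (\<Sum>i\<le>2 * s. t ^ i * v i)" for A :: "('n, 'n) rmat"
    using homs_line[OF homs_congruence[OF f(1), of A], of D] by metis
  then obtain v where v: "\<And>A t. f ((sel + t *\<^sub>R D) ** A ** transpose (sel + t *\<^sub>R D)) = (\<Sum>i\<le>2 * s. t ^ i * v A i)" by metis
  define w where "w i A = (if transpose A = A then v A i else 0)" for i and A :: "('n, 'n) rmat"
  have pp: "on_sym (\<lambda>A :: ('n, 'n) rmat. power_poly \<sigma> ((sel + t *\<^sub>R D) ** A ** transpose (sel + t *\<^sub>R D))) = (\<lambda>A. \<Sum>i\<le>2 * s. t ^ i * w i A)" for t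
    using transpose_congruence[where g = "sel + t *\<^sub>R D"]
    by (auto simp: on_sym_def fun_eq_iff f(2) w_def v)
  obtain e where e: "0 < e" "\<And>t. 0 < t \<Longrightarrow> t < e \<Longrightarrow> pos_form (mat 1 + t *\<^sub>R (transpose sel ** D))"
    using pos_form_near_mat_1 by blast
  have w: "w i \<in> zspace \<sigma>" if "i \<in> {..2 * s}" for i
  proof (rule coefficients_in_subspace[OF subspace_zspace _ e(1) _ that])
    fix t :: real assume t: "0 < t" "t < e"
    \<comment> \<open>Chosen such that \<open>sel ** ?h = sel + t *\<^sub>R D\<close>, which holds
      because \<open>sel ** transpose sel\<close> is the identity.\<close>
    let ?h = "mat 1 + t *\<^sub>R (transpose sel ** D)"
    have h: "invertible ?h" by (rule pos_form_invertible[OF e(2)[OF t]])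
    have "sel ** ?h = sel + t *\<^sub>R D"
    proof -
      have "sel ** ?h = sel ** mat 1 + t *\<^sub>R (sel ** (transpose sel ** D))"
        by (simp only: linear_add[OF linear_matrix_mult_left] linear_cmul[OF linear_matrix_mult_left])
      then show ?thesis by (simp add: matrix_mul_assoc sel_sel)
    qed
    then have eq: "(sel + t *\<^sub>R D) ** A ** transpose (sel + t *\<^sub>R D) = sel ** (?h ** A ** transpose ?h) ** transpose sel" for A
      by (simp add: matrix_transpose_mul matrix_mul_assoc flip: \<open>sel ** ?h = sel + t *\<^sub>R D\<close>)
    have "on_sym (\<lambda>A. power_poly \<sigma> ((sel + t *\<^sub>R D) ** A ** transpose (sel + t *\<^sub>R D))) = act ?h (power_poly \<sigma> :: ('n, 'n) rmat \<Rightarrow> real)"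
    proof
      fix A :: "('n, 'n) rmat"
      show "on_sym (\<lambda>A. power_poly \<sigma> ((sel + t *\<^sub>R D) ** A ** transpose (sel + t *\<^sub>R D))) A = act ?h (power_poly \<sigma>) A"
      proof (cases "transpose A = A")
        case True
        then show ?thesis
          using power_poly_corner[OF transpose_congruence[OF True, of ?h]] by (simp only: on_sym_def if_True simp_thms eq act_def)
      next
        case False
        then show ?thesis
          using hom_polys_not_sym[OF act_hom_polys[OF power_poly_hom[OF \<sigma>(2)] h] False] by (simp add: on_sym_def)
      qed
    qed
    then show "(\<lambda>A. \<Sum>i\<in>{..2 * s}. t ^ i * w i A) \<in> zspace \<sigma>"
      using zspace_act[OF power_poly_in_zspace h] by (simp only: pp)
  qed simp
  have "(\<lambda>A. \<Sum>i\<le>2 * s. 1 ^ i * w i A) \<in> zspace \<sigma>"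
    by (intro subspace_fun_sum subspace_fun_scale subspace_zspace w)
  then have "on_sym (\<lambda>A :: ('n, 'n) rmat. power_poly \<sigma> ((sel + 1 *\<^sub>R D) ** A ** transpose (sel + 1 *\<^sub>R D))) \<in> zspace \<sigma>"
    by (simp only: pp)
  then show ?thesis by (simp add: D_def)
qed

lemma zspace_congruence:
  fixes x :: "('l, 'n) rmat"
  assumes "P \<in> zspace \<sigma>"
  shows "on_sym (\<lambda>A :: ('n, 'n) rmat. P (x ** A ** transpose x)) \<in> zspace \<sigma>"
  using assms
proof (induction rule: zspace_induct)
  case (act g)
  have "act g (power_poly \<sigma>) (x ** A ** transpose x) = power_poly \<sigma> ((g ** x) ** A ** transpose (g ** x))" for A :: "('n, 'n) rmat"
    by (simp add: act_def matrix_transpose_mul matrix_mul_assoc)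
  then show ?case using power_poly_congruence_zspace[of "g ** x"] by simp
next
  case (add P Q)
  have "on_sym (\<lambda>A :: ('n, 'n) rmat. P (x ** A ** transpose x) + Q (x ** A ** transpose x)) =
    (\<lambda>A. on_sym (\<lambda>A. P (x ** A ** transpose x)) A + on_sym (\<lambda>A. Q (x ** A ** transpose x)) A)"
    by (auto simp: on_sym_def)
  then show ?case using subspace_fun_add[OF subspace_zspace add.IH] by simp
next
  case (scale c P)
  have "on_sym (\<lambda>A :: ('n, 'n) rmat. c * P (x ** A ** transpose x)) =
    (\<lambda>A. c * on_sym (\<lambda>A. P (x ** A ** transpose x)) A)"
    by (auto simp: on_sym_def)
  then show ?case using subspace_fun_scale[OF subspace_zspace scale.IH] by simp
qed

end

end

text \<open>An invariant element is a combination of spherical elements; as the sum of the spaces is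
  direct, only the term for \<sigma> survives, so the invariants in V_\<sigma> form a line.\<close>

lemma zspace_invariant_multiple_zonal:
  fixes F :: "('m::{finite,linorder}, 'm) rmat \<Rightarrow> real"
  assumes \<sigma>: "\<sigma> \<in> partitions CARD('m) k" and F: "F \<in> zspace \<sigma>" "\<And>h. orthogonal_matrix h \<Longrightarrow> act h F = F"
  shows "F S * zonal \<sigma> (mat 1 :: ('m, 'm) rmat) = F (mat 1) * zonal \<sigma> S"
proof -
  let ?P = "partitions CARD('m) k"
  have "F \<in> hom_polys k" using F(1) zspace_hom_polys[OF \<sigma>] by blast
  then obtain c where c: "F = (\<lambda>S. \<Sum>\<kappa>\<in>?P. c \<kappa> * sph \<kappa> S)" by (rule invariant_span[OF _ F(2)])
  define d where "d \<tau> S = c \<tau> * sph \<tau> S - (if \<tau> = \<sigma> then F S else 0)" for \<tau> S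
  have "d \<sigma> = (\<lambda>S. 0)"
  proof (rule zspace_components_unique[OF _ _ \<sigma>])
    fix \<tau> assume \<tau>: "\<tau> \<in> ?P"
    have "(\<lambda>S. if \<tau> = \<sigma> then F S else 0) \<in> zspace \<tau>"
      using F(1) subspace_fun_zero[OF subspace_zspace] by (cases "\<tau> = \<sigma>") auto
    then show "d \<tau> \<in> zspace \<tau>"
      unfolding d_def[abs_def] by (intro subspace_fun_diff subspace_fun_scale subspace_zspace sph_zspace[OF \<tau>])
  next
    fix S
    have "(\<Sum>\<tau>\<in>?P. d \<tau> S) = F S - (\<Sum>\<tau>\<in>?P. if \<tau> = \<sigma> then F S else 0)"
      unfolding d_def sum_subtractf using fun_cong[OF c, of S] by simp
    then show "(\<Sum>\<tau>\<in>?P. d \<tau> S) = 0" using \<sigma> partitions_finite by simp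
  qed
  then have Fc: "F S = c \<sigma> * sph \<sigma> S" for S by (simp add: d_def fun_eq_iff)
  show ?thesis
    by (rule zonal_multiple_sph[OF \<sigma>]) (simp add: Fc)
qed

section \<open>The covariance of Hermite polynomials\<close>

text \<open>By orthogonality one of the two factors may be replaced by the trace power, to which
  \<open>fischer_trace_power\<close> applies. The constant 4^k is 2^k from \<open>weight\<close>
  times 2^k from the Gaussian moment.\<close>

lemma gram_form_zonal_self:
  assumes le: "CARD('l::{finite,linorder}) \<le> CARD('n::finite)" and \<kappa>: "\<kappa> \<in> partitions CARD('l) k"
  shows "gram_form TYPE('n) k (zonal \<kappa> :: ('l, 'l) rmat \<Rightarrow> real) (zonal \<kappa>) =
    4 ^ k * fact k * gen_pochhammer CARD('l) (real CARD('n) / 2) \<kappa> * zonal \<kappa> (mat 1 :: ('l, 'l) rmat) / fact (2 * k)"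
proof -
  let ?P = "partitions CARD('l) k" and ?B = "gram_form TYPE('n) k" and ?C = "\<lambda>\<tau>. zonal \<tau> :: ('l, 'l) rmat \<Rightarrow> real"
  obtain M :: "(('l, 'n) rmat \<Rightarrow> real) measure" and \<zeta> where "gaussian M (\<zeta> :: _ \<Rightarrow> ('l, 'n) rmat)"
    using ex_gaussian by blast
  then interpret gaussian_matrix M \<zeta> by (simp add: gaussian_matrix_def)
  have h: "?C \<tau> \<in> hom_polys k" if "\<tau> \<in> ?P" for \<tau> by (rule zonal_hom_polys[OF that])
  have eq: "trace_power k = (\<lambda>S :: ('l, 'l) rmat. \<Sum>\<tau>\<in>?P. zonal \<tau> S)" by (simp add: fun_eq_iff trace_power_zonal)
  have "?B (trace_power k) (?C \<kappa>) = (\<Sum>\<tau>\<in>?P. ?B (?C \<tau>) (?C \<kappa>))"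
    unfolding gram_form_def eq pull_sum by (subst fischer_sum_left) (auto intro!: pull_homs h \<kappa>)
  also have "\<dots> = (\<Sum>\<tau>\<in>{\<kappa>}. ?B (?C \<tau>) (?C \<kappa>))"
    using zspace_orthogonal[OF _ \<kappa> _ zonal_zspace zonal_zspace[OF \<kappa>]] \<kappa> partitions_finite
    by (intro sum.mono_neutral_right) auto
  finally have "?B (?C \<kappa>) (?C \<kappa>) = ?B (trace_power k) (?C \<kappa>)" by simp
  moreover have "gauss_moment (2 * k) * ?B (trace_power k) (?C \<kappa>) = weight \<kappa> * ?C \<kappa> (mat 1)"
    by (rule fischer_trace_power[OF \<kappa> zonal_zspace[OF \<kappa>]])
  ultimately have "fact (2 * k) / (2 ^ k * fact k) * ?B (?C \<kappa>) (?C \<kappa>) =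
    2 ^ k * gen_pochhammer CARD('l) (real CARD('n) / 2) \<kappa> * ?C \<kappa> (mat 1)"
    by (simp add: gauss_moment_even weight_def partitionsD(3)[OF \<kappa>])
  moreover have "(4 :: real) ^ k = 2 ^ k * 2 ^ k" by (simp add: power_mult_distrib[symmetric])
  ultimately show ?thesis by (simp add: field_simps)
qed

lemma fischer_zonal_congruence:
  fixes A :: "('n::{finite,linorder}, 'n) rmat"
  assumes le: "CARD('l::{finite,linorder}) \<le> CARD('n)"
    and \<kappa>: "\<kappa> \<in> partitions CARD('l) k" and \<sigma>: "\<sigma> \<in> partitions CARD('l) k" and A: "transpose A = A"
  shows "fischer (2 * k) (pull (zonal \<kappa> :: ('l, 'l) rmat \<Rightarrow> real)) (\<lambda>x. zonal \<sigma> (x ** A ** transpose x)) * zonal \<sigma> (mat 1 :: ('n, 'n) rmat) =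
    gram_form TYPE('n) k (zonal \<kappa> :: ('l, 'l) rmat \<Rightarrow> real) (zonal \<sigma>) * zonal \<sigma> A"
proof -
  let ?q = "pull (zonal \<kappa> :: ('l, 'l) rmat \<Rightarrow> real) :: ('l, 'n) rmat \<Rightarrow> real"
  have \<sigma>n: "\<sigma> \<in> partitions CARD('n) k" by (rule partitions_mono[OF le \<sigma>])
  have q: "?q \<in> homs (2 * k)" by (rule pull_homs[OF zonal_hom_polys[OF \<kappa>]])
  obtain B \<beta> where B: "finite B" "?q = (\<lambda>x. \<Sum>a\<in>B. \<beta> a * (a \<bullet> x) ^ (2 * k))" by (rule homs_repr[OF q])
  have "\<exists>j :: 'n. rank_of j = rank_of i" for i :: 'l
    using ex_rank_of[of "rank_of i"] rank_of_less_card[of i] le by (metis order_less_le_trans)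
  then obtain \<iota> :: "'l \<Rightarrow> 'n" where \<iota>: "\<And>i. rank_of (\<iota> i) = rank_of i" by metis
  have z: "(\<lambda>x :: ('l, 'n) rmat. zonal \<sigma> (x ** A ** transpose x)) \<in> homs (2 * k)" if "transpose A = A" for A
  proof -
    obtain f where f: "f \<in> homs k" "(zonal \<sigma> :: ('l, 'l) rmat \<Rightarrow> real) = on_sym f"
      using zonal_hom_polys[OF \<sigma>] by (auto simp: hom_polys_eq)
    have "(\<lambda>x :: ('l, 'n) rmat. zonal \<sigma> (x ** A ** transpose x)) = (\<lambda>x. f (x ** A ** transpose x))"
      by (simp add: f(2) on_sym_def transpose_congruence[OF that])
    then show ?thesis using homs_congruence[OF f(1)] by simp
  qed
  \<comment> \<open>The pairing, expanded with a representation of its first argument;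
    \<open>on_sym\<close> makes every summand an element of \<open>zspace \<sigma>\<close> for the
    larger matrices.\<close>
  define F where "F A = (\<Sum>a\<in>B. \<beta> a * on_sym (\<lambda>A. zonal \<sigma> (a ** A ** transpose a)) A)" for A
  have FA: "F A = fischer (2 * k) ?q (\<lambda>x. zonal \<sigma> (x ** A ** transpose x))" if "transpose A = A" for A
    unfolding fischer_eq[OF B z[OF that]] using that by (simp add: F_def on_sym_def)
  have Fz: "F \<in> zspace \<sigma>"
    unfolding F_def[abs_def]
    by (intro subspace_fun_sum subspace_fun_scale subspace_zspace zspace_congruence[OF \<iota> \<sigma> \<sigma>n] zonal_zspace[OF \<sigma>])
  have inv: "act h F = F" if h: "orthogonal_matrix h" for h
  proof
    fix S
    show "act h F S = F S"
    proof (cases "transpose S = S")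
      case True
      have qh: "?q (x ** transpose h) = ?q x" for x
      proof -
        have "(x ** transpose h) ** transpose (x ** transpose h) = x ** (transpose h ** h) ** transpose x"
          by (simp add: matrix_transpose_mul matrix_mul_assoc)
        then show ?thesis using h by (simp add: pull_def orthogonal_matrix_def)
      qed
      \<comment> \<open>Congruence of S by h amounts to replacing x by x h, whose adjoint multiplies
        the other argument by \<open>transpose h\<close>; the Gram matrix there does not
        change.\<close>
      have "act h F S = fischer (2 * k) ?q (\<lambda>x. zonal \<sigma> ((x ** h) ** S ** transpose (x ** h)))"
        unfolding act_def using FA[OF transpose_congruence[OF True, of h]]
        by (simp add: matrix_transpose_mul matrix_mul_assoc)
      also have "\<dots> = fischer (2 * k) (\<lambda>x. ?q (x ** transpose h)) (\<lambda>x. zonal \<sigma> (x ** S ** transpose x))"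
        by (rule fischer_adjoint[OF q z[OF True] linear_matrix_mult_right linear_matrix_mult_right, symmetric])
           (simp add: inner_matrix_mult_right)
      also have "\<dots> = F S" by (simp add: qh FA[OF True])
      finally show ?thesis .
    next
      case False
      have "F \<in> hom_polys k" using Fz zspace_hom_polys[OF \<sigma>n] by blast
      then show ?thesis
        using False hom_polys_not_sym act_hom_polys orthogonal_imp_invertible[OF h] by metis
    qed
  qed
  have "F A * zonal \<sigma> (mat 1 :: ('n, 'n) rmat) = F (mat 1) * zonal \<sigma> A"
    by (rule zspace_invariant_multiple_zonal[OF \<sigma>n Fz inv])
  moreover have "F (mat 1) = gram_form TYPE('n) k (zonal \<kappa> :: ('l, 'l) rmat \<Rightarrow> real) (zonal \<sigma>)"
    using FA[OF transpose_mat] by (simp add: gram_form_def pull_def[abs_def])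
  ultimately show ?thesis by (simp add: FA[OF A])
qed

section \<open>Gaussian pairs and the covariance formula\<close>

lemma std_normal_matrix_inner:
  fixes X :: "'w \<Rightarrow> ('l::finite, 'n::finite) rmat"
  assumes M: "prob_space M" and X: "std_normal_matrix M X" and "a \<noteq> 0"
  shows "distributed M lborel (\<lambda>\<omega>. a \<bullet> X \<omega>) (normal_density 0 (norm a))"
proof -
  have n: "(\<Sum>ij\<in>UNIV. (a $ fst ij $ snd ij)\<^sup>2) = (norm a)\<^sup>2"
    by (simp add: power2_norm_eq_inner inner_rmat sum.cartesian_product UNIV_Times_UNIV[symmetric] case_prod_beta power2_eq_square[of "_ $ _"] del: UNIV_Times_UNIV)
  have X': "prob_space.indep_vars M (\<lambda>_. borel) (\<lambda>ij \<omega>. X \<omega> $ fst ij $ snd ij) UNIV"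
    "distributed M lborel (\<lambda>\<omega>. X \<omega> $ fst ij $ snd ij) std_normal_density" for ij
    using X by (auto simp: std_normal_matrix_def case_prod_beta')
  have "a \<bullet> X \<omega> = (\<Sum>ij\<in>UNIV. a $ fst ij $ snd ij * X \<omega> $ fst ij $ snd ij)" for \<omega>
    by (simp add: inner_rmat sum.cartesian_product UNIV_Times_UNIV[symmetric] case_prod_beta del: UNIV_Times_UNIV)
  then show ?thesis
    using normal_linear_combination[OF M finite_class.finite_UNIV X'(1) X'(2), of "\<lambda>ij. a $ fst ij $ snd ij"] \<open>a \<noteq> 0\<close>
    by (simp add: n)
qed

lemma gaussian_pair:
  fixes X X\<^sub>0 :: "'w \<Rightarrow> ('l::finite, 'n::finite) rmat"
  assumes M: "prob_space M" and X: "std_normal_matrix M X" "std_normal_matrix M X\<^sub>0"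
    and ind: "prob_space.indep_var M borel X borel X\<^sub>0"
  shows "gaussian M (\<lambda>\<omega>. (X \<omega>, X\<^sub>0 \<omega>))"
proof (rule gaussianI_normal[OF M])
  interpret prob_space M by (rule M)
  fix a :: "('l, 'n) rmat \<times> ('l, 'n) rmat" assume "a \<noteq> 0"
  obtain b c where a: "a = (b, c)" by (cases a)
  show "distributed M lborel (\<lambda>\<omega>. a \<bullet> (X \<omega>, X\<^sub>0 \<omega>)) (normal_density 0 (norm a))"
  \<comment> \<open>A normal law of standard deviation 0 has no density, so a vanishing component is
    treated separately.\<close>
  proof (cases "b = 0 \<or> c = 0")
    case True
    then show ?thesis
      using \<open>a \<noteq> 0\<close> std_normal_matrix_inner[OF M X(1), of b] std_normal_matrix_inner[OF M X(2), of c]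
      by (auto simp: a norm_Pair zero_prod_def)
  next
    case False
    have "indep_var borel ((\<lambda>x. b \<bullet> x) \<circ> X) borel ((\<lambda>x. c \<bullet> x) \<circ> X\<^sub>0)"
      by (rule indep_var_compose[OF ind]) auto
    then have "distributed M lborel (\<lambda>\<omega>. b \<bullet> X \<omega> + c \<bullet> X\<^sub>0 \<omega>) (normal_density (0 + 0) (sqrt ((norm b)\<^sup>2 + (norm c)\<^sup>2)))"
      using False by (intro add_indep_normal std_normal_matrix_inner[OF M] X) (auto simp: o_def)
    then show ?thesis by (simp add: a norm_Pair)
  qed
qed

lemma hermite_polys:
  assumes "CARD('l::{finite,linorder}) \<le> CARD('n::finite)" and \<kappa>: "\<kappa> \<in> partitions CARD('l) k"
  shows "(hermite \<kappa> :: ('l, 'n) rmat \<Rightarrow> real) \<in> polys"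
proof -
  obtain A \<alpha> where A: "finite A" "(pull (zonal \<kappa> :: ('l, 'l) rmat \<Rightarrow> real) :: ('l, 'n) rmat \<Rightarrow> real) = (\<lambda>x. \<Sum>a\<in>A. \<alpha> a * (a \<bullet> x) ^ (2 * k))"
    by (rule homs_repr[OF pull_homs[OF zonal_hom_polys[OF \<kappa>]]])
  show ?thesis
    unfolding hermite_eq[OF \<kappa> assms(1) A, abs_def] by (intro polys_scale polys_sum herm_polys)
qed

lemma pull_zonal_covariance:
  fixes R :: "('n::{finite,linorder}, 'n) rmat"
  assumes le: "CARD('l::{finite,linorder}) \<le> CARD('n)"
    and \<kappa>: "\<kappa> \<in> partitions CARD('l) k" and \<sigma>: "\<sigma> \<in> partitions CARD('l) k"
    and R: "transpose R = R"
  shows "fischer (2 * k) (pull (zonal \<kappa> :: ('l, 'l) rmat \<Rightarrow> real)) (\<lambda>x. pull (zonal \<sigma> :: ('l, 'l) rmat \<Rightarrow> real) (x ** R)) =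
    of_bool (\<kappa> = \<sigma>) * 4 ^ k * fact k * gen_pochhammer CARD('l) (real CARD('n) / 2) \<kappa> / fact (2 * k) *
      zonal \<kappa> (R ** R) * (zonal \<kappa> (mat 1 :: ('l, 'l) rmat) / zonal \<kappa> (mat 1 :: ('n, 'n) rmat))"
proof -
  have "transpose (R ** R) = R ** R" using R by (simp add: matrix_transpose_mul)
  from fischer_zonal_congruence[OF le \<kappa> \<sigma> this]
  have e: "fischer (2 * k) (pull (zonal \<kappa> :: ('l, 'l) rmat \<Rightarrow> real)) (\<lambda>x. pull (zonal \<sigma> :: ('l, 'l) rmat \<Rightarrow> real) (x ** R)) * zonal \<sigma> (mat 1 :: ('n, 'n) rmat) =
    gram_form TYPE('n) k (zonal \<kappa> :: ('l, 'l) rmat \<Rightarrow> real) (zonal \<sigma>) * zonal \<sigma> (R ** R)"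
    using R by (simp add: pull_def matrix_transpose_mul matrix_mul_assoc)
  have z: "zonal \<sigma> (mat 1 :: ('n, 'n) rmat) \<noteq> 0" by (rule zonal_one_nonzero[OF partitions_mono[OF le \<sigma>]])
  show ?thesis
  proof (cases "\<kappa> = \<sigma>")
    case True
    then show ?thesis using e z by (simp add: gram_form_zonal_self[OF le \<sigma>] field_simps)
  next
    case False
    then show ?thesis
      using e z zspace_orthogonal[where ty = "TYPE('n)", OF \<kappa> \<sigma> False zonal_zspace[OF \<kappa>] zonal_zspace[OF \<sigma>]] by simp
  qed
qed

lemma hermite_covariance:
  fixes R S :: "('n::{finite,linorder}, 'n) rmat" and \<zeta> :: "'w \<Rightarrow> ('l::{finite,linorder}, 'n) rmat \<times> ('l, 'n) rmat"
  assumes "gaussian M \<zeta>" and le: "CARD('l) \<le> CARD('n)"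
    and \<kappa>: "\<kappa> \<in> partitions CARD('l) k" and \<sigma>: "\<sigma> \<in> partitions CARD('l) l"
    and R: "transpose R = R" and S: "transpose S = S" and RS: "R ** R + S ** S = mat 1"
  shows "gaussian.E M \<zeta> (\<lambda>z. hermite \<kappa> (fst z) * hermite \<sigma> (fst z ** R + snd z ** S)) =
    of_bool (\<kappa> = \<sigma>) * inverse (4 ^ k) * inverse (gen_pochhammer CARD('l) (real CARD('n) / 2) \<kappa>) * fact k *
      zonal \<kappa> (R ** R) * (zonal \<kappa> (mat 1 :: ('l, 'l) rmat) / zonal \<kappa> (mat 1 :: ('n, 'n) rmat))"
proof -
  interpret gaussian M \<zeta> by fact
  let ?qk = "pull (zonal \<kappa> :: ('l, 'l) rmat \<Rightarrow> real) :: ('l, 'n) rmat \<Rightarrow> real"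
  let ?ql = "pull (zonal \<sigma> :: ('l, 'l) rmat \<Rightarrow> real) :: ('l, 'n) rmat \<Rightarrow> real"
  obtain A \<alpha> where A: "finite A" "?qk = (\<lambda>x. \<Sum>a\<in>A. \<alpha> a * (a \<bullet> x) ^ (2 * k))"
    by (rule homs_repr[OF pull_homs[OF zonal_hom_polys[OF \<kappa>]]])
  obtain B \<beta> where B: "finite B" "?ql = (\<lambda>x. \<Sum>b\<in>B. \<beta> b * (b \<bullet> x) ^ (2 * l))"
    by (rule homs_repr[OF pull_homs[OF zonal_hom_polys[OF \<sigma>]]])
  define c where "c = inverse (4 ^ k) * inverse (gen_pochhammer CARD('l) (real CARD('n) / 2) \<kappa>)"
  define d where "d = inverse (4 ^ l) * inverse (gen_pochhammer CARD('l) (real CARD('n) / 2) \<sigma>)"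
  let ?L = "\<lambda>a :: ('l, 'n) rmat. (a, 0 :: ('l, 'n) rmat)" and ?R = "\<lambda>b :: ('l, 'n) rmat. (b ** R, b ** S)"
  let ?h = "\<lambda>m v (z :: ('l, 'n) rmat \<times> ('l, 'n) rmat). herm m (- (norm v)\<^sup>2) (v \<bullet> z)"
  \<comment> \<open>Since R^2 + S^2 is the identity, b \<mapsto> (b R, b S) is isometric. Hence the
    parameter |b|^2 in the Hermite polynomial of Y is the variance that \<open>E_herm_herm\<close>
    requires.\<close>
  have nb: "(norm (?R b))\<^sup>2 = (norm b)\<^sup>2" for b
  proof -
    have "?R b \<bullet> ?R b = b \<bullet> (b ** (R ** R)) + b \<bullet> (b ** (S ** S))"
      by (simp add: inner_matrix_mult_right R S matrix_mul_assoc)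
    also have "\<dots> = b \<bullet> (b ** (R ** R + S ** S))" by (simp add: matrix_add_ldistrib inner_add_right)
    finally show ?thesis by (simp only: RS power2_norm_eq_inner matrix_mul_rid)
  qed
  have hk: "hermite \<kappa> (fst z) = c * (\<Sum>a\<in>A. \<alpha> a * ?h (2 * k) (?L a) z)" for z
    unfolding hermite_eq[OF \<kappa> le A] c_def by (cases z) (simp add: norm_Pair)
  have hl: "hermite \<sigma> (fst z ** R + snd z ** S) = d * (\<Sum>b\<in>B. \<beta> b * ?h (2 * l) (?R b) z)" for z
  proof -
    have "b \<bullet> (fst z ** R + snd z ** S) = ?R b \<bullet> z" for b
      by (cases z) (simp add: inner_matrix_mult_right R S inner_add_right)
    then show ?thesis unfolding hermite_eq[OF \<sigma> le B] d_def nb by simp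
  qed
  \<comment> \<open>The inner product on the left is the covariance of a . X and b . Y.\<close>
  have LR: "?L a \<bullet> ?R b = b \<bullet> (a ** R)" for a b
    using inner_matrix_mult_right[of b R a] by (simp add: R inner_commute)
  have "E (\<lambda>z. hermite \<kappa> (fst z) * hermite \<sigma> (fst z ** R + snd z ** S)) =
    E (\<lambda>z. c * d * (\<Sum>a\<in>A. \<Sum>b\<in>B. \<alpha> a * \<beta> b * (?h (2 * k) (?L a) z * ?h (2 * l) (?R b) z)))"
  proof (intro arg_cong[where f = E] ext)
    fix z
    let ?a = "\<lambda>a. \<alpha> a * ?h (2 * k) (?L a) z" and ?b = "\<lambda>b. \<beta> b * ?h (2 * l) (?R b) z"
    have "hermite \<kappa> (fst z) * hermite \<sigma> (fst z ** R + snd z ** S) = c * d * ((\<Sum>a\<in>A. ?a a) * (\<Sum>b\<in>B. ?b b))"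
      by (simp only: hk hl mult_ac)
    also have "\<dots> = c * d * (\<Sum>a\<in>A. \<Sum>b\<in>B. ?a a * ?b b)" by (simp only: sum_product)
    also have "\<dots> = c * d * (\<Sum>a\<in>A. \<Sum>b\<in>B. \<alpha> a * \<beta> b * (?h (2 * k) (?L a) z * ?h (2 * l) (?R b) z))"
      by (simp only: mult_ac)
    finally show "hermite \<kappa> (fst z) * hermite \<sigma> (fst z ** R + snd z ** S) = \<dots>" .
  qed
  also have "\<dots> = c * d * (\<Sum>a\<in>A. \<Sum>b\<in>B. \<alpha> a * \<beta> b * E (\<lambda>z. ?h (2 * k) (?L a) z * ?h (2 * l) (?R b) z))"
    by (simp only: E_scale) (simp add: E_sum E_scale polys_sum polys_scale polys_mult herm_polys)
  also have "\<dots> = c * d * (\<Sum>a\<in>A. \<Sum>b\<in>B. \<alpha> a * \<beta> b * (if k = l then fact (2 * k) * (b \<bullet> (a ** R)) ^ (2 * k) else 0))"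
    unfolding E_herm_herm LR by simp
  also have "\<dots> = c * d * (if k = l then fact (2 * k) * (\<Sum>a\<in>A. \<alpha> a * ?ql (a ** R)) else 0)"
    by (simp add: B(2) sum_distrib_left mult_ac)
  finally have eq: "E (\<lambda>z. hermite \<kappa> (fst z) * hermite \<sigma> (fst z ** R + snd z ** S)) = \<dots>" .
  show ?thesis
  proof (cases "k = l")
    case True
    then have \<sigma>': "\<sigma> \<in> partitions CARD('l) k" using \<sigma> by simp
    have "(\<lambda>x. ?ql (x ** R)) \<in> homs (2 * k)"
      by (rule homs_compose[OF pull_homs[OF zonal_hom_polys[OF \<sigma>']] linear_matrix_mult_right])
    from fischer_eq[OF A this] have "(\<Sum>a\<in>A. \<alpha> a * ?ql (a ** R)) = fischer (2 * k) ?qk (\<lambda>x. ?ql (x ** R))" by simp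
    then have "E (\<lambda>z. hermite \<kappa> (fst z) * hermite \<sigma> (fst z ** R + snd z ** S)) =
      c * d * (fact (2 * k) * fischer (2 * k) ?qk (\<lambda>x. ?ql (x ** R)))"
      using eq by (simp only: True if_True simp_thms)
    note E = this[unfolded pull_zonal_covariance[OF le \<kappa> \<sigma>' R]]
    show ?thesis
    proof (cases "\<kappa> = \<sigma>")
      case eq: True
      \<comment> \<open>One of the two normalizations c is cancelled by 4^k (n/2)_\<kappa> from the
        squared norm of the zonal polynomial, and the factorials of 2k cancel each other.\<close>
      have "gen_pochhammer CARD('l) (real CARD('n) / 2) \<kappa> > 0" by (rule gen_pochhammer_pos) (use le in simp)
      then have "c * (4 ^ k * gen_pochhammer CARD('l) (real CARD('n) / 2) \<kappa>) = 1" by (simp add: c_def field_simps)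
      moreover have "c * c * (f * (q * r * p / f * u * v)) = c * r * u * v" if "f \<noteq> 0" "c * (q * p) = 1" for f p q r u v :: real
      proof -
        have "c * c * (f * (q * r * p / f * u * v)) = c * (q * p) * (c * r * u * v)" using that(1) by simp
        then show ?thesis using that(2) by simp
      qed
      ultimately have "c * c * (fact (2 * k) * (4 ^ k * fact k * gen_pochhammer CARD('l) (real CARD('n) / 2) \<kappa> / fact (2 * k) * u * v)) = c * fact k * u * v" for u v
        by simp
      moreover have "d = c" by (simp add: c_def d_def True eq)
      ultimately show ?thesis
        unfolding E by (simp only: eq simp_thms of_bool_eq mult_1_left) (simp only: c_def eq)
    qed (simp add: E)
  next
    case False
    then have "\<kappa> \<noteq> \<sigma>" using partitionsD(3)[OF \<kappa>] partitionsD(3)[OF \<sigma>] by auto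
    then show ?thesis using eq False by simp
  qed
qed

theorem theorem3p12:
  fixes M :: "'w measure"
    and X X\<^sub>0 Y :: "'w \<Rightarrow> ('l::{finite,linorder}, 'n::{finite,linorder}) rmat"
    and R :: "('n, 'n) rmat"
    and k l :: nat and \<kappa> \<sigma> :: "nat \<Rightarrow> nat"
  assumes "prob_space M"
    and "CARD('l) \<le> CARD('n)"
    and "std_normal_matrix M X" and "std_normal_matrix M X\<^sub>0"
    and "prob_space.indep_var M borel X borel X\<^sub>0"
    and "transpose R = R" and "pos_semidef (mat 1 - R ** R)"
    and "Y \<in> borel_measurable M"
    and "distr M borel (\<lambda>\<omega>. (X \<omega>, Y \<omega>)) =
         distr M borel (\<lambda>\<omega>. (X \<omega>, X \<omega> ** R + X\<^sub>0 \<omega> ** psd_sqrt (mat 1 - R ** R)))"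
    and "\<kappa> \<in> partitions CARD('l) k" and "\<sigma> \<in> partitions CARD('l) l"
  shows "integrable M (\<lambda>\<omega>. hermite \<kappa> (X \<omega>) * hermite \<sigma> (Y \<omega>)) \<and>
         prob_space.expectation M (\<lambda>\<omega>. hermite \<kappa> (X \<omega>) * hermite \<sigma> (Y \<omega>)) =
           of_bool (\<kappa> = \<sigma>) * inverse (4 ^ k) *
           inverse (gen_pochhammer CARD('l) (real CARD('n) / 2) \<kappa>) * fact k *
           zonal \<kappa> (R ** R) *
           (zonal \<kappa> (mat 1 :: ('l, 'l) rmat) / zonal \<kappa> (mat 1 :: ('n, 'n) rmat))"
proof -
  define S where "S = psd_sqrt (mat 1 - R ** R)"
  note S = psd_sqrt[OF assms(7), folded S_def]
  interpret prob_space M by fact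
  interpret gaussian M "\<lambda>\<omega>. (X \<omega>, X\<^sub>0 \<omega>)" by (rule gaussian_pair[OF assms(1,3-5)])
  let ?Z = "\<lambda>\<omega>. (X \<omega>, X \<omega> ** R + X\<^sub>0 \<omega> ** S)"
  \<comment> \<open>Integrability and expectation depend only on the joint law, so Y may be replaced
    by X R + X0 S; the integrand is then a polynomial in the Gaussian pair (X, X0).\<close>
  define G where "G z = hermite \<kappa> (fst z) * hermite \<sigma> (snd z)" for z :: "('l, 'n) rmat \<times> ('l, 'n) rmat"
  have linS: "linear (\<lambda>z :: ('l, 'n) rmat \<times> ('l, 'n) rmat. fst z ** R + snd z ** S)"
    by (intro linear_compose_add linear_compose[OF linear_fst linear_matrix_mult_right, unfolded o_def]
        linear_compose[OF linear_snd linear_matrix_mult_right, unfolded o_def])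
  have G: "G \<in> borel_measurable borel"
    unfolding G_def[abs_def]
    by (intro polys_measurable polys_mult polys_compose[OF hermite_polys[OF assms(2,10)] linear_fst]
        polys_compose[OF hermite_polys[OF assms(2,11)] linear_snd])
  have [measurable]: "X \<in> borel_measurable M" "X\<^sub>0 \<in> borel_measurable M" "Y \<in> borel_measurable M"
    using indep_var_rv1[OF assms(5)] indep_var_rv2[OF assms(5)] assms(8) by auto
  have XY: "(\<lambda>\<omega>. (X \<omega>, Y \<omega>)) \<in> borel_measurable M" by (intro borel_measurable_Pair) measurable
  have "(\<lambda>z :: ('l, 'n) rmat \<times> ('l, 'n) rmat. fst z ** R + snd z ** S) \<in> borel_measurable borel"
    using linS by (intro borel_measurable_continuous_onI linear_continuous_on) (simp add: linear_conv_bounded_linear)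
  from measurable_compose[OF borel_measurable_Pair this, of X M X\<^sub>0]
  have XZ: "?Z \<in> borel_measurable M" by (intro borel_measurable_Pair) auto
  have d: "distr M borel (\<lambda>\<omega>. (X \<omega>, Y \<omega>)) = distr M borel ?Z"
    using assms(9) by (simp add: S_def)
  have "(\<lambda>z :: ('l, 'n) rmat \<times> ('l, 'n) rmat. hermite \<kappa> (fst z) * hermite \<sigma> (fst z ** R + snd z ** S)) \<in> polys"
    by (intro polys_mult polys_compose[OF hermite_polys[OF assms(2,10)] linear_fst]
        polys_compose[OF hermite_polys[OF assms(2,11)] linS])
  from integrable_polys[OF this] have int: "integrable M (\<lambda>\<omega>. G (?Z \<omega>))" by (simp add: G_def)
  have "integrable M (\<lambda>\<omega>. G (X \<omega>, Y \<omega>))"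
    using int integrable_distr_eq[OF XY G] integrable_distr_eq[OF XZ G] d by simp
  moreover have "expectation (\<lambda>\<omega>. G (X \<omega>, Y \<omega>)) = expectation (\<lambda>\<omega>. G (?Z \<omega>))"
    using integral_distr[OF XY G] integral_distr[OF XZ G] d by simp
  moreover have "expectation (\<lambda>\<omega>. G (?Z \<omega>)) = E (\<lambda>z. hermite \<kappa> (fst z) * hermite \<sigma> (fst z ** R + snd z ** S))"
    by (simp add: E_def G_def)
  moreover have "transpose S = S" using S(1) by (simp add: pos_semidef_def)
  ultimately show ?thesis
    using hermite_covariance[OF gaussian_axioms assms(2,10,11,6), of S] S(2) by (simp add: G_def)
qed

end
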